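(* Let $\Delta$ be a polar space of type $\mathsf{D}_n$, $n\ge 4$. Every collineation $\theta$ of $\Delta$ with opposition diagram $\mathsf{D}_{n;1}^1$ is an involution pointwise fixing a polar subspace of type $\mathsf{B}_{n-1}$. It follows that $\theta$ is automatically type-rotating, that is, it interchanges the two families of maximal singular subspaces of $\Delta$.
   Context: A polar space of type $\mathsf D_n$ over a commutative field $\mathbb K$ is the hyperbolic quadric $X_{-n}X_n+\cdots+X_{-1}X_1=0$ in $\mathrm{PG}(2n-1,\mathbb K)$; its maximal singular subspaces form two families, two members being in the same family iff their intersection has even codimension in each. A polar subspace of type $\mathsf B_{n-1}$ is a subspace that is a parabolic quadric of rank $n-1$ (standard equation $X_{-(n-1)}X_{n-1}+\cdots+X_{-1}X_1=X_0^2$ in $\mathrm{PG}(2n-2,\mathbb K)$). Points are opposite iff non-collinear; singular subspaces $X,Y$ are opposite iff they have the same projective dimension and every point of $X$ is opposite some point of $Y$. $\mathrm{Diag}(\theta)=\mathsf D_{n;1}^1$ means that $\theta$ maps some point to an opposite point, but maps no singular subspace of positive dimension to an opposite one. *)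

theory Defs
  imports "HOL-Analysis.Cartesian_Space"
begin

text \<open>
  The type-\<open>D\<^sub>n\<close> polar space over a field \<open>'k\<close> lives in the vector space \<open>'k ^ ('n + 'n)\<close>, where
  \<open>n = CARD('n)\<close>; the coordinates \<open>X\<^sub>-\<^sub>i\<close> and \<open>X\<^sub>i\<close> are those with index \<open>Inl i\<close> and \<open>Inr i\<close>.
  A point of the projective space is a 1-dimensional linear subspace, and a projective subspace
  is identified with its set of points.
\<close>

definition hyp_form :: "'k::field ^ ('n::finite + 'n) \<Rightarrow> 'k" where
  "hyp_form v = (\<Sum>i\<in>UNIV. v $ Inl i * v $ Inr i)"

definition proj_points :: "('k::field ^ ('n::finite + 'n)) set \<Rightarrow> ('k ^ ('n + 'n)) set set" where
  "proj_points U = {P. vec.subspace P \<and> vec.dim P = 1 \<and> P \<subseteq> U}"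

definition polar_points :: "('k::field ^ ('n::finite + 'n)) set set" where
  "polar_points = {P \<in> proj_points UNIV. \<forall>v\<in>P. hyp_form v = 0}"

definition singular_subspaces :: "('k::field ^ ('n::finite + 'n)) set set set" where
  "singular_subspaces =
     {X. X \<subseteq> polar_points \<and> (\<exists>U. vec.subspace U \<and> X = proj_points U)}"

text \<open>Projective dimension of a projective subspace; the empty subspace has dimension -1.\<close>

definition pdim :: "('k::field ^ ('n::finite + 'n)) set set \<Rightarrow> int" where
  "pdim X = int (vec.dim (\<Union>X)) - 1"

definition polar_lines :: "('k::field ^ ('n::finite + 'n)) set set set" where
  "polar_lines = {L \<in> singular_subspaces. pdim L = 1}"

definition collinear_points ::
    "('k::field ^ ('n::finite + 'n)) set \<Rightarrow> ('k ^ ('n + 'n)) set \<Rightarrow> bool" where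
  "collinear_points P Q \<longleftrightarrow> (\<exists>L\<in>polar_lines. P \<in> L \<and> Q \<in> L)"

definition opposite_points ::
    "('k::field ^ ('n::finite + 'n)) set \<Rightarrow> ('k ^ ('n + 'n)) set \<Rightarrow> bool" where
  "opposite_points P Q \<longleftrightarrow>
     P \<in> polar_points \<and> Q \<in> polar_points \<and> \<not> collinear_points P Q"

definition opposite_subspaces ::
    "('k::field ^ ('n::finite + 'n)) set set \<Rightarrow> ('k ^ ('n + 'n)) set set \<Rightarrow> bool" where
  "opposite_subspaces X Y \<longleftrightarrow>
     X \<in> singular_subspaces \<and> Y \<in> singular_subspaces \<and> pdim X = pdim Y \<and>
     (\<forall>P\<in>X. \<exists>Q\<in>Y. opposite_points P Q)"

text \<open>
  A collineation is a self-map of the point set; its values outside \<open>polar_points\<close> are irrelevant.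
\<close>

definition collineation ::
    "(('k::field ^ ('n::finite + 'n)) set \<Rightarrow> ('k ^ ('n + 'n)) set) \<Rightarrow> bool" where
  "collineation \<theta> \<longleftrightarrow>
     bij_betw \<theta> polar_points polar_points \<and>
     (\<forall>L\<subseteq>polar_points. \<theta> ` L \<in> polar_lines \<longleftrightarrow> L \<in> polar_lines)"

definition opposition_diagram_Dn11 ::
    "(('k::field ^ ('n::finite + 'n)) set \<Rightarrow> ('k ^ ('n + 'n)) set) \<Rightarrow> bool" where
  "opposition_diagram_Dn11 \<theta> \<longleftrightarrow>
     (\<exists>P\<in>polar_points. opposite_points P (\<theta> P)) \<and>
     (\<forall>X\<in>singular_subspaces. pdim X > 0 \<longrightarrow> \<not> opposite_subspaces X (\<theta> ` X))"

definition involution ::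
    "(('k::field ^ ('n::finite + 'n)) set \<Rightarrow> ('k ^ ('n + 'n)) set) \<Rightarrow> bool" where
  "involution \<theta> \<longleftrightarrow>
     (\<forall>P\<in>polar_points. \<theta> (\<theta> P) = P) \<and> (\<exists>P\<in>polar_points. \<theta> P \<noteq> P)"

definition polar_subspace :: "('k::field ^ ('n::finite + 'n)) set set \<Rightarrow> bool" where
  "polar_subspace S \<longleftrightarrow>
     S \<subseteq> polar_points \<and>
     (\<forall>L\<in>polar_lines. (\<exists>P\<in>L \<inter> S. \<exists>Q\<in>L \<inter> S. P \<noteq> Q) \<longrightarrow> L \<subseteq> S)"

text \<open>
  With \<open>m = n - 1\<close>, the independent vectors \<open>e\<^sub>-\<^sub>m, \<dots>, e\<^sub>m\<close> are a coordinate frame of a subspace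
  \<open>PG(2n-2, K)\<close>, in which \<open>S\<close> is to have the standard equation of a parabolic quadric. Only the
  zero set matters, so the ambient form may restrict to a scalar multiple of the standard one.
\<close>

definition polar_subspace_B :: "('k::field ^ ('n::finite + 'n)) set set \<Rightarrow> bool" where
  "polar_subspace_B S \<longleftrightarrow>
     polar_subspace S \<and>
     (let m = CARD('n) - 1; I = {- int m..int m} in
      \<exists>e :: int \<Rightarrow> 'k ^ ('n + 'n). inj_on e I \<and> vec.independent (e ` I) \<and>
        S = {vec.span {\<Sum>i\<in>I. x i *s e i} | x.
               (\<exists>i\<in>I. x i \<noteq> 0) \<and> (\<Sum>i=1..int m. x (- i) * x i) = (x 0)\<^sup>2})"

definition maximal_singular :: "('k::field ^ ('n::finite + 'n)) set set set" where
  "maximal_singular =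
     {M \<in> singular_subspaces. \<forall>X\<in>singular_subspaces. M \<subseteq> X \<longrightarrow> X = M}"

definition same_family :: "(('k::field ^ ('n::finite + 'n)) set set) rel" where
  "same_family =
     {(M, N). M \<in> maximal_singular \<and> N \<in> maximal_singular \<and>
        even (pdim M - pdim (M \<inter> N)) \<and> even (pdim N - pdim (M \<inter> N))}"

definition families :: "('k::field ^ ('n::finite + 'n)) set set set set" where
  "families = maximal_singular // same_family"

definition type_rotating ::
    "(('k::field ^ ('n::finite + 'n)) set \<Rightarrow> ('k ^ ('n + 'n)) set) \<Rightarrow> bool" where
  "type_rotating \<theta> \<longleftrightarrow>
     (\<exists>F G. F \<noteq> G \<and> families = {F, G} \<and> (`) \<theta> ` F = G \<and> (`) \<theta> ` G = F)"

end

(* Idea. Work with a map g on singular vectors representing the collineation, and let e be a point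
   mapped to an opposite point g e. Since no line and no plane is opposite its image, every point r
   collinear to both e and g e is mapped into the span of r and g e, and playing two such e against
   each other shows that r is fixed. The cone over these points is then mapped by
   g (e + h) ~ g e + a h with a constant a, which is what the reflection in p = a e - g e does. All
   points of the perp of p are fixed, and since they determine every other point v up to its mirror
   image, g agrees with this reflection everywhere. A reflection fixes the parabolic quadric p^perp
   and moves every maximal singular subspace to one meeting it in a hyperplane, hence changes its
   family. *)
theory Submission
  imports Defs
begin

section \<open>The hyperbolic quadratic space\<close>

text \<open>The representing map \<open>g\<close> is chosen separately at each point and is
  determined there only up to a scalar, so it cannot be treated as linear or semilinear.
  Coefficients in an image vector are read off by pairing with vectors of known orthogonality;
  \<open>e\<close> is the main probe, being orthogonal to the points collinear to both
  \<open>e\<close> and \<open>g e\<close>, but not to \<open>g e\<close>. The vector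
  \<open>p\<close> arises because \<open>a (e + h)\<close> and \<open>g e + a h\<close>, which
  represent a point of the cone and its image, differ by \<open>a e - g e\<close> for every
  \<open>h\<close>. A point of the perp of \<open>p\<close> that is not collinear to
  \<open>e\<close> is treated by replacing \<open>e\<close> with a suitable \<open>e + h\<close>,
  also mapped to an opposite point. For \<open>v\<close> off this perp, every point collinear to
  \<open>v\<close> and to its mirror image is fixed, so \<open>g v\<close> lies on the line joining
  these two, where no other point is singular. It then remains to exclude that \<open>v\<close>
  itself is fixed, which is done by spreading from \<open>e\<close> along collinear points. The
  field may have characteristic 2, so the quadratic form and its polar form are kept apart and no
  step divides by 2.\<close>

definition hyp_bil :: "'k::field ^ ('n::finite + 'n) \<Rightarrow> 'k ^ ('n + 'n) \<Rightarrow> 'k" where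
  "hyp_bil v w = (\<Sum>i\<in>UNIV. v $ Inl i * w $ Inr i + v $ Inr i * w $ Inl i)"

lemma hyp_bil_commute: "hyp_bil v w = hyp_bil w v"
  unfolding hyp_bil_def by (intro sum.cong) (auto simp: algebra_simps)

lemma hyp_bil_add_left: "hyp_bil (v + v') w = hyp_bil v w + hyp_bil v' w"
  unfolding hyp_bil_def sum.distrib[symmetric] by (intro sum.cong) (auto simp: algebra_simps)

lemma hyp_bil_add_right: "hyp_bil w (v + v') = hyp_bil w v + hyp_bil w v'"
  by (metis hyp_bil_add_left hyp_bil_commute)

lemma hyp_bil_scale_left: "hyp_bil (c *s v) w = c * hyp_bil v w"
  unfolding hyp_bil_def sum_distrib_left by (intro sum.cong) (auto simp: algebra_simps)

lemma hyp_bil_scale_right: "hyp_bil w (c *s v) = c * hyp_bil w v"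
  by (metis hyp_bil_scale_left hyp_bil_commute)

lemma hyp_bil_zero_left: "hyp_bil 0 w = 0"
  by (simp add: hyp_bil_def)

lemma hyp_bil_zero_right: "hyp_bil w 0 = 0"
  by (simp add: hyp_bil_def)

lemma hyp_bil_minus_left: "hyp_bil (- v) w = - hyp_bil v w"
  by (simp add: hyp_bil_def sum_negf[symmetric])

lemma hyp_bil_minus_right: "hyp_bil w (- v) = - hyp_bil w v"
  by (metis hyp_bil_minus_left hyp_bil_commute)

lemma hyp_bil_diff_left: "hyp_bil (v - v') w = hyp_bil v w - hyp_bil v' w"
  by (metis hyp_bil_add_left hyp_bil_minus_left diff_conv_add_uminus)

lemma hyp_bil_diff_right: "hyp_bil w (v - v') = hyp_bil w v - hyp_bil w v'"
  by (metis hyp_bil_diff_left hyp_bil_commute)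

lemmas hyp_bil_simps = hyp_bil_add_left hyp_bil_add_right hyp_bil_scale_left hyp_bil_scale_right
  hyp_bil_zero_left hyp_bil_zero_right hyp_bil_minus_left hyp_bil_minus_right
  hyp_bil_diff_left hyp_bil_diff_right

lemma hyp_bil_sum_left: "hyp_bil (\<Sum>i\<in>A. f i) w = (\<Sum>i\<in>A. hyp_bil (f i) w)"
  by (induction A rule: infinite_finite_induct) (simp_all add: hyp_bil_simps)

lemma hyp_bil_sum_right: "hyp_bil w (\<Sum>i\<in>A. f i) = (\<Sum>i\<in>A. hyp_bil w (f i))"
  by (induction A rule: infinite_finite_induct) (simp_all add: hyp_bil_simps)

lemma hyp_form_zero: "hyp_form 0 = 0"
  by (simp add: hyp_form_def)

lemma hyp_form_add: "hyp_form (v + w) = hyp_form v + hyp_form w + hyp_bil v w"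
  unfolding hyp_bil_def hyp_form_def sum.distrib[symmetric]
  by (intro sum.cong) (auto simp: algebra_simps)

lemma hyp_form_scale: "hyp_form (c *s v) = c * c * hyp_form v"
  unfolding hyp_form_def sum_distrib_left by (intro sum.cong) (auto simp: algebra_simps)

lemma hyp_form_minus: "hyp_form (- v) = hyp_form v"
  by (simp add: hyp_form_def)

lemma hyp_form_diff: "hyp_form (v - w) = hyp_form v + hyp_form w - hyp_bil v w"
  using hyp_form_add[of v "- w"] by (simp add: hyp_form_minus hyp_bil_simps)

lemmas hyp_form_simps = hyp_form_zero hyp_form_add hyp_form_scale hyp_form_minus hyp_form_diff

text \<open>In characteristic 2 the right-hand side vanishes, so \<open>hyp_bil\<close> is
  alternating and does not recover \<open>hyp_form\<close>; this is why both forms are carried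
  along.\<close>

lemma hyp_bil_self: "hyp_bil v v = 2 * hyp_form v"
  unfolding hyp_form_def hyp_bil_def sum_distrib_left by (intro sum.cong) (auto simp: algebra_simps)

lemma hyp_bil_self_singular: "hyp_form v = 0 \<Longrightarrow> hyp_bil v v = 0"
  by (simp add: hyp_bil_self)

lemma hyp_bil_axis:
  "hyp_bil w (axis (Inr j) 1) = w $ Inl j" "hyp_bil w (axis (Inl j) 1) = w $ Inr j"
  by (simp_all add: hyp_bil_def axis_def sum.distrib if_distrib[of "(*) _"] cong: if_cong)

text \<open>Prescribed values on an independent set extend to a linear functional, and by
  nondegeneracy every linear functional is the pairing with some vector.\<close>

lemma ex_hyp_bil_eq:
  fixes S :: "('k::field ^ ('n::finite + 'n)) set"
  assumes "vec.independent S"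
  shows "\<exists>v. \<forall>x\<in>S. hyp_bil v x = t x"
proof -
  fix a :: "'n + 'n"
  \<comment> \<open>The extension theorem is applied to a vector-valued map; the scalar functional
    is stored in its coordinate \<open>a\<close>.\<close>
  obtain f :: "'k ^ ('n + 'n) \<Rightarrow> 'k ^ ('n + 'n)"
    where f: "\<forall>x\<in>S. f x = t x *s axis a 1" and lin: "Vector_Spaces.linear (*s) (*s) f"
    using vec.linear_independent_extend[OF assms, of "\<lambda>x. t x *s axis a 1"] by blast
  define b where "b j = f (axis j 1) $ a" for j
  \<comment> \<open>The pairing matches \<open>Inl i\<close> with \<open>Inr i\<close>, so the
    coefficients of the functional enter with the two halves exchanged.\<close>
  define v :: "'k ^ ('n + 'n)" where "v = (\<chi> j. case j of Inl i \<Rightarrow> b (Inr i) | Inr i \<Rightarrow> b (Inl i))"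
  have "hyp_bil v x = t x" if "x \<in> S" for x
  proof -
    have "f x = f (\<Sum>j\<in>UNIV. x $ j *s axis j 1)"
      by (simp add: basis_expansion)
    also have "\<dots> = (\<Sum>j\<in>UNIV. x $ j *s f (axis j 1))"
      by (simp add: vec.linear_sum[OF lin] vec.linear_scale[OF lin])
    finally have "f x $ a = (\<Sum>j\<in>UNIV. x $ j * b j)"
      by (simp add: b_def sum_component)
    then have "t x = (\<Sum>j\<in>UNIV. x $ j * b j)"
      using f that by simp
    also have "\<dots> = (\<Sum>i\<in>UNIV. x $ Inl i * b (Inl i)) + (\<Sum>i\<in>UNIV. x $ Inr i * b (Inr i))"
      unfolding UNIV_Plus_UNIV[symmetric] by (subst sum.Plus) auto
    also have "\<dots> = hyp_bil v x"
      by (simp add: hyp_bil_def v_def sum.distrib algebra_simps)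
    finally show ?thesis by simp
  qed
  then show ?thesis by blast
qed

section \<open>Orthogonal complements and totally singular subspaces\<close>

definition hyp_perp :: "('k::field ^ ('n::finite + 'n)) set \<Rightarrow> ('k ^ ('n + 'n)) set" where
  "hyp_perp C = {x. \<forall>c\<in>C. hyp_bil x c = 0}"

lemma subspace_hyp_perp: "vec.subspace (hyp_perp C)"
  by (auto simp: hyp_perp_def vec.subspace_def hyp_bil_simps)

lemma hyp_perp_span: "hyp_perp (vec.span C) = hyp_perp C"
proof -
  have "hyp_bil x c = 0" if "x \<in> hyp_perp C" "c \<in> vec.span C" for x c
    using that(2) by (induction rule: vec.span_induct_alt)
      (use that(1) in \<open>auto simp: hyp_perp_def hyp_bil_simps\<close>)
  then show ?thesis by (auto simp: hyp_perp_def vec.span_base)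
qed

text \<open>Each vector of \<open>C\<close> imposes one linear condition, which lowers the dimension
  by at most one.\<close>

lemma dim_le_inter_hyp_perp:
  fixes M :: "('k::field ^ ('n::finite + 'n)) set"
  assumes "finite C" "vec.subspace M"
  shows "vec.dim M \<le> vec.dim (M \<inter> hyp_perp C) + card C"
  using assms(1)
proof (induction C rule: finite_induct)
  case empty
  then show ?case by (simp add: hyp_perp_def)
next
  case (insert c C)
  let ?M = "M \<inter> hyp_perp C" and ?N = "M \<inter> hyp_perp (insert c C)"
  have "vec.dim ?M \<le> vec.dim ?N + 1"
  proof (cases "\<exists>u\<in>?M. hyp_bil u c \<noteq> 0")
    case True
    then obtain u where u: "u \<in> ?M" "hyp_bil u c \<noteq> 0" by blast
    have "x \<in> vec.span (insert u ?N)" if x: "x \<in> ?M" for x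
    proof -
      have sub: "vec.subspace ?M"
        using assms(2) subspace_hyp_perp vec.subspace_inter by blast
      let ?r = "hyp_bil x c / hyp_bil u c"
      have "x - ?r *s u \<in> ?M"
        by (intro vec.subspace_diff vec.subspace_scale sub x u)
      then have "x - ?r *s u \<in> ?N"
        using u by (auto simp: hyp_perp_def hyp_bil_simps)
      then show ?thesis
        using vec.span_breakdown_eq vec.span_base by blast
    qed
    then have "?M \<subseteq> vec.span (insert u ?N)" by blast
    then have "vec.dim ?M \<le> vec.dim (insert u ?N)" by (rule vec.dim_mono)
    also have "\<dots> \<le> vec.dim ?N + 1" by (simp add: vec.dim_insert)
    finally show ?thesis .
  next
    case False
    then have "?M \<subseteq> ?N" by (auto simp: hyp_perp_def)
    from vec.dim_subset[OF this] show ?thesis by simp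
  qed
  then show ?case using insert by simp
qed

definition tot_sing :: "('k::field ^ ('n::finite + 'n)) set \<Rightarrow> bool" where
  "tot_sing U \<longleftrightarrow> vec.subspace U \<and> (\<forall>v\<in>U. hyp_form v = 0)"

lemma tot_sing_hyp_bil: "tot_sing U \<Longrightarrow> v \<in> U \<Longrightarrow> w \<in> U \<Longrightarrow> hyp_bil v w = 0"
  by (metis hyp_form_add tot_sing_def vec.subspace_add add_0)

lemma tot_sing_span_insert:
  assumes U: "tot_sing U" and x: "hyp_form x = 0" "x \<in> hyp_perp U"
  shows "tot_sing (vec.span (insert x U))"
proof -
  have "hyp_form y = 0" if y: "y \<in> vec.span (insert x U)" for y
  proof -
    obtain k where k: "y - k *s x \<in> U"
      using y vec.span_breakdown_eq[of y x U] U vec.span_eq_iff tot_sing_def by metis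
    define z where "z = y - k *s x"
    have "y = z + k *s x" by (simp add: z_def)
    moreover have "hyp_form z = 0" "hyp_bil x z = 0"
      using k U x by (auto simp: z_def tot_sing_def hyp_perp_def)
    ultimately show ?thesis
      by (simp add: hyp_form_simps hyp_bil_simps x hyp_bil_commute[of z])
  qed
  then show ?thesis by (simp add: tot_sing_def)
qed

text \<open>A basis of \<open>Z\<close> is chosen to extend one of \<open>M \<inter> Z\<close>. Only
  its members outside \<open>M\<close> restrict a vector of \<open>M\<close>, because
  \<open>M\<close> is totally singular; so the part of \<open>M\<close> orthogonal to
  \<open>Z\<close> has dimension at least \<open>dim M - dim Z + dim (M \<inter> Z)\<close>, more
  than that of \<open>M \<inter> Z\<close>.\<close>

lemma ex_perp_not_mem:
  fixes M Z :: "('k::field ^ ('n::finite + 'n)) set"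
  assumes M: "tot_sing M" and Z: "vec.subspace Z" and dim: "vec.dim Z < vec.dim M"
  shows "\<exists>x\<in>M. x \<in> hyp_perp Z \<and> x \<notin> Z"
proof -
  obtain A where A: "A \<subseteq> M \<inter> Z" "vec.independent A" "M \<inter> Z \<subseteq> vec.span A" "card A = vec.dim (M \<inter> Z)"
    using vec.basis_exists[of "M \<inter> Z"] by blast
  obtain A' where A': "A \<subseteq> A'" "A' \<subseteq> Z" "vec.independent A'" "Z \<subseteq> vec.span A'"
    using vec.maximal_independent_subset_extend[of A Z] A by auto
  have fin: "finite A'" using A'(3) vec.finiteI_independent by blast
  have cA': "card A' = vec.dim Z"
    using A' vec.basis_card_eq_dim by blast
  have "card (A' - A) = vec.dim Z - vec.dim (M \<inter> Z)"
    using A A' fin by (simp add: cA' card_Diff_subset finite_subset)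
  moreover have le: "vec.dim (M \<inter> Z) \<le> vec.dim Z"
    by (simp add: vec.dim_subset)
  moreover have "vec.dim M \<le> vec.dim (M \<inter> hyp_perp (A' - A)) + card (A' - A)"
    using dim_le_inter_hyp_perp fin M tot_sing_def by blast
  ultimately have d: "vec.dim (M \<inter> Z) < vec.dim (M \<inter> hyp_perp (A' - A))"
    using dim by linarith
  have "M \<inter> hyp_perp (A' - A) \<subseteq> hyp_perp A'"
    using A tot_sing_hyp_bil[OF M] by (auto simp: hyp_perp_def)
  moreover have "hyp_perp A' = hyp_perp Z"
    by (metis A' Z hyp_perp_span vec.span_subspace)
  moreover obtain x where "x \<in> M \<inter> hyp_perp (A' - A)" "x \<notin> M \<inter> Z"
    using d vec.dim_subset by (metis leD subsetI)
  ultimately show ?thesis by blast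
qed

section \<open>Hyperbolic frames\<close>

definition frame_index :: "nat \<Rightarrow> int set" where
  "frame_index k = {- int k..int k} - {0}"

lemma finite_frame_index [simp]: "finite (frame_index k)"
  by (simp add: frame_index_def)

lemma card_frame_index: "card (frame_index k) = 2 * k"
  by (simp add: frame_index_def)

lemma uminus_frame_index: "- i \<in> frame_index k \<longleftrightarrow> i \<in> frame_index k"
  by (auto simp: frame_index_def)

lemma frame_index_Suc:
  "i \<in> frame_index (Suc k) \<longleftrightarrow> i \<in> frame_index k \<or> i = int (Suc k) \<or> i = - int (Suc k)"
  by (auto simp: frame_index_def)

text \<open>These are \<open>k\<close> mutually orthogonal hyperbolic pairs \<open>c i\<close>,
  \<open>c (- i)\<close>; changing the sign of an index exchanges the partners, as in the
  coordinates of the quadric.\<close>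

definition hyp_frame :: "nat \<Rightarrow> (int \<Rightarrow> 'k::field ^ ('n::finite + 'n)) \<Rightarrow> bool" where
  "hyp_frame k c \<longleftrightarrow> (\<forall>i\<in>frame_index k. hyp_form (c i) = 0 \<and>
     (\<forall>j\<in>frame_index k. hyp_bil (c i) (c j) = (if i = - j then 1 else 0)))"

text \<open>Pairing a vanishing combination with \<open>d i\<close> isolates the coefficient of
  \<open>c i\<close>. The values \<open>s i\<close> leave room for the coordinate frame of the
  parabolic quadric, which has a dual family only up to such factors.\<close>

lemma independent_dual_family:
  fixes c d :: "int \<Rightarrow> 'k::field ^ ('n::finite + 'n)"
  assumes fin: "finite I"
    and dual: "\<And>i j. i \<in> I \<Longrightarrow> j \<in> I \<Longrightarrow> hyp_bil (d i) (c j) = (if i = j then s i else 0)"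
    and s: "\<And>i. i \<in> I \<Longrightarrow> s i \<noteq> 0"
  shows "inj_on c I" and "vec.independent (c ` I)"
proof -
  show inj: "inj_on c I"
    by (rule inj_onI) (metis dual s)
  show "vec.independent (c ` I)"
  proof (rule vec.independent_if_scalars_zero)
    fix f x assume "(\<Sum>x\<in>c ` I. f x *s x) = 0" and x: "x \<in> c ` I"
    then have 0: "(\<Sum>i\<in>I. f (c i) *s c i) = 0"
      by (simp add: sum.reindex[OF inj])
    obtain i where i: "i \<in> I" "x = c i" using x by blast
    have "0 = hyp_bil (d i) (\<Sum>j\<in>I. f (c j) *s c j)"
      by (simp add: 0 hyp_bil_simps)
    also have "\<dots> = (\<Sum>j\<in>I. if i = j then f (c j) * s i else 0)"
      unfolding hyp_bil_sum_right by (intro sum.cong) (auto simp: hyp_bil_simps dual i)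
    also have "\<dots> = f x * s i" using i fin by simp
    finally show "f x = 0" using s i by simp
  qed (use fin in simp)
qed

lemma hyp_frame_independent:
  assumes "hyp_frame k c"
  shows "inj_on c (frame_index k)" and "vec.independent (c ` frame_index k)"
proof -
  have "hyp_bil (c (- i)) (c j) = (if i = j then 1 else 0)"
    if "i \<in> frame_index k" "j \<in> frame_index k" for i j
  proof -
    have "- i \<in> frame_index k" using that uminus_frame_index by blast
    then have "hyp_bil (c (- i)) (c j) = (if - i = - j then 1 else 0)"
      using assms that(2) unfolding hyp_frame_def by blast
    then show ?thesis by simp
  qed
  note dual = independent_dual_family[of "frame_index k" "\<lambda>i. c (- i)" c "\<lambda>_. 1",
      OF finite_frame_index this]
  show "inj_on c (frame_index k)" by (rule dual(1)) auto
  show "vec.independent (c ` frame_index k)" by (rule dual(2)) auto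
qed

text \<open>The sum is the orthogonal projection to the span of the frame: the coefficient of
  \<open>c i\<close> is the pairing with its partner.\<close>

lemma hyp_frame_project:
  assumes c: "hyp_frame k c" and j: "j \<in> frame_index k"
  shows "hyp_bil (v - (\<Sum>i\<in>frame_index k. hyp_bil v (c (- i)) *s c i)) (c j) = 0"
proof -
  have "hyp_bil (\<Sum>i\<in>frame_index k. hyp_bil v (c (- i)) *s c i) (c j)
      = (\<Sum>i\<in>frame_index k. if i = - j then hyp_bil v (c (- i)) else 0)"
    unfolding hyp_bil_sum_left
    by (intro sum.cong) (use c j in \<open>auto simp: hyp_bil_simps hyp_frame_def\<close>)
  also have "\<dots> = hyp_bil v (c j)"
    using j by (simp add: uminus_frame_index)
  finally show ?thesis by (simp add: hyp_bil_simps)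
qed

lemma dim_hyp_le: "vec.dim (S :: ('k::field ^ ('n::finite + 'n)) set) \<le> 2 * CARD('n)"
  using dim_subset_UNIV_cart_gen[of S] by simp

lemma hyp_frame_le:
  assumes "hyp_frame k (c :: int \<Rightarrow> 'k::field ^ ('n::finite + 'n))"
  shows "k \<le> CARD('n)"
proof -
  have "2 * k = card (c ` frame_index k)"
    using hyp_frame_independent(1)[OF assms] by (simp add: card_image card_frame_index)
  also have "\<dots> \<le> 2 * CARD('n)"
    using hyp_frame_independent(2)[OF assms] dim_hyp_le
    by (metis vec.dim_eq_card_independent)
  finally show ?thesis by simp
qed

text \<open>With \<open>n\<close> pairs the frame is a basis, so what remains after the projection
  is orthogonal to every vector, in particular to the coordinate vectors, and hence zero.\<close>

lemma hyp_frame_expand: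
  fixes c :: "int \<Rightarrow> 'k::field ^ ('n::finite + 'n)"
  assumes c: "hyp_frame CARD('n) c"
  shows "v = (\<Sum>i\<in>frame_index CARD('n). hyp_bil v (c (- i)) *s c i)"
proof -
  let ?I = "frame_index CARD('n)"
  define w where "w = v - (\<Sum>i\<in>?I. hyp_bil v (c (- i)) *s c i)"
  have "card (c ` ?I) = 2 * CARD('n)"
    using hyp_frame_independent(1)[OF c] by (simp add: card_image card_frame_index)
  then have "UNIV \<subseteq> vec.span (c ` ?I)"
    using hyp_frame_independent(2)[OF c] vec.card_eq_dim[of "c ` ?I" UNIV]
    by (simp del: vec.dim_UNIV add: vec_dim_card)
  moreover have "w \<in> hyp_perp (c ` ?I)"
    using hyp_frame_project[OF c] by (auto simp: hyp_perp_def w_def)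
  ultimately have "w \<in> hyp_perp UNIV"
    by (metis hyp_perp_span top.extremum_uniqueI)
  then have w: "hyp_bil w x = 0" for x
    by (simp add: hyp_perp_def)
  have "w $ Inl j = 0" "w $ Inr j = 0" for j
    using w[of "axis (Inr j) 1"] w[of "axis (Inl j) 1"] by (simp_all add: hyp_bil_axis)
  then have "w $ j = 0" for j by (cases j) auto
  then have "w = 0" by (simp add: vec_eq_iff)
  then show ?thesis by (simp add: w_def)
qed

text \<open>The new pair is made orthogonal to the old frame by projection. Its first vector stays
  in \<open>M\<close>: a vector of \<open>M\<close> pairs to zero with the \<open>c i\<close> of
  positive index, so its projection involves these alone.\<close>

lemma hyp_frame_extend:
  fixes c :: "int \<Rightarrow> 'k::field ^ ('n::finite + 'n)"
  assumes c: "hyp_frame k c" and M: "tot_sing M" "\<And>i. i \<in> {1..int k} \<Longrightarrow> c i \<in> M"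
    and k: "k < vec.dim M"
  shows "\<exists>c'. hyp_frame (Suc k) c' \<and> (\<forall>i\<in>frame_index k. c' i = c i) \<and> c' (int (Suc k)) \<in> M"
proof -
  let ?I = "frame_index k" and ?P = "\<lambda>v. \<Sum>i\<in>frame_index k. hyp_bil v (c (- i)) *s c i"
  have subM: "vec.subspace M" using M tot_sing_def by blast
  have "vec.dim (c ` {1..int k}) \<le> k"
    by (metis card_atLeastAtMost_int card_image_le diff_add_cancel finite_atLeastAtMost_int
        finite_imageI nat_int order_trans vec.dim_le_card vec.span_superset)
  then have "\<exists>x\<in>M. x \<notin> vec.span (c ` {1..int k})"
    using k vec.dim_subset[of M "vec.span (c ` {1..int k})"] by (auto simp: subset_iff)
  then obtain x0 where x0: "x0 \<in> M" "x0 \<notin> vec.span (c ` {1..int k})" by blast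
  define x where "x = x0 - ?P x0"
  have P: "?P x0 \<in> vec.span (c ` {1..int k})"
  proof (rule vec.span_sum)
    fix i assume i: "i \<in> ?I"
    show "hyp_bil x0 (c (- i)) *s c i \<in> vec.span (c ` {1..int k})"
    proof (cases "i > 0")
      case True
      then show ?thesis using i
        by (intro vec.span_scale vec.span_base) (auto simp: frame_index_def)
    next
      case False
      then have "hyp_bil x0 (c (- i)) = 0"
        using i x0 by (intro tot_sing_hyp_bil[OF M(1)] M(2)) (auto simp: frame_index_def)
      then show ?thesis by (simp add: vec.span_zero)
    qed
  qed
  have "x \<noteq> 0" using x0 P by (auto simp: x_def)
  have "vec.span (c ` {1..int k}) \<subseteq> M"
    using M subM by (intro vec.span_minimal) auto
  then have xM: "x \<in> M"
    using P x0 subM by (auto simp: x_def intro: vec.subspace_diff)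
  then have Qx: "hyp_form x = 0" using M tot_sing_def by blast
  have xc: "hyp_bil x (c j) = 0" if "j \<in> ?I" for j
    using hyp_frame_project[OF c that] by (simp add: x_def)
  obtain y0 where y0: "hyp_bil y0 x = 1"
    using ex_hyp_bil_eq[of "{x}" "\<lambda>_. 1"] \<open>x \<noteq> 0\<close> by auto
  define y1 where "y1 = y0 - ?P y0"
  \<comment> \<open>Since \<open>y1\<close> pairs to 1 with the singular vector \<open>x\<close>,
    subtracting \<open>hyp_form y1\<close> times \<open>x\<close> makes it singular, in every
    characteristic.\<close>
  define y where "y = y1 - hyp_form y1 *s x"
  have cx: "hyp_bil (c j) x = 0" if "j \<in> ?I" for j
    using xc[OF that] by (simp add: hyp_bil_commute)
  have "hyp_bil (?P y0) x = 0"
    unfolding hyp_bil_sum_left using cx by (simp add: hyp_bil_simps)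
  then have y1x: "hyp_bil y1 x = 1" by (simp add: y1_def hyp_bil_simps y0)
  have yx: "hyp_bil y x = 1"
    by (simp add: y_def hyp_bil_simps y1x hyp_bil_self_singular Qx)
  have Qy: "hyp_form y = 0"
    by (simp add: y_def hyp_form_simps hyp_bil_simps y1x Qx)
  have yc: "hyp_bil y (c j) = 0" if "j \<in> ?I" for j
    using hyp_frame_project[OF c that] xc[OF that] by (simp add: y_def y1_def hyp_bil_simps)
  have xy: "hyp_bil x y = 1" using yx by (simp add: hyp_bil_commute)
  have cy: "hyp_bil (c j) y = 0" if "j \<in> ?I" for j
    using yc[OF that] by (simp add: hyp_bil_commute)
  let ?c = "c(int (Suc k) := x, - int (Suc k) := y)"
  have notin: "int (Suc k) \<notin> ?I" "- int (Suc k) \<notin> ?I" by (auto simp: frame_index_def)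
  have self: "hyp_bil x x = 0" "hyp_bil y y = 0"
    using Qx Qy hyp_bil_self_singular by blast+
  have old: "?c j = c j" if "j \<in> ?I" for j using that notin by auto
  have newx: "?c (int (Suc k)) = x" and newy: "?c (- int (Suc k)) = y" by auto
  have "hyp_frame (Suc k) ?c"
    unfolding hyp_frame_def
  proof (intro ballI conjI)
    fix i assume "i \<in> frame_index (Suc k)"
    then show "hyp_form (?c i) = 0"
      using c Qx Qy old newx newy unfolding frame_index_Suc hyp_frame_def by metis
  next
    fix i j assume ij: "i \<in> frame_index (Suc k)" "j \<in> frame_index (Suc k)"
    have new: "i \<noteq> - int (Suc k)" "i \<noteq> int (Suc k)" if "i \<in> ?I" for i
      using that by (auto simp: frame_index_def)
    from ij show "hyp_bil (?c i) (?c j) = (if i = - j then 1 else 0)"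
      unfolding frame_index_Suc
    proof (elim disjE)
      assume ij: "i \<in> ?I" "j \<in> ?I"
      then have "?c i = c i" "?c j = c j" by (simp_all only: old)
      then show ?thesis using c ij by (simp add: hyp_frame_def)
    next
      assume ij: "i \<in> ?I" "j = int (Suc k)"
      then have "?c i = c i" "?c j = x" by (simp_all only: old newx newy)
      moreover have "i \<noteq> - j" using ij new[of i] by auto
      ultimately show ?thesis using cx ij by simp
    next
      assume ij: "i \<in> ?I" "j = - int (Suc k)"
      then have "?c i = c i" "?c j = y" by (simp_all only: old newx newy)
      moreover have "i \<noteq> - j" using ij new[of i] by auto
      ultimately show ?thesis using cy ij by simp
    next
      assume ij: "i = int (Suc k)" "j \<in> ?I"
      then have "?c i = x" "?c j = c j" by (simp_all only: old newx newy)
      moreover have "i \<noteq> - j" using ij new[of j] by auto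
      ultimately show ?thesis using xc ij by simp
    next
      assume ij: "i = - int (Suc k)" "j \<in> ?I"
      then have "?c i = y" "?c j = c j" by (simp_all only: old newx newy)
      moreover have "i \<noteq> - j" using ij new[of j] by auto
      ultimately show ?thesis using yc ij by simp
    next
      assume ij: "i = int (Suc k)" "j = int (Suc k)"
      then show ?thesis by (simp add: self)
    next
      assume ij: "i = - int (Suc k)" "j = - int (Suc k)"
      then show ?thesis by (simp add: self)
    next
      assume ij: "i = int (Suc k)" "j = - int (Suc k)"
      then show ?thesis by (simp add: xy)
    next
      assume ij: "i = - int (Suc k)" "j = int (Suc k)"
      then show ?thesis by (simp add: yx)
    qed
  qed
  moreover have "\<forall>i\<in>?I. ?c i = c i" using old by blast
  moreover have "?c (int (Suc k)) \<in> M" using newx xM by metis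
  ultimately show ?thesis by blast
qed

lemma hyp_frame_extend_full:
  fixes c :: "int \<Rightarrow> 'k::field ^ ('n::finite + 'n)"
  assumes c: "hyp_frame k c" and M: "tot_sing M" "\<And>i. i \<in> {1..int k} \<Longrightarrow> c i \<in> M"
    and k: "k \<le> m" "m \<le> vec.dim M"
  shows "\<exists>c'. hyp_frame m c' \<and> (\<forall>i\<in>frame_index k. c' i = c i) \<and> (\<forall>i\<in>{1..int m}. c' i \<in> M)"
  using k
proof (induction m rule: dec_induct)
  case base
  then show ?case using c M by blast
next
  case (step m)
  then obtain c' where c': "hyp_frame m c'" "\<forall>i\<in>frame_index k. c' i = c i" "\<forall>i\<in>{1..int m}. c' i \<in> M"
    by auto
  then obtain c'' where c'': "hyp_frame (Suc m) c''" "\<forall>i\<in>frame_index m. c'' i = c' i"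
    "c'' (int (Suc m)) \<in> M"
    using hyp_frame_extend[of m c' M] M(1) step by auto
  have "i \<in> frame_index m" if "i \<in> frame_index k" for i
    using that step(1) by (auto simp: frame_index_def)
  moreover have "c'' i \<in> M" if "i \<in> {1..int (Suc m)}" for i
  proof (cases "i = int (Suc m)")
    case False
    then have "i \<in> {1..int m}" "i \<in> frame_index m" using that by (auto simp: frame_index_def)
    then show ?thesis using c' c'' by simp
  qed (use c'' in simp)
  ultimately have "\<forall>i\<in>frame_index k. c'' i = c i" "\<forall>i\<in>{1..int (Suc m)}. c'' i \<in> M"
    using c'(2) c''(2) by (simp_all del: atLeastAtMost_iff)
  then show ?case using c''(1) by blast
qed

lemma tot_sing_frame:
  assumes "tot_sing M"
  shows "\<exists>c. hyp_frame (vec.dim M) c \<and> (\<forall>i\<in>{1..int (vec.dim M)}. c i \<in> M)"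
proof -
  have "hyp_frame 0 (\<lambda>_. 0)" by (simp add: hyp_frame_def frame_index_def)
  from hyp_frame_extend_full[OF this assms, of "vec.dim M"] show ?thesis by fastforce
qed

text \<open>A frame with its positive half in \<open>M\<close> consists of \<open>2 * dim M\<close>
  independent vectors.\<close>

lemma tot_sing_dim_le:
  fixes M :: "('k::field ^ ('n::finite + 'n)) set"
  assumes "tot_sing M"
  shows "vec.dim M \<le> CARD('n)"
  using tot_sing_frame[OF assms] hyp_frame_le by blast

text \<open>Some full frame has its positive half in \<open>M\<close>. For \<open>v\<close>
  orthogonal to \<open>M\<close> the coefficients at negative indices are pairings with vectors of
  \<open>M\<close>, so \<open>v\<close> is a combination of the positive half.\<close>

lemma tot_sing_perp_subset:
  fixes M :: "('k::field ^ ('n::finite + 'n)) set"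
  assumes M: "tot_sing M" "vec.dim M = CARD('n)"
  shows "hyp_perp M \<subseteq> M"
proof
  fix v assume v: "v \<in> hyp_perp M"
  obtain c where c: "hyp_frame CARD('n) c" "\<forall>i\<in>{1..int CARD('n)}. c i \<in> M"
    using tot_sing_frame[OF M(1)] M(2) by auto
  have sub: "vec.subspace M" using M by (simp add: tot_sing_def)
  have "(\<Sum>i\<in>frame_index CARD('n). hyp_bil v (c (- i)) *s c i) \<in> M"
  proof (rule vec.subspace_sum[OF sub])
    fix i assume i: "i \<in> frame_index CARD('n)"
    show "hyp_bil v (c (- i)) *s c i \<in> M"
    proof (cases "i > 0")
      case True
      then show ?thesis using i c sub by (auto simp: frame_index_def intro: vec.subspace_scale)
    next
      case False
      then have "c (- i) \<in> M" using i c by (auto simp: frame_index_def)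
      then show ?thesis using v sub by (simp add: hyp_perp_def vec.subspace_0)
    qed
  qed
  then show "v \<in> M" using hyp_frame_expand[OF c(1), of v] by simp
qed

lemma ex_tot_sing_max:
  "\<exists>M :: ('k::field ^ ('n::finite + 'n)) set. tot_sing M \<and> vec.dim M = CARD('n)"
proof -
  let ?M = "{x :: 'k ^ ('n + 'n). \<forall>i. i \<notin> range Inl \<longrightarrow> x $ i = 0}"
  have "vec.dim ?M = CARD('n)"
    by (simp add: dim_substandard_cart card_image)
  moreover have "tot_sing ?M"
    unfolding tot_sing_def
  proof
    show "vec.subspace ?M" by (auto simp: vec.subspace_def)
    show "\<forall>v\<in>?M. hyp_form v = 0" by (auto simp: hyp_form_def intro!: sum.neutral)
  qed
  ultimately show ?thesis by blast
qed

text \<open>As long as \<open>U\<close> is smaller than a totally singular \<open>M0\<close> of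
  dimension \<open>n\<close>, the dimension count gives a vector of \<open>M0\<close> orthogonal to
  \<open>U\<close> and outside it, which can be adjoined.\<close>

lemma tot_sing_extend:
  fixes U :: "('k::field ^ ('n::finite + 'n)) set"
  assumes "tot_sing U"
  shows "\<exists>M. tot_sing M \<and> U \<subseteq> M \<and> vec.dim M = CARD('n)"
  using assms
proof (induction "CARD('n) - vec.dim U" arbitrary: U)
  case 0
  then show ?case using tot_sing_dim_le by (metis diff_is_0_eq le_antisym order_refl)
next
  case (Suc d)
  obtain M0 :: "('k ^ ('n + 'n)) set" where M0: "tot_sing M0" "vec.dim M0 = CARD('n)"
    using ex_tot_sing_max by blast
  have "vec.subspace U" "vec.dim U < vec.dim M0"
    using Suc(2,3) M0 by (simp_all add: tot_sing_def)
  then obtain x where x: "x \<in> M0" "x \<in> hyp_perp U" "x \<notin> U"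
    using ex_perp_not_mem[OF M0(1)] by blast
  let ?U = "vec.span (insert x U)"
  have "tot_sing ?U" using tot_sing_span_insert Suc x M0 tot_sing_def by blast
  moreover have "vec.dim ?U = Suc (vec.dim U)"
    using x \<open>vec.subspace U\<close> by (simp add: vec.dim_insert vec.span_eq_iff[THEN iffD2])
  moreover from this have "d = CARD('n) - vec.dim ?U" using Suc(2) by linarith
  ultimately obtain M where "tot_sing M" "?U \<subseteq> M" "vec.dim M = CARD('n)"
    using Suc(1)[of ?U] by blast
  then show ?case using vec.span_superset by blast
qed

lemma tot_sing_singleton:
  "hyp_form x = 0 \<Longrightarrow> tot_sing (vec.span {x})"
  unfolding tot_sing_def
  by (rule conjI[OF vec.subspace_span]) (auto simp: vec.span_singleton hyp_form_scale)

text \<open>Only \<open>x\<close>, at index 1, has to lie in the totally singular subspace that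
  steers the extension; \<open>y\<close> sits at index -1.\<close>

lemma hyperbolic_pair_frame:
  fixes x y :: "'k::field ^ ('n::finite + 'n)"
  assumes "hyp_form x = 0" "hyp_form y = 0" "hyp_bil x y = 1"
  shows "\<exists>c. hyp_frame CARD('n) c \<and> c 1 = x \<and> c (-1) = y"
proof -
  obtain M where M: "tot_sing M" "vec.span {x} \<subseteq> M" "vec.dim M = CARD('n)"
    using tot_sing_extend[OF tot_sing_singleton] assms(1) by metis
  define c where "c = (\<lambda>i::int. if i = 1 then x else y)"
  have I: "frame_index (Suc 0) = {1, -1}" by (auto simp: frame_index_def)
  have "hyp_frame (Suc 0) c"
    using assms hyp_bil_self_singular[of x] hyp_bil_self_singular[of y]
    by (auto simp: hyp_frame_def I c_def hyp_bil_commute[of y x])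
  moreover have "c i \<in> M" if "i \<in> {1..int (Suc 0)}" for i
    using that M vec.span_base[of x "{x}"] by (auto simp: c_def)
  ultimately have "\<exists>c'. hyp_frame CARD('n) c' \<and> (\<forall>i\<in>frame_index (Suc 0). c' i = c i) \<and> (\<forall>i\<in>{1..int CARD('n)}. c' i \<in> M)"
    using M by (intro hyp_frame_extend_full) (auto simp: Suc_leI)
  then show ?thesis by (auto simp: I c_def)
qed

section \<open>Proportional singular vectors\<close>

definition sing :: "'k::field ^ ('n::finite + 'n) \<Rightarrow> bool" where
  "sing v \<longleftrightarrow> v \<noteq> 0 \<and> hyp_form v = 0"

definition proportional :: "'k::field ^ 'm \<Rightarrow> 'k ^ 'm \<Rightarrow> bool" where
  "proportional v w \<longleftrightarrow> (\<exists>c. c \<noteq> 0 \<and> v = c *s w)"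

lemma proportional_sym: "proportional v w \<Longrightarrow> proportional w v"
  unfolding proportional_def by (metis inverse_nonzero_iff_nonzero left_inverse vector_smult_assoc vector_smult_lid)

lemma proportional_trans: "proportional u v \<Longrightarrow> proportional v w \<Longrightarrow> proportional u w"
  unfolding proportional_def by (metis mult_eq_0_iff vector_smult_assoc)

lemma proportional_scale: "c \<noteq> 0 \<Longrightarrow> proportional (c *s v) v"
  unfolding proportional_def by blast

lemma proportionalI: "v \<noteq> 0 \<Longrightarrow> v = c *s w \<Longrightarrow> proportional v w"
  unfolding proportional_def by (cases "c = 0") auto

lemma scale_eq_imp_proportional:
  assumes "a *s v = b *s w" "a \<noteq> 0" "v \<noteq> 0"
  shows "proportional v w"
proof -
  have "v = (b / a) *s w"
    using assms(1,2) by (metis divide_self_if vector_smult_assoc vector_smult_lid mult.commute divide_inverse)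
  then show ?thesis using assms(3) proportionalI by blast
qed

lemma proportional_hyp_bil: "proportional v w \<Longrightarrow> hyp_bil v x = 0 \<longleftrightarrow> hyp_bil w x = 0"
  by (auto simp: proportional_def hyp_bil_simps)

lemma sing_scale: "sing v \<Longrightarrow> c \<noteq> 0 \<Longrightarrow> sing (c *s v)"
  by (auto simp: sing_def hyp_form_simps)

lemma comb_eq_0:
  assumes "a *s v + b *s w = 0" "v \<noteq> 0" "w \<noteq> 0" "\<not> proportional v w"
  shows "a = 0 \<and> b = 0"
proof -
  have "a *s v = (- b) *s w"
    using assms(1) by (simp add: eq_neg_iff_add_eq_0)
  then have "a = 0" using scale_eq_imp_proportional assms by blast
  then show ?thesis using assms by simp
qed

lemma sing_hyp_bil_self: "sing v \<Longrightarrow> hyp_bil v v = 0"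
  by (simp add: sing_def hyp_bil_self_singular)

text \<open>In a frame containing \<open>x\<close> and a multiple of \<open>y\<close> as a pair, the
  nonzero vector \<open>w\<close> pairs nontrivially with some member, which is neither of these
  two; a multiple of this member serves as \<open>h\<close>.\<close>

lemma ex_sing_partner:
  fixes x y w :: "'k::field ^ ('n::finite + 'n)"
  assumes x: "sing x" and y: "sing y" and xy: "hyp_bil x y \<noteq> 0"
    and w: "hyp_bil w x = 0" "hyp_bil w y = 0" "w \<noteq> 0" and s: "s \<noteq> 0"
  shows "\<exists>h. sing h \<and> hyp_bil h x = 0 \<and> hyp_bil h y = 0 \<and> hyp_bil w h = s"
proof -
  define y' where "y' = (1 / hyp_bil x y) *s y"
  have "\<exists>c. hyp_frame CARD('n) c \<and> c 1 = x \<and> c (-1) = y'"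
    by (rule hyperbolic_pair_frame)
      (use x y xy in \<open>auto simp: sing_def y'_def hyp_form_simps hyp_bil_simps\<close>)
  then obtain c where c: "hyp_frame CARD('n) c" "c 1 = x" "c (-1) = y'" by blast
  have "\<exists>i\<in>frame_index CARD('n). hyp_bil w (c (- i)) \<noteq> 0"
  proof (rule ccontr)
    assume "\<not> ?thesis"
    then have "w = 0" by (subst hyp_frame_expand[OF c(1)]) simp
    then show False using w by simp
  qed
  then obtain i where i: "i \<in> frame_index CARD('n)" "hyp_bil w (c i) \<noteq> 0"
    using uminus_frame_index by blast
  have one: "1 \<in> frame_index CARD('n)" "-1 \<in> frame_index CARD('n)"
    by (auto simp: frame_index_def Suc_leI)
  have "hyp_bil w y' = 0" using w by (simp add: y'_def hyp_bil_simps)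
  then have "i \<noteq> 1" "i \<noteq> -1" using i w c by auto
  then have perp: "hyp_bil (c i) (c 1) = 0" "hyp_bil (c i) (c (-1)) = 0"
    using c(1) i(1) one by (auto simp: hyp_frame_def)
  define h where "h = (s / hyp_bil w (c i)) *s c i"
  have "hyp_form (c i) = 0" using c(1) i by (auto simp: hyp_frame_def)
  then have "sing h"
    using i s by (auto simp: sing_def h_def hyp_form_simps hyp_bil_simps)
  moreover have "hyp_bil h x = 0" "hyp_bil w h = s"
    using perp(1) c i by (auto simp: h_def hyp_bil_simps)
  moreover have "hyp_bil h y = 0"
    using perp(2) c xy by (auto simp: h_def hyp_bil_simps y'_def)
  ultimately show ?thesis by blast
qed

text \<open>Removing the components along \<open>x\<close> and \<open>y\<close> leaves a vector
  orthogonal to both. Were it nonzero, a singular \<open>h\<close> orthogonal to \<open>x\<close>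
  and \<open>y\<close> would pair with it nontrivially, so testing against singular vectors is
  enough.\<close>

lemma perp_of_perp_pair:
  fixes x y w :: "'k::field ^ ('n::finite + 'n)"
  assumes x: "sing x" and y: "sing y" and xy: "hyp_bil x y \<noteq> 0"
    and w: "\<And>h. sing h \<Longrightarrow> hyp_bil h x = 0 \<Longrightarrow> hyp_bil h y = 0 \<Longrightarrow> hyp_bil w h = 0"
  shows "\<exists>a b. w = a *s x + b *s y"
proof -
  define z where "z = w - (hyp_bil w y / hyp_bil x y) *s x - (hyp_bil w x / hyp_bil x y) *s y"
  have xx: "hyp_bil x x = 0" "hyp_bil y y = 0" using x y sing_hyp_bil_self by blast+
  have z: "hyp_bil z x = 0" "hyp_bil z y = 0"
    using xy by (simp_all add: z_def hyp_bil_simps xx hyp_bil_commute[of y x])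
  have "z = 0"
  proof (rule ccontr)
    assume "z \<noteq> 0"
    then obtain h where h: "sing h" "hyp_bil h x = 0" "hyp_bil h y = 0" "hyp_bil z h = 1"
      using ex_sing_partner[OF x y xy z, of 1] by auto
    then have "hyp_bil w h = 1"
      by (simp add: z_def hyp_bil_simps hyp_bil_commute[of x h] hyp_bil_commute[of y h])
    then show False using w h by simp
  qed
  then have "w = (hyp_bil w y / hyp_bil x y) *s x + (hyp_bil w x / hyp_bil x y) *s y"
    by (simp add: z_def algebra_simps)
  then show ?thesis by blast
qed

section \<open>Collineations opposing no line and no plane\<close>

text \<open>\<open>g\<close> picks a vector of the image point. That a line or plane is not opposite
  its image is expressed on spanning vectors: some nonzero vector of the subspace is orthogonal to
  their images, hence to the span of these images.\<close>

locale opposition_map =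
  fixes g :: "'k::field ^ ('n::finite + 'n) \<Rightarrow> 'k ^ ('n + 'n)"
  assumes card: "CARD('n) \<ge> 3"
    and g_sing: "sing v \<Longrightarrow> sing (g v)"
    and g_orth: "sing v \<Longrightarrow> sing w \<Longrightarrow> hyp_bil (g v) (g w) = 0 \<longleftrightarrow> hyp_bil v w = 0"
    and g_inj: "sing v \<Longrightarrow> sing w \<Longrightarrow> proportional (g v) (g w) \<Longrightarrow> proportional v w"
    and g_scale: "sing v \<Longrightarrow> c \<noteq> 0 \<Longrightarrow> proportional (g (c *s v)) (g v)"
    and g_line: "sing v \<Longrightarrow> sing w \<Longrightarrow> hyp_bil v w = 0 \<Longrightarrow> v + w \<noteq> 0 \<Longrightarrow>
      \<exists>c d. g (v + w) = c *s g v + d *s g w"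
    and no_line_opp: "sing v \<Longrightarrow> sing w \<Longrightarrow> hyp_bil v w = 0 \<Longrightarrow> \<not> proportional v w \<Longrightarrow>
      \<exists>a b. (a \<noteq> 0 \<or> b \<noteq> 0) \<and> (\<forall>x\<in>{v, w}. hyp_bil (a *s v + b *s w) (g x) = 0)"
    and no_plane_opp: "sing u \<Longrightarrow> sing v \<Longrightarrow> sing w \<Longrightarrow>
      hyp_bil u v = 0 \<Longrightarrow> hyp_bil u w = 0 \<Longrightarrow> hyp_bil v w = 0 \<Longrightarrow>
      \<not> proportional v w \<Longrightarrow> \<forall>a b. u \<noteq> a *s v + b *s w \<Longrightarrow>
      \<exists>a b c. (a \<noteq> 0 \<or> b \<noteq> 0 \<or> c \<noteq> 0) \<and>
        (\<forall>x\<in>{u, v, w}. hyp_bil (a *s u + b *s v + c *s w) (g x) = 0)"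
begin

section \<open>Points collinear to both \<open>e\<close> and \<open>g e\<close>\<close>

definition opp :: "'k ^ ('n + 'n) \<Rightarrow> bool" where
  "opp e \<longleftrightarrow> sing e \<and> hyp_bil e (g e) \<noteq> 0"

text \<open>Over these points the cone of all points collinear to \<open>e\<close> is built, with
  apex \<open>e\<close>.\<close>

definition base :: "'k ^ ('n + 'n) \<Rightarrow> 'k ^ ('n + 'n) \<Rightarrow> bool" where
  "base e r \<longleftrightarrow> sing r \<and> hyp_bil r e = 0 \<and> hyp_bil r (g e) = 0"

definition fixed_pt :: "'k ^ ('n + 'n) \<Rightarrow> bool" where
  "fixed_pt r \<longleftrightarrow> proportional (g r) r"

lemma fixed_proportional:
  assumes "proportional v w" "sing w" "fixed_pt w"
  shows "fixed_pt v"
  using assms unfolding fixed_pt_def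
  by (metis g_scale proportional_def proportional_sym proportional_trans)

lemma g_comb:
  assumes "sing v" "sing w" "hyp_bil v w = 0" "a *s v + b *s w \<noteq> 0"
  shows "\<exists>c d. g (a *s v + b *s w) = c *s g v + d *s g w"
proof -
  have scale: "\<exists>d. g (c *s u) = d *s g u" if "sing u" "c \<noteq> 0" for c u
    using g_scale[OF that] proportional_def by blast
  consider "a = 0" | "b = 0" | "a \<noteq> 0" "b \<noteq> 0" by blast
  then show ?thesis
  proof cases
    case 1
    then obtain d where "g (b *s w) = d *s g w" using scale[of w b] assms by auto
    then have "g (a *s v + b *s w) = 0 *s g v + d *s g w" using 1 by simp
    then show ?thesis by blast
  next
    case 2
    then obtain d where "g (a *s v) = d *s g v" using scale[of v a] assms by auto
    then have "g (a *s v + b *s w) = d *s g v + 0 *s g w" using 2 by simp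
    then show ?thesis by blast
  next
    case 3
    obtain c d where "g (a *s v + b *s w) = c *s g (a *s v) + d *s g (b *s w)"
      using g_line[of "a *s v" "b *s w"] assms 3 by (auto simp: sing_scale hyp_bil_simps)
    moreover obtain c' d' where "g (a *s v) = c' *s g v" "g (b *s w) = d' *s g w"
      using scale assms 3 by metis
    ultimately show ?thesis by (metis vector_smult_assoc)
  qed
qed

lemma g_eq_scale: "sing v \<Longrightarrow> sing w \<Longrightarrow> g v = c *s g w \<Longrightarrow> proportional v w"
  using g_inj g_sing proportionalI unfolding sing_def by blast

lemma opp_not_proportional:
  assumes "opp e" "hyp_bil r (g e) = 0" "sing r"
  shows "\<not> proportional e r"
  using assms by (metis opp_def proportional_hyp_bil)

text \<open>Some nonzero \<open>a *s e + b *s r\<close> is orthogonal to \<open>g e\<close> and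
  \<open>g r\<close>. Pairing with \<open>g e\<close> forces \<open>a = 0\<close>, because
  \<open>r\<close> is orthogonal to \<open>g e\<close> and \<open>e\<close> is not.\<close>

lemma base_perp_image:
  assumes e: "opp e" and r: "base e r"
  shows "hyp_bil r (g r) = 0"
proof -
  have np: "\<not> proportional e r"
    using e r by (simp add: base_def opp_not_proportional)
  have "hyp_bil e r = 0" using r by (simp add: base_def hyp_bil_commute)
  then obtain a b where ab: "a \<noteq> 0 \<or> b \<noteq> 0" "hyp_bil (a *s e + b *s r) (g e) = 0"
    "hyp_bil (a *s e + b *s r) (g r) = 0"
    using no_line_opp[of e r] e r np by (auto simp: opp_def base_def)
  then have "a = 0" using e r by (simp add: opp_def base_def hyp_bil_simps)
  then show ?thesis using ab by (simp add: hyp_bil_simps)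
qed

lemma base_comb:
  assumes "base e r" "base e y" "hyp_bil r y = 0" "a *s r + b *s y \<noteq> 0"
  shows "base e (a *s r + b *s y)"
  using assms by (auto simp: base_def sing_def hyp_form_simps hyp_bil_simps)

text \<open>Applying the previous lemma to \<open>r + y\<close> shows that \<open>y \<bottom> g r\<close> iff \<open>r \<bottom> g y\<close>; if both failed,
  the plane spanned by \<open>e\<close>, \<open>r\<close>, \<open>y\<close> would be opposite its image.\<close>

lemma base_perp_image_perp:
  assumes e: "opp e" and r: "base e r" and y: "base e y" and yr: "hyp_bil y r = 0"
  shows "hyp_bil y (g r) = 0"
proof (rule ccontr)
  assume yg: "hyp_bil y (g r) \<noteq> 0"
  have rg: "hyp_bil r (g r) = 0" "hyp_bil y (g y) = 0"
    using base_perp_image e r y by blast+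
  have sing: "sing r" "sing y" "sing e" using r y e by (auto simp: base_def opp_def)
  have np: "\<not> proportional r y"
    using yg rg(1) proportional_hyp_bil by blast
  have ry: "hyp_bil r y = 0" using yr by (simp add: hyp_bil_commute)
  have nz: "r + y \<noteq> 0"
  proof
    assume "r + y = 0"
    then have "1 *s r = (-1) *s y" by (simp add: eq_neg_iff_add_eq_0)
    then show False using scale_eq_imp_proportional[of 1 r "-1" y] np sing by (auto simp: sing_def)
  qed
  then obtain c d where cd: "g (r + y) = c *s g r + d *s g y"
    using g_line[OF sing(1,2) ry] by blast
  have sry: "sing (r + y)" and bry: "base e (r + y)"
    using base_comb[OF r y ry, of 1 1] nz by (auto simp: base_def)
  have "c \<noteq> 0"
  proof
    assume "c = 0"
    then have "g (r + y) = d *s g y" using cd by simp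
    then have "proportional (r + y) y"
      using g_eq_scale sry sing(2) by blast
    then obtain k where "r + y = k *s y" by (auto simp: proportional_def)
    then have "1 *s r = (k - 1) *s y"
      by (simp add: vec.scale_left_diff_distrib algebra_simps)
    then show False using scale_eq_imp_proportional[of 1 r "k - 1" y] np sing by (auto simp: sing_def)
  qed
  have "hyp_bil (r + y) (g (r + y)) = 0" using base_perp_image e bry by blast
  then have "d * hyp_bil r (g y) + c * hyp_bil y (g r) = 0"
    by (simp add: cd hyp_bil_simps rg algebra_simps)
  then have rgy: "hyp_bil r (g y) \<noteq> 0" using \<open>c \<noteq> 0\<close> yg by auto
  have "\<forall>a b. e \<noteq> a *s r + b *s y"
    using e r y by (auto simp: opp_def base_def hyp_bil_simps)
  moreover have "hyp_bil e r = 0" "hyp_bil e y = 0"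
    using r y by (auto simp: base_def hyp_bil_commute)
  ultimately obtain a b c where abc: "a \<noteq> 0 \<or> b \<noteq> 0 \<or> c \<noteq> 0"
    "\<forall>x\<in>{e, r, y}. hyp_bil (a *s e + b *s r + c *s y) (g x) = 0"
    using no_plane_opp[OF sing(3,1,2) _ _ ry np] by blast
  \<comment> \<open>The three conditions are triangular: the one for \<open>g e\<close> yields
    \<open>a = 0\<close>, the one for \<open>g r\<close> then \<open>c = 0\<close>, and the one for
    \<open>g y\<close> finally \<open>b = 0\<close>.\<close>
  then have "a = 0" using e r y by (simp add: opp_def base_def hyp_bil_simps)
  moreover from this have "c = 0" using abc(2) rg yg by (simp add: hyp_bil_simps)
  ultimately show False using abc rgy by (simp add: hyp_bil_simps)
qed

lemma ex_hyp_bil_0_1: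
  fixes r s :: "'k ^ ('n + 'n)"
  assumes "r \<noteq> 0" "\<forall>d. s \<noteq> d *s r"
  shows "\<exists>v. hyp_bil v r = 0 \<and> hyp_bil v s = 1"
proof -
  have "vec.independent {s, r}"
    using assms by (auto simp: vec.independent_insert vec.span_singleton)
  from ex_hyp_bil_eq[OF this, of "\<lambda>x. if x = s then 1 else 0"] obtain v
    where v: "\<forall>x\<in>{s, r}. hyp_bil v x = (if x = s then 1 else 0)" by blast
  moreover have "r \<noteq> s" using assms(2) by (metis vector_smult_lid)
  ultimately show ?thesis by (intro exI[of _ v]) auto
qed

text \<open>If \<open>g r\<close> leaves the span of \<open>g e\<close> and \<open>r\<close>, its
  part \<open>s\<close> orthogonal to \<open>e\<close> is not a multiple of \<open>r\<close>. Then
  some singular \<open>y\<close> orthogonal to \<open>e\<close>, \<open>g e\<close> and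
  \<open>r\<close> is not orthogonal to \<open>s\<close>, hence not to \<open>g r\<close>, against
  \<open>base_perp_image_perp\<close>.\<close>

lemma base_image:
  assumes e: "opp e" and r: "base e r"
  shows "\<exists>c d. g r = c *s g e + d *s r"
proof (rule ccontr)
  assume neg: "\<not> ?thesis"
  have sing: "sing r" "sing e" "sing (g e)" "sing (g r)"
    using r e g_sing by (auto simp: base_def opp_def)
  define t where "t = hyp_bil e (g e)"
  have t: "t \<noteq> 0" using e by (simp add: t_def opp_def)
  have ee: "hyp_bil e e = 0" "hyp_bil (g e) (g e) = 0" and ge: "hyp_bil (g e) e = t"
    using sing sing_hyp_bil_self by (auto simp: t_def hyp_bil_commute)
  have re: "hyp_bil r e = 0" "hyp_bil e r = 0" "hyp_bil r (g e) = 0" "hyp_bil (g e) r = 0"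
    using r by (auto simp: base_def hyp_bil_commute)
  have grge: "hyp_bil (g r) (g e) = 0" using g_orth sing re by blast
  have grr: "hyp_bil (g r) r = 0"
    using base_perp_image[OF e r] by (simp add: hyp_bil_commute)
  \<comment> \<open>This \<open>c\<close> makes \<open>s\<close> orthogonal to \<open>e\<close>,
    while \<open>s\<close> remains singular and orthogonal to \<open>g e\<close> and
    \<open>r\<close>.\<close>
  define c where "c = hyp_bil (g r) e / t"
  define s where "s = g r - c *s g e"
  have s: "hyp_bil s e = 0" "hyp_bil s (g e) = 0" "hyp_bil s r = 0" "hyp_form s = 0"
    using t sing by (auto simp: s_def c_def hyp_bil_simps hyp_form_simps ee ge grge grr re sing_def)
  have "\<forall>d. s \<noteq> d *s r"
  proof
    fix d show "s \<noteq> d *s r"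
    proof
      assume "s = d *s r"
      then have "g r = c *s g e + d *s r" by (simp add: s_def algebra_simps)
      then show False using neg by blast
    qed
  qed
  then obtain v0 where v0: "hyp_bil v0 r = 0" "hyp_bil v0 s = 1"
    using ex_hyp_bil_0_1 sing by (metis sing_def)
  \<comment> \<open>Projection to the perp of \<open>e\<close> and \<open>g e\<close> keeps the
    pairings with \<open>r\<close> and \<open>s\<close>, which lie in that perp.\<close>
  define v where "v = v0 - (hyp_bil v0 (g e) / t) *s e - (hyp_bil v0 e / t) *s g e"
  have es: "hyp_bil e s = 0" "hyp_bil (g e) s = 0" using s by (simp_all add: hyp_bil_commute)
  have v: "hyp_bil v e = 0" "hyp_bil v (g e) = 0" "hyp_bil v r = 0" "hyp_bil v s = 1"
    using t by (simp_all add: v_def hyp_bil_simps v0 ee ge re es t_def[symmetric])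
  \<comment> \<open>As \<open>v\<close> pairs to 1 with the singular \<open>s\<close>, this
    correction makes it singular without changing its pairings with \<open>e\<close>,
    \<open>g e\<close>, \<open>r\<close> and \<open>s\<close>.\<close>
  define y where "y = v - hyp_form v *s s"
  have ss: "hyp_bil s s = 0" using s hyp_bil_self_singular by blast
  have y: "hyp_bil y e = 0" "hyp_bil y (g e) = 0" "hyp_bil y r = 0" "hyp_bil y s = 1" "hyp_form y = 0"
    by (simp_all add: y_def hyp_bil_simps hyp_form_simps v s ss)
  then have "y \<noteq> 0" by (auto simp: hyp_bil_simps)
  then have "base e y" using y by (simp add: base_def sing_def)
  then have "hyp_bil y (g r) = 0" using base_perp_image_perp e r y by blast
  moreover have "hyp_bil y (g r) = hyp_bil y s + c * hyp_bil y (g e)"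
    by (simp add: s_def hyp_bil_simps)
  ultimately show False using y by simp
qed

text \<open>The coefficient of \<open>r\<close> cannot vanish, since then \<open>r\<close> and
  \<open>e\<close> would have the same image point.\<close>

lemma base_image_normal:
  assumes e: "opp e" and r: "base e r"
  shows "\<exists>c. proportional (g r) (r + c *s g e)"
proof -
  obtain c d where cd: "g r = c *s g e + d *s r" using base_image assms by blast
  have "d \<noteq> 0"
  proof
    assume "d = 0"
    then have "proportional r e"
      using cd g_eq_scale[of r e c] e r by (simp add: base_def opp_def)
    then show False using opp_not_proportional e r proportional_sym unfolding base_def by blast
  qed
  then have "g r = d *s (r + (c / d) *s g e)"
    by (simp add: cd vector_add_ldistrib vector_smult_assoc)
  then show ?thesis using \<open>d \<noteq> 0\<close> unfolding proportional_def by blast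
qed

text \<open>The coefficients \<open>c\<close> and \<open>c'\<close> of \<open>g e\<close> measure
  how far \<open>r\<close> and \<open>y\<close> are from being fixed. The combination
  \<open>c' *s r - c *s y\<close> balances them, so the multiple of \<open>g e\<close> in its image
  vanishes.\<close>

lemma base_line_fixed:
  assumes e: "opp e" and r: "base e r" and y: "base e y" and ry: "hyp_bil r y = 0"
    and np: "\<not> proportional r y"
  shows "\<exists>a b. (a \<noteq> 0 \<or> b \<noteq> 0) \<and> fixed_pt (a *s r + b *s y)"
proof -
  obtain c where c: "proportional (g r) (r + c *s g e)" using base_image_normal e r by blast
  obtain c' where c': "proportional (g y) (y + c' *s g e)" using base_image_normal e y by blast
  have nz: "r \<noteq> 0" "y \<noteq> 0" and sing: "sing r" "sing y" using r y by (auto simp: base_def sing_def)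
  consider "c = 0" | "c' = 0" | "c \<noteq> 0" "c' \<noteq> 0" by blast
  then show ?thesis
  proof cases
    case 1
    then have "fixed_pt (1 *s r + 0 *s y)" using c by (simp add: fixed_pt_def)
    then show ?thesis by (metis zero_neq_one)
  next
    case 2
    then have "fixed_pt (0 *s r + 1 *s y)" using c' by (simp add: fixed_pt_def)
    then show ?thesis by (metis zero_neq_one)
  next
    case 3
    define x where "x = c' *s r + (- c) *s y"
    have "x \<noteq> 0" using comb_eq_0[OF _ nz np] 3 unfolding x_def by blast
    then have bx: "base e x" unfolding x_def using base_comb[OF r y ry] by blast
    obtain c'' k where k: "k \<noteq> 0" "g x = k *s (x + c'' *s g e)"
      using base_image_normal[OF e bx] by (auto simp: proportional_def)
    obtain l m where "g x = l *s g r + m *s g y"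
      using g_comb[OF sing ry] \<open>x \<noteq> 0\<close> unfolding x_def by blast
    moreover obtain l' where "g r = l' *s (r + c *s g e)" using c by (auto simp: proportional_def)
    moreover obtain m' where "g y = m' *s (y + c' *s g e)" using c' by (auto simp: proportional_def)
    ultimately have "g x = (l * l') *s (r + c *s g e) + (m * m') *s (y + c' *s g e)"
      by (simp add: vector_smult_assoc)
    then obtain l m where gx: "g x = l *s (r + c *s g e) + m *s (y + c' *s g e)" by blast
    have bil: "hyp_bil r e = 0" "hyp_bil y e = 0" "hyp_bil (g e) e \<noteq> 0" "hyp_bil x e = 0"
      using e r y bx by (auto simp: base_def opp_def hyp_bil_commute)
    \<comment> \<open>\<open>e\<close> is orthogonal to \<open>r\<close>, \<open>y\<close> and
      \<open>x\<close>, so pairing with it compares the coefficients of \<open>g e\<close>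
      alone.\<close>
    have "hyp_bil (g x) e = k * c'' * hyp_bil (g e) e"
      by (simp add: k hyp_bil_simps bil)
    moreover have "hyp_bil (g x) e = (l * c + m * c') * hyp_bil (g e) e"
      by (simp add: gx hyp_bil_simps bil algebra_simps)
    ultimately have c''1: "k * c'' = l * c + m * c'" using bil by simp
    have "k *s x + (k * c'') *s g e = l *s r + m *s y + (l * c + m * c') *s g e"
      using gx k by (simp add: vec.scale_left_distrib vec.scale_right_distrib algebra_simps)
    then have "k *s x = l *s r + m *s y" using c''1 by simp
    then have "(k * c' - l) *s r + (- k * c - m) *s y = 0"
      unfolding x_def
      by (simp add: vec.scale_left_diff_distrib vec.scale_right_distrib vec.scale_right_diff_distrib algebra_simps)
    then have "k * c' - l = 0 \<and> - k * c - m = 0" using comb_eq_0[OF _ nz np] by blast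
    then have "l = k * c'" "m = - k * c" by (auto simp: algebra_simps)
    then have "k * c'' = 0" using c''1 by simp
    then have "fixed_pt x" using k by (auto simp: fixed_pt_def intro: proportional_scale)
    then show ?thesis using 3 unfolding x_def by blast
  qed
qed

text \<open>By injectivity on points the image of \<open>e + q\<close> differs from those of
  \<open>e\<close> and \<open>q\<close>, so both coefficients are nonzero.\<close>

lemma opp_add_base:
  assumes e: "opp e" and q: "base e q"
  shows "\<exists>c d. c \<noteq> 0 \<and> d \<noteq> 0 \<and> g (e + q) = c *s g e + d *s g q"
    and "sing (e + q)"
proof -
  have sing: "sing e" "sing q" and eq: "hyp_bil e q = 0" and t: "hyp_bil e (g e) \<noteq> 0"
    "hyp_bil q (g e) = 0"
    using e q by (auto simp: opp_def base_def hyp_bil_commute)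
  have nz: "e + q \<noteq> 0"
  proof
    assume "e + q = 0"
    then have "hyp_bil (e + q) (g e) = 0" by (simp add: hyp_bil_simps)
    then show False using t by (simp add: hyp_bil_simps)
  qed
  then show s: "sing (e + q)" using sing eq by (simp add: sing_def hyp_form_simps)
  obtain c d where cd: "g (e + q) = c *s g e + d *s g q"
    using g_line[OF sing eq nz] by blast
  have "c \<noteq> 0"
  proof
    assume "c = 0"
    then have "proportional (e + q) q"
      using cd g_eq_scale[OF s sing(2), of d] by simp
    then obtain k where "e + q = k *s q" by (auto simp: proportional_def)
    then have "hyp_bil (e + q) (g e) = hyp_bil (k *s q) (g e)" by simp
    then show False using t by (simp add: hyp_bil_simps)
  qed
  moreover have "d \<noteq> 0"
  proof
    assume "d = 0"
    then have "proportional (e + q) e"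
      using cd g_eq_scale[OF s sing(1), of c] by simp
    then obtain k where k: "e + q = k *s e" by (auto simp: proportional_def)
    then have "hyp_bil (e + q) (g e) = hyp_bil (k *s e) (g e)" by simp
    then have "k = 1" using t by (simp add: hyp_bil_simps)
    then show False using k sing by (simp add: sing_def)
  qed
  ultimately show "\<exists>c d. c \<noteq> 0 \<and> d \<noteq> 0 \<and> g (e + q) = c *s g e + d *s g q" using cd by blast
qed

text \<open>The point \<open>e + q\<close> is also mapped to an opposite point, so \<open>g r\<close> lies in the spans of
  both \<open>r, g e\<close> and \<open>r, g (e + q)\<close>, which meet only in \<open>r\<close>.\<close>

lemma fixed_perp_fixed:
  assumes e: "opp e" and q: "base e q" and fq: "fixed_pt q" and r: "base e r" and rq: "hyp_bil r q = 0"
  shows "fixed_pt r"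
proof (cases "proportional r q")
  case True
  then show ?thesis using fixed_proportional fq q unfolding base_def by blast
next
  case np: False
  obtain c d where cd: "c \<noteq> 0" "d \<noteq> 0" "g (e + q) = c *s g e + d *s g q"
    using opp_add_base(1)[OF e q] by blast
  obtain m where m: "m \<noteq> 0" "g q = m *s q" using fq by (auto simp: fixed_pt_def proportional_def)
  have bil: "hyp_bil r e = 0" "hyp_bil r (g e) = 0" "hyp_bil q e = 0" "hyp_bil e q = 0"
    "hyp_bil q (g e) = 0" "hyp_bil e (g e) \<noteq> 0" "hyp_bil q q = 0" "hyp_bil (g e) e \<noteq> 0"
    using e q r sing_hyp_bil_self by (auto simp: opp_def base_def hyp_bil_commute)
  \<comment> \<open>Pairing \<open>e + q\<close> with its image leaves only
    \<open>c * hyp_bil e (g e)\<close>, since \<open>q\<close> is orthogonal to \<open>e\<close>,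
    \<open>g e\<close> and itself.\<close>
  have e1: "opp (e + q)"
    using opp_add_base(2)[OF e q] cd bil by (simp add: opp_def hyp_bil_simps m)
  have "base (e + q) r"
    using r by (simp add: base_def hyp_bil_simps cd m bil rq)
  then obtain a b where ab: "g r = a *s g (e + q) + b *s r" using base_image e1 by blast
  obtain a' b' where ab': "g r = a' *s g e + b' *s r" using base_image e r by blast
  have "hyp_bil (g r) e = a * c * hyp_bil (g e) e"
    by (simp add: ab cd m hyp_bil_simps bil)
  moreover have "hyp_bil (g r) e = a' * hyp_bil (g e) e"
    by (simp add: ab' hyp_bil_simps bil)
  \<comment> \<open>Once the coefficients of \<open>g e\<close> agree, comparing the two expressions
    leaves a multiple of \<open>q\<close> equal to a multiple of \<open>r\<close>; these are
    different points, so the multiple is zero.\<close>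
  ultimately have a': "a' = a * c" using bil by simp
  have "(a * c) *s g e + (a * d * m) *s q + b *s r = (a * c) *s g e + b' *s r"
    using ab ab' by (simp add: cd m a' vector_add_ldistrib vector_smult_assoc mult.assoc)
  then have "(a * d * m) *s q = (b' - b) *s r"
    by (simp add: vec.scale_left_diff_distrib algebra_simps)
  then have "a * d * m = 0"
    using scale_eq_imp_proportional[of _ q _ r] np proportional_sym q unfolding base_def sing_def
    by blast
  then have "a' = 0" using cd m a' by simp
  then have "g r = b' *s r" using ab' by simp
  then show ?thesis
    using g_sing[of r] r by (auto simp: fixed_pt_def base_def sing_def intro: proportionalI)
qed

text \<open>A frame extending the pair formed by \<open>e\<close> and a multiple of
  \<open>g e\<close> has at least three pairs; its vectors of index 2 and 3 span a singular line
  orthogonal to \<open>e\<close> and \<open>g e\<close>.\<close>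

lemma ex_base_line:
  assumes e: "opp e"
  shows "\<exists>u w. base e u \<and> base e w \<and> hyp_bil u w = 0 \<and> \<not> proportional u w"
proof -
  define f where "f = (1 / hyp_bil e (g e)) *s g e"
  have t: "hyp_bil e (g e) \<noteq> 0" and s: "sing e" "sing (g e)"
    using e g_sing by (auto simp: opp_def)
  have "\<exists>c. hyp_frame CARD('n) c \<and> c 1 = e \<and> c (-1) = f"
    by (rule hyperbolic_pair_frame)
      (use t s in \<open>auto simp: sing_def f_def hyp_form_simps hyp_bil_simps\<close>)
  then obtain c where c: "hyp_frame CARD('n) c" "c 1 = e" "c (-1) = f" by blast
  have I: "1 \<in> frame_index CARD('n)" "-1 \<in> frame_index CARD('n)" "2 \<in> frame_index CARD('n)"
    "3 \<in> frame_index CARD('n)" "- 2 \<in> frame_index CARD('n)"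
    using card by (auto simp: frame_index_def)
  have Q: "hyp_form (c 2) = 0" "hyp_form (c 3) = 0"
    using c(1) I unfolding hyp_frame_def by blast+
  have bil: "hyp_bil (c i) (c j) = (if i = - j then 1 else 0)"
    if "i \<in> frame_index CARD('n)" "j \<in> frame_index CARD('n)" for i j
    using c(1) that unfolding hyp_frame_def by blast
  have "hyp_bil (c 2) (c (-2)) = 1" "hyp_bil (c 3) (c (-2)) = 0"
    using bil[OF I(3,5)] bil[OF I(4,5)] by auto
  then have "\<not> proportional (c 2) (c 3)" using proportional_hyp_bil by force
  moreover have b: "base e (c i)" if "i = 2 \<or> i = 3" for i
  proof -
    have i: "i \<in> frame_index CARD('n)" "- i \<in> frame_index CARD('n)"
      using I that uminus_frame_index by blast+
    have "hyp_bil (c i) e = 0" "hyp_bil (c i) f = 0"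
      using bil[OF i(1) I(1)] bil[OF i(1) I(2)] c(2,3) that by auto
    moreover have "hyp_bil (c i) (c (- i)) = 1" using bil[OF i] by simp
    ultimately show ?thesis
      using t Q that by (auto simp: base_def sing_def f_def hyp_bil_simps)
  qed
  moreover have "hyp_bil (c 2) (c 3) = 0" using bil[OF I(3,4)] by simp
  ultimately show ?thesis by blast
qed

text \<open>One linear condition on a two-dimensional space has a nonzero solution. For orthogonal
  \<open>u\<close> and \<open>w\<close> this says that every point is collinear to some point of a
  given line.\<close>

lemma ex_perp_comb:
  assumes "sing u" "sing w" "\<not> proportional u w"
  shows "\<exists>a b. a *s u + b *s w \<noteq> 0 \<and> hyp_bil r (a *s u + b *s w) = 0"
proof (cases "hyp_bil r u = 0")
  case True
  then show ?thesis using assms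
    by (intro exI[of _ 1] exI[of _ 0]) (simp add: sing_def)
next
  case False
  then show ?thesis using assms comb_eq_0[of "- hyp_bil r w" u "hyp_bil r u" w]
    by (intro exI[of _ "- hyp_bil r w"] exI[of _ "hyp_bil r u"]) (auto simp: sing_def hyp_bil_simps)
qed

text \<open>A singular line in the base has a fixed point, hence all its points are fixed, being
  collinear to that one. The point \<open>r\<close> is collinear to some point of the line and
  inherits the property from it.\<close>

lemma base_fixed:
  assumes e: "opp e" and r: "base e r"
  shows "fixed_pt r"
proof -
  obtain u w where uw: "base e u" "base e w" "hyp_bil u w = 0" "\<not> proportional u w"
    using ex_base_line[OF e] by blast
  have s: "sing u" "sing w" "u \<noteq> 0" "w \<noteq> 0" using uw by (auto simp: base_def sing_def)
  obtain a b where ab: "a \<noteq> 0 \<or> b \<noteq> 0" "fixed_pt (a *s u + b *s w)"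
    using base_line_fixed[OF e uw] by blast
  then have nz: "a *s u + b *s w \<noteq> 0" using comb_eq_0 s uw by blast
  obtain c d where cd: "c *s u + d *s w \<noteq> 0" "hyp_bil r (c *s u + d *s w) = 0"
    using ex_perp_comb[OF s(1,2) uw(4)] by blast
  have "hyp_bil (c *s u + d *s w) (a *s u + b *s w) = 0"
    using uw(3) s sing_hyp_bil_self[OF s(1)] sing_hyp_bil_self[OF s(2)]
    by (simp add: hyp_bil_simps hyp_bil_commute[of w u])
  then have "fixed_pt (c *s u + d *s w)"
    using fixed_perp_fixed[OF e base_comb[OF uw(1-3) nz] ab(2) base_comb[OF uw(1-3) cd(1)]] by blast
  then show ?thesis
    using fixed_perp_fixed[OF e base_comb[OF uw(1-3) cd(1)] _ r cd(2)] by blast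
qed

section \<open>The constant of the cone over \<open>e\<close>\<close>

lemma image_add_base:
  assumes e: "opp e" and h: "base e h"
  shows "\<exists>a. a \<noteq> 0 \<and> proportional (g (e + h)) (g e + a *s h)"
proof -
  obtain c d where cd: "c \<noteq> 0" "d \<noteq> 0" "g (e + h) = c *s g e + d *s g h"
    using opp_add_base(1)[OF e h] by blast
  obtain m where m: "m \<noteq> 0" "g h = m *s h"
    using base_fixed[OF e h] by (auto simp: fixed_pt_def proportional_def)
  have "g (e + h) = c *s (g e + (d * m / c) *s h)"
    using cd m by (simp add: vector_add_ldistrib vector_smult_assoc)
  then show ?thesis using cd m
    by (intro exI[of _ "d * m / c"]) (auto simp: proportional_def)
qed

text \<open>The vector \<open>e + h + h'\<close> is read in two ways: as a point of the cone, and as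
  a point of the line through \<open>e + h\<close> and the fixed point \<open>h'\<close>. In the
  second reading the ratio of the coefficients of \<open>h\<close> and \<open>g e\<close> is that of
  \<open>g (e + h)\<close>.\<close>

lemma image_add_base_line:
  assumes e: "opp e" and h: "base e h" and h': "base e h'" and hh': "hyp_bil h h' = 0"
    and np: "\<not> proportional h h'"
    and a: "proportional (g (e + h)) (g e + a *s h)"
    and a': "proportional (g (e + (h + h'))) (g e + a' *s (h + h'))"
  shows "a = a'"
proof -
  have sing: "sing (e + h)" "sing h'" and nz: "h \<noteq> 0" "h' \<noteq> 0"
    using opp_add_base(2)[OF e h] h h' by (auto simp: base_def sing_def)
  have bil: "hyp_bil h e = 0" "hyp_bil h' e = 0" "hyp_bil e h' = 0" "hyp_bil (g e) e \<noteq> 0"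
    using e h h' by (auto simp: base_def opp_def hyp_bil_commute)
  have "h + h' \<noteq> 0" using comb_eq_0[OF _ nz np, of 1 1] by auto
  then have "base e (h + h')" using base_comb[OF h h' hh', of 1 1] by simp
  then have "sing ((e + h) + h')" using opp_add_base(2)[OF e] by (simp add: add.assoc)
  moreover have "hyp_bil (e + h) h' = 0" by (simp add: hyp_bil_simps bil hh')
  ultimately obtain l m where lm: "g (e + h + h') = l *s g (e + h) + m *s g h'"
    using g_line[OF sing] by (auto simp: sing_def)
  obtain k where k: "g (e + h) = k *s (g e + a *s h)" using a by (auto simp: proportional_def)
  obtain k' where k': "k' \<noteq> 0" "g (e + h + h') = k' *s (g e + a' *s (h + h'))"
    using a' by (auto simp: proportional_def add.assoc)
  obtain n where n: "g h' = n *s h'"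
    using base_fixed[OF e h'] by (auto simp: fixed_pt_def proportional_def)
  have "hyp_bil (g (e + h + h')) e = l * k * hyp_bil (g e) e"
    by (simp add: lm k n hyp_bil_simps bil)
  moreover have "hyp_bil (g (e + h + h')) e = k' * hyp_bil (g e) e"
    by (simp add: k' hyp_bil_simps bil)
  ultimately have lk: "l * k = k'" using bil by simp
  have "k' *s (g e + a' *s (h + h')) = l *s (k *s (g e + a *s h)) + m *s (n *s h')"
    using lm k k' n by simp
  also have "\<dots> = k' *s (g e + a *s h) + (m * n) *s h'"
    by (simp add: vector_smult_assoc lk)
  finally have "(k' * (a' - a)) *s h + (k' * a' - m * n) *s h' = 0"
    by (simp add: vec.scale_left_diff_distrib vec.scale_right_distrib vec.scale_right_diff_distrib algebra_simps)
  then have "k' * (a' - a) = 0" using comb_eq_0[OF _ nz np] by blast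
  then show ?thesis using k' by simp
qed

text \<open>Both constants agree with the one of \<open>h + h'\<close>.\<close>

lemma image_add_base_eq:
  assumes e: "opp e" and h: "base e h" and h': "base e h'" and hh': "hyp_bil h h' = 0"
    and np: "\<not> proportional h h'"
    and a: "proportional (g (e + h)) (g e + a *s h)"
    and a': "proportional (g (e + h')) (g e + a' *s h')"
  shows "a = a'"
proof -
  have nz: "h \<noteq> 0" "h' \<noteq> 0" using h h' by (auto simp: base_def sing_def)
  then have "h + h' \<noteq> 0" using comb_eq_0[OF _ nz np, of 1 1] by auto
  then have "base e (h + h')" using base_comb[OF h h' hh', of 1 1] by simp
  then obtain b where b: "proportional (g (e + (h + h'))) (g e + b *s (h + h'))"
    using image_add_base e by blast
  have "a = b" using image_add_base_line[OF e h h' hh' np a b] .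
  moreover have "a' = b"
    using image_add_base_line[OF e h' h _ _ a', of b] hh' np b proportional_sym
    by (auto simp: hyp_bil_commute add.commute)
  ultimately show ?thesis by simp
qed

text \<open>A singular line in the base carries a single constant, and each \<open>h\<close> is
  orthogonal to some point of this line, which transfers the constant to \<open>h\<close>.\<close>

lemma ex_image_const:
  assumes e: "opp e"
  shows "\<exists>a. a \<noteq> 0 \<and> (\<forall>h. base e h \<longrightarrow> proportional (g (e + h)) (g e + a *s h))"
proof -
  obtain u w where uw: "base e u" "base e w" "hyp_bil u w = 0" "\<not> proportional u w"
    using ex_base_line[OF e] by blast
  have s: "sing u" "sing w" "u \<noteq> 0" "w \<noteq> 0" using uw by (auto simp: base_def sing_def)
  have bil: "hyp_bil u u = 0" "hyp_bil w w = 0" "hyp_bil w u = 0"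
    using s sing_hyp_bil_self uw by (auto simp: hyp_bil_commute)
  obtain a where a: "a \<noteq> 0" "proportional (g (e + u)) (g e + a *s u)"
    using image_add_base[OF e uw(1)] by blast
  obtain a2 where a2: "proportional (g (e + w)) (g e + a2 *s w)"
    using image_add_base[OF e uw(2)] by blast
  have "a = a2" using image_add_base_eq[OF e uw a(2) a2] .
  \<comment> \<open>A point \<open>x\<close> of the line spanned by \<open>u\<close> and
    \<open>w\<close> is collinear to both and differs from at least one of them.\<close>
  have comb: "b = a" if x: "x = c *s u + d *s w" "base e x" "proportional (g (e + x)) (g e + b *s x)" for x b c d
  proof (cases "proportional x u")
    case True
    then have "\<not> proportional x w" using uw proportional_sym proportional_trans by blast
    moreover have "hyp_bil x w = 0" using x(1) uw bil by (simp add: hyp_bil_simps)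
    ultimately show ?thesis using image_add_base_eq[OF e x(2) uw(2) _ _ x(3) a2] \<open>a = a2\<close> by simp
  next
    case False
    moreover have "hyp_bil x u = 0" using x(1) uw bil by (simp add: hyp_bil_simps)
    ultimately show ?thesis using image_add_base_eq[OF e x(2) uw(1) _ _ x(3) a(2)] by simp
  qed
  have "proportional (g (e + h)) (g e + a *s h)" if h: "base e h" for h
  proof -
    obtain b where b: "proportional (g (e + h)) (g e + b *s h)"
      using image_add_base[OF e h] by blast
    obtain c d where cd: "c *s u + d *s w \<noteq> 0" "hyp_bil h (c *s u + d *s w) = 0"
      using ex_perp_comb[OF s(1,2) uw(4)] by blast
    define x where "x = c *s u + d *s w"
    have bx: "base e x" unfolding x_def using base_comb[OF uw(1-3) cd(1)] .
    obtain b' where b': "proportional (g (e + x)) (g e + b' *s x)"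
      using image_add_base[OF e bx] by blast
    have "b' = a" using comb x_def bx b' by blast
    have "b = a"
    \<comment> \<open>The comparison requires two different points; if \<open>h\<close> is the
      chosen point, it lies on the line itself.\<close>
    proof (cases "proportional h x")
      case True
      then obtain k where "h = k *s x" by (auto simp: proportional_def)
      then have "h = (k * c) *s u + (k * d) *s w"
        by (simp add: x_def vector_add_ldistrib vector_smult_assoc)
      then show ?thesis using comb h b by blast
    next
      case False
      then have "b = b'" using image_add_base_eq[OF e h bx _ _ b b'] cd x_def by blast
      then show ?thesis using \<open>b' = a\<close> by simp
    qed
    then show ?thesis using b by simp
  qed
  then show ?thesis using a by blast
qed

end

section \<open>Reflections\<close>

text \<open>Written with \<open>hyp_form p\<close> instead of half of \<open>hyp_bil p p\<close>,
  the formula also covers characteristic 2, where it is an orthogonal transvection.\<close>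

definition hyp_reflection ::
    "'k::field ^ ('n::finite + 'n) \<Rightarrow> 'k ^ ('n + 'n) \<Rightarrow> 'k ^ ('n + 'n)" where
  "hyp_reflection p v = v - (hyp_bil v p / hyp_form p) *s p"

lemma hyp_reflection_add: "hyp_reflection p (v + w) = hyp_reflection p v + hyp_reflection p w"
  by (simp add: hyp_reflection_def hyp_bil_simps vec.scale_left_distrib add_divide_distrib)

lemma hyp_reflection_scale: "hyp_reflection p (c *s v) = c *s hyp_reflection p v"
  by (simp add: hyp_reflection_def hyp_bil_simps vec.scale_right_diff_distrib vector_smult_assoc)

lemma hyp_form_reflection: "hyp_form p \<noteq> 0 \<Longrightarrow> hyp_form (hyp_reflection p v) = hyp_form v"
  by (simp add: hyp_reflection_def hyp_form_simps hyp_bil_simps field_simps)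

lemma hyp_bil_reflection: "hyp_form p \<noteq> 0 \<Longrightarrow> hyp_bil (hyp_reflection p v) p = - hyp_bil v p"
  by (simp add: hyp_reflection_def hyp_bil_simps hyp_bil_self)

lemma hyp_reflection_reflection:
  assumes "hyp_form p \<noteq> 0"
  shows "hyp_reflection p (hyp_reflection p v) = v"
  using hyp_bil_reflection[OF assms, of v]
  by (simp add: hyp_reflection_def[of p "hyp_reflection p v"]) (simp add: hyp_reflection_def)

lemma hyp_reflection_perp: "hyp_bil v p = 0 \<Longrightarrow> hyp_reflection p v = v"
  by (simp add: hyp_reflection_def)

text \<open>When \<open>hyp_form p\<close> is nonzero and the singular vector \<open>v\<close> is
  not orthogonal to \<open>p\<close>, this value is nonzero: the point is opposite its mirror
  image.\<close>

lemma hyp_bil_reflection_self: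
  "hyp_form v = 0 \<Longrightarrow> hyp_bil v (hyp_reflection p v) = - (hyp_bil v p * hyp_bil v p / hyp_form p)"
  by (simp add: hyp_reflection_def hyp_bil_simps hyp_bil_self_singular)

lemma sing_reflection:
  assumes "hyp_form p \<noteq> 0"
  shows "sing (hyp_reflection p v) \<longleftrightarrow> sing v"
proof -
  have "hyp_reflection p v = 0 \<longleftrightarrow> v = 0"
    using hyp_reflection_reflection[OF assms, of v]
    by (metis hyp_reflection_scale vector_smult_lzero)
  then show ?thesis by (simp add: sing_def hyp_form_reflection assms)
qed

context opposition_map
begin

context
  fixes e :: "'k ^ ('n + 'n)" and a :: 'k
  assumes e: "opp e" and a: "a \<noteq> 0"
    and cone: "\<And>h. base e h \<Longrightarrow> proportional (g (e + h)) (g e + a *s h)"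
begin

text \<open>With this \<open>p\<close> one has \<open>R (e + h) = (1 / a) *s (g e + a *s h)\<close>
  for \<open>h\<close> in the base, so the reflection agrees with the known images on the
  cone.\<close>

private abbreviation (input) p where "p \<equiv> a *s e - g e"

private abbreviation (input) R where "R \<equiv> hyp_reflection p"

private definition moved where "moved v \<longleftrightarrow> proportional (g v) (R v)"

private lemma pair_simps:
  "sing e" "sing (g e)" "hyp_form e = 0" "hyp_form (g e) = 0" "hyp_bil e e = 0"
  "hyp_bil (g e) (g e) = 0" "hyp_bil (g e) e = hyp_bil e (g e)" "hyp_bil e (g e) \<noteq> 0"
  using e g_sing[of e] sing_hyp_bil_self[of e] sing_hyp_bil_self[of "g e"]
  by (auto simp: opp_def sing_def hyp_bil_commute)

private lemma form_axis: "hyp_form p = - (a * hyp_bil e (g e))"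
  using pair_simps by (simp add: hyp_form_simps hyp_bil_simps)

private lemma form_axis_nz: "hyp_form p \<noteq> 0"
  using form_axis a pair_simps by simp

text \<open>If \<open>v\<close> is not orthogonal to \<open>e\<close>, it lies in the base of
  another opposite vector \<open>e + h\<close>. As \<open>g (e + h)\<close> is a multiple of
  \<open>g e + a *s h\<close> and \<open>hyp_bil v (g e) = a * hyp_bil v e\<close>, orthogonality to
  \<open>e + h\<close> and to its image is one and the same condition
  \<open>hyp_bil v h = - hyp_bil v e\<close>.\<close>

lemma perp_axis_fixed:
  assumes v: "sing v" "hyp_bil v p = 0"
  shows "fixed_pt v"
proof -
  let ?t = "hyp_bil e (g e)"
  note ps = pair_simps
  \<comment> \<open>The vector \<open>a *s e + g e\<close> spans the part of the plane of
    \<open>e\<close> and \<open>g e\<close> orthogonal to \<open>p\<close>; its component is removed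
    from \<open>v\<close>.\<close>
  define b where "b = hyp_bil v e / ?t"
  define w where "w = v - b *s (a *s e + g e)"
  have vg: "hyp_bil v (g e) = a * b * ?t" "hyp_bil v e = b * ?t"
    using v ps by (simp_all add: b_def hyp_bil_simps)
  have w: "hyp_bil w e = 0" "hyp_bil w (g e) = 0"
    using ps by (simp_all add: w_def hyp_bil_simps vg algebra_simps)
  show ?thesis
  proof (cases "b = 0")
    case True
    then have "base e v" using v vg by (simp add: base_def)
    then show ?thesis using base_fixed e by blast
  next
    case False
    have "v = w + b *s (a *s e + g e)" by (simp add: w_def)
    then have "hyp_form v = hyp_form w + b * b * (a * ?t)"
      using ps w by (simp add: hyp_form_simps hyp_bil_simps)
    \<comment> \<open>If \<open>w\<close> were zero, \<open>v\<close> would be a nonzero multiple of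
      \<open>a *s e + g e\<close>, which is not singular.\<close>
    then have "w \<noteq> 0" using v False a ps by (auto simp: sing_def hyp_form_simps)
    then obtain h where h: "sing h" "hyp_bil h e = 0" "hyp_bil h (g e) = 0" "hyp_bil w h = - (b * ?t)"
      using ex_sing_partner[OF ps(1,2,8) w, of "- (b * ?t)"] False ps by auto
    have bh: "base e h" using h by (simp add: base_def)
    obtain m where m: "m \<noteq> 0" "g (e + h) = m *s (g e + a *s h)"
      using cone[OF bh] by (auto simp: proportional_def)
    have hh: "hyp_bil h h = 0" "hyp_bil e h = 0" "hyp_bil (g e) h = 0"
      using h sing_hyp_bil_self by (auto simp: hyp_bil_commute)
    have "opp (e + h)"
      using opp_add_base(2)[OF e bh] m ps by (simp add: opp_def hyp_bil_simps h hh)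
    moreover have "hyp_bil v h = - (b * ?t)"
    proof -
      have "hyp_bil v h = hyp_bil w h + b * (a * hyp_bil e h + hyp_bil (g e) h)"
        by (simp add: w_def hyp_bil_simps)
      then show ?thesis using h hh by simp
    qed
    then have "base (e + h) v"
      using v(1) by (simp add: base_def hyp_bil_simps m vg algebra_simps)
    ultimately show ?thesis using base_fixed by blast
  qed
qed

text \<open>A singular \<open>h\<close> orthogonal to \<open>v\<close> and \<open>R v\<close> is
  orthogonal to \<open>p\<close>, so it is fixed and \<open>g v\<close> is orthogonal to it. This
  confines \<open>g v\<close> to the span of \<open>v\<close> and \<open>R v\<close>, where a
  singular vector is a multiple of one of the two.\<close>

lemma fixed_or_reflected:
  assumes v: "sing v" "hyp_bil v p \<noteq> 0"
  shows "fixed_pt v \<or> moved v"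
proof -
  have Rv: "sing (R v)" using sing_reflection[OF form_axis_nz] v by blast
  have vRv: "hyp_bil v (R v) \<noteq> 0"
    using v form_axis_nz by (simp add: hyp_bil_reflection_self sing_def)
  have "\<exists>x y. g v = x *s v + y *s R v"
  proof (rule perp_of_perp_pair[OF v(1) Rv vRv])
    fix h assume h: "sing h" "hyp_bil h v = 0" "hyp_bil h (R v) = 0"
    then have "hyp_bil h p = 0"
      using v form_axis_nz by (simp add: hyp_reflection_def hyp_bil_simps)
    then obtain m where m: "m \<noteq> 0" "g h = m *s h"
      using perp_axis_fixed h by (auto simp: fixed_pt_def proportional_def)
    have "hyp_bil (g v) (g h) = 0" using g_orth v h by (simp add: hyp_bil_commute)
    then show "hyp_bil (g v) h = 0" using m by (simp add: hyp_bil_simps)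
  qed
  then obtain x y where xy: "g v = x *s v + y *s R v" by blast
  have gv: "g v \<noteq> 0" "hyp_form (g v) = 0" using g_sing v by (auto simp: sing_def)
  have "hyp_form v = 0" "hyp_form (R v) = 0" using v Rv by (auto simp: sing_def)
  then have "x * y = 0"
    using gv(2) vRv unfolding xy by (auto simp: hyp_form_simps hyp_bil_simps)
  then show ?thesis
    using xy gv unfolding fixed_pt_def moved_def by (auto intro: proportionalI)
qed

text \<open>The line of \<open>v\<close> and \<open>w\<close> meets the perp of \<open>p\<close> in
  a fixed point \<open>x\<close>. If \<open>w\<close> were fixed too, \<open>g w\<close> could have
  no component along \<open>g v\<close>, and \<open>w\<close> would be proportional to
  \<open>x\<close>.\<close>

lemma moved_perp:
  assumes v: "sing v" "hyp_bil v p \<noteq> 0" "moved v"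
    and w: "sing w" "hyp_bil w p \<noteq> 0" "hyp_bil v w = 0"
  shows "moved w"
proof (cases "proportional w v")
  case True
  then obtain c where c: "c \<noteq> 0" "w = c *s v" by (auto simp: proportional_def)
  have "proportional (g w) (g v)" unfolding c using g_scale[OF v(1) c(1)] .
  moreover have "proportional (R v) (R w)"
    unfolding c hyp_reflection_scale using proportional_scale[OF c(1)] proportional_sym by blast
  ultimately show ?thesis using v unfolding moved_def by (meson proportional_trans)
next
  case False
  have "\<not> fixed_pt w"
  proof
    assume "fixed_pt w"
    then obtain k where k: "k \<noteq> 0" "g w = k *s w" by (auto simp: fixed_pt_def proportional_def)
    \<comment> \<open>This ratio places \<open>x = w - c *s v\<close> in the perp of
      \<open>p\<close>.\<close>
    define c where "c = hyp_bil w p / hyp_bil v p"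
    have c: "c \<noteq> 0" using v w by (simp add: c_def)
    define x where "x = w - c *s v"
    have xp: "hyp_bil x p = 0" using v(2) by (simp only: x_def c_def hyp_bil_simps(9,3)) simp
    have "x \<noteq> 0"
    proof
      assume "x = 0"
      then have "w = c *s v" by (simp add: x_def)
      then show False using False c by (auto simp: proportional_def)
    qed
    then have sx: "sing x"
      using v w by (simp add: sing_def x_def hyp_form_simps hyp_bil_simps hyp_bil_commute[of w v])
    obtain m where m: "g x = m *s x"
      using perp_axis_fixed[OF sx xp] by (auto simp: fixed_pt_def proportional_def)
    have vv: "hyp_bil v v = 0" using v sing_hyp_bil_self by blast
    have xv: "hyp_bil x v = 0" "hyp_bil w v = 0"
      using w vv by (auto simp: x_def hyp_bil_simps hyp_bil_commute[of w v])
    have wx: "w = 1 *s x + c *s v" by (simp add: x_def)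
    obtain l n where ln: "g w = l *s g x + n *s g v"
      using g_comb[OF sx v(1) xv(1), of 1 c] wx w(1) by (auto simp: sing_def)
    obtain n' where n': "n' \<noteq> 0" "g v = n' *s R v" using v by (auto simp: moved_def proportional_def)
    have vRv: "hyp_bil (R v) v \<noteq> 0"
      using v form_axis_nz by (simp add: hyp_bil_commute[of "R v" v] hyp_bil_reflection_self sing_def)
    \<comment> \<open>Pairing with \<open>v\<close> annihilates \<open>w\<close> and
      \<open>x\<close> but not \<open>R v\<close>, which isolates the coefficient
      \<open>n\<close>.\<close>
    have "0 = hyp_bil (g w) v" by (simp only: k hyp_bil_simps(3) xv) simp
    also have "\<dots> = n * n' * hyp_bil (R v) v"
      by (simp only: ln m n' hyp_bil_simps(1,3) xv) simp
    finally have "n = 0" using vRv n' by simp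
    then have kw: "k *s w = (l * m) *s x" using ln k m by (simp add: vector_smult_assoc)
    have "hyp_bil (k *s w) p = 0" unfolding kw hyp_bil_simps(3) xp by simp
    then show False using k w by (simp only: hyp_bil_simps(3)) simp
  qed
  then show ?thesis using fixed_or_reflected w by blast
qed

private lemma moved_pole: "moved e" "hyp_bil e p \<noteq> 0"
proof -
  note ps = pair_simps
  have ep: "hyp_bil e p = - hyp_bil e (g e)" using ps by (simp add: hyp_bil_simps)
  then show "hyp_bil e p \<noteq> 0" using ps by simp
  have "hyp_bil e p / hyp_form p = 1 / a" unfolding ep form_axis using a ps by simp
  then have "R e = e - (1 / a) *s p" by (simp only: hyp_reflection_def)
  also have "\<dots> = (1 / a) *s g e"
    using a by (simp add: vec.scale_right_diff_distrib vector_smult_assoc)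
  finally have "g e = a *s R e" using a by (simp add: vector_smult_assoc)
  then show "moved e" using a unfolding moved_def proportional_def by blast
qed

text \<open>A singular \<open>h\<close> orthogonal to \<open>e\<close> and \<open>v\<close> but not
  to \<open>p\<close> links \<open>e\<close> to \<open>v\<close>; it exists unless \<open>p\<close>
  lies in the span of \<open>e\<close> and \<open>v\<close>.\<close>

private lemma moved_generic:
  assumes v: "sing v" "hyp_bil v p \<noteq> 0" "hyp_bil v e \<noteq> 0" and ns: "\<forall>x y. p \<noteq> x *s e + y *s v"
  shows "moved v"
proof -
  have "hyp_bil e v \<noteq> 0" using v by (simp add: hyp_bil_commute)
  then obtain h where h: "sing h" "hyp_bil h e = 0" "hyp_bil h v = 0" "hyp_bil p h \<noteq> 0"
    using perp_of_perp_pair[OF pair_simps(1) v(1), of p] ns by blast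
  have hp: "hyp_bil h p \<noteq> 0" using h(4) by (metis hyp_bil_commute)
  have "moved h" using moved_perp[OF pair_simps(1) moved_pole(2,1) h(1) hp] h(2) by (simp add: hyp_bil_commute)
  then show ?thesis using moved_perp[OF h(1) hp _ v(1,2) h(3)] by blast
qed

text \<open>In the perp of \<open>p\<close> the reflection is the identity. Elsewhere the only
  exception to a link through at most one intermediate point is \<open>g e\<close>, the second
  singular point on the line of \<open>e\<close> and \<open>p\<close>.\<close>

private lemma moved_sing:
  assumes v: "sing v"
  shows "moved v"
proof (cases "hyp_bil v p = 0")
  case True
  then show ?thesis
    using perp_axis_fixed[OF v] hyp_reflection_perp[of v p] by (simp add: moved_def fixed_pt_def)
next
  case vp: False
  note ps = pair_simps
  consider "hyp_bil v e = 0" | "hyp_bil v e \<noteq> 0" "\<forall>x y. p \<noteq> x *s e + y *s v"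
    | x y where "p = x *s e + y *s v" by blast
  then show ?thesis
  proof cases
    case 1
    then show ?thesis
      using moved_perp[OF ps(1) moved_pole(2,1) v vp] by (simp add: hyp_bil_commute)
  next
    case 2
    then show ?thesis using moved_generic v vp by blast
  next
    case 3
    then have yv: "y *s v = (a - x) *s e - g e"
      by (simp add: vec.scale_left_diff_distrib algebra_simps)
    have "y \<noteq> 0"
    proof
      assume "y = 0"
      then have "hyp_bil ((a - x) *s e - g e) e = 0" using yv by (metis hyp_bil_zero_left vector_smult_lzero)
      then show False using ps by (simp add: hyp_bil_simps)
    qed
    have "hyp_form ((a - x) *s e - g e) = 0"
      using v unfolding yv[symmetric] by (simp add: hyp_form_simps sing_def)
    then have "a = x" using ps by (simp add: hyp_form_simps hyp_bil_simps)
    then have "y *s v = (-1) *s g e" using yv by simp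
    then have vg: "proportional v (g e)" using scale_eq_imp_proportional \<open>y \<noteq> 0\<close> v sing_def by blast
    obtain u where u: "base e u" using ex_base_line[OF e] by blast
    then have ub: "sing u" "hyp_bil u e = 0" "hyp_bil u (g e) = 0" "hyp_bil (g e) u = 0" "hyp_bil e u = 0"
      by (auto simp: base_def hyp_bil_commute)
    \<comment> \<open>\<open>z\<close> is collinear to \<open>g e\<close>, and the summand
      \<open>u\<close> moves it off the line of \<open>e\<close> and \<open>g e\<close>, so that
      \<open>z\<close> is linked to \<open>e\<close>.\<close>
    define z where "z = g e + u"
    have zb: "hyp_bil z e \<noteq> 0" "hyp_bil z p \<noteq> 0" "hyp_bil (g e) z = 0"
      using ps a by (simp_all add: z_def hyp_bil_simps ub)
    have "z \<noteq> 0" using zb by (auto simp: hyp_bil_simps)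
    then have sz: "sing z" using ub ps by (simp add: sing_def z_def hyp_form_simps)
    have "\<forall>x y. p \<noteq> x *s e + y *s z"
    proof (intro allI notI)
      fix x y assume eq: "p = x *s e + y *s z"
      have "hyp_bil p e = hyp_bil (x *s e + y *s z) e" by (simp only: eq)
      then have "(-1) * hyp_bil e (g e) = y * hyp_bil e (g e)"
        using ps by (simp add: z_def hyp_bil_simps ub)
      then have "y = -1" using ps(8) mult_right_cancel by metis
      have "hyp_bil p (g e) = hyp_bil (x *s e + y *s z) (g e)" by (simp only: eq)
      then have "a = x" using ps by (simp add: z_def hyp_bil_simps ub)
      then have "u = 0" using eq \<open>y = -1\<close> by (simp add: z_def)
      then show False using ub by (simp add: sing_def)
    qed
    then have "moved z" using moved_generic sz zb by blast
    moreover have "hyp_bil z v = 0" using vg zb(3) by (metis hyp_bil_commute proportional_hyp_bil)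
    ultimately show ?thesis using moved_perp[OF sz zb(2) _ v vp] by blast
  qed
qed

lemmas image_reflection = moved_sing[unfolded moved_def]

end

theorem ex_reflection:
  assumes "opp e"
  shows "\<exists>p. hyp_form p \<noteq> 0 \<and> (\<forall>v. sing v \<longrightarrow> proportional (g v) (hyp_reflection p v))"
proof -
  obtain a where a: "a \<noteq> 0" "\<And>h. base e h \<Longrightarrow> proportional (g (e + h)) (g e + a *s h)"
    using ex_image_const[OF assms] by blast
  have t: "hyp_bil e (g e) \<noteq> 0" "hyp_form e = 0" "hyp_form (g e) = 0"
    using assms g_sing by (auto simp: opp_def sing_def)
  then have "hyp_form (a *s e - g e) \<noteq> 0" using a by (simp add: hyp_form_simps hyp_bil_simps)
  then show ?thesis using image_reflection[OF assms a] by blast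
qed

end

section \<open>Points and singular subspaces as linear subspaces\<close>

lemma mem_span_pair: "x \<in> vec.span {v, w} \<longleftrightarrow> (\<exists>a b. x = a *s v + b *s w)"
proof
  assume "x \<in> vec.span {v, w}"
  then obtain a b where "x - a *s v = b *s w"
    by (auto simp: vec.span_insert[of v] vec.span_singleton)
  then have "x = a *s v + b *s w" by (simp add: algebra_simps)
  then show "\<exists>a b. x = a *s v + b *s w" by blast
qed (auto intro: vec.span_add vec.span_scale vec.span_base)

lemma subspace_span_le: "vec.subspace U \<Longrightarrow> vec.span S \<subseteq> U \<longleftrightarrow> S \<subseteq> U"
  by (meson order_trans vec.span_minimal vec.span_superset)

lemma proportional_mem_span: "proportional v w \<Longrightarrow> w \<in> S \<Longrightarrow> v \<in> vec.span S"
  unfolding proportional_def using vec.span_scale[OF vec.span_base] by blast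

lemma span_singleton_eq_iff:
  assumes "v \<noteq> 0" "w \<noteq> 0"
  shows "vec.span {v} = vec.span {w} \<longleftrightarrow> proportional v w"
proof
  assume "vec.span {v} = vec.span {w}"
  then have "v \<in> vec.span {w}" using vec.span_base by blast
  then show "proportional v w" using assms(1) by (auto simp: vec.span_singleton intro: proportionalI)
next
  assume p: "proportional v w"
  have "vec.span {x} \<subseteq> vec.span {y}" if "proportional x y" for x y :: "'a ^ 'b"
    using that by (auto simp: proportional_def subspace_span_le intro: vec.span_scale vec.span_base)
  then show "vec.span {v} = vec.span {w}" using p proportional_sym by blast
qed

lemma dim_1_span:
  fixes P :: "('k::field ^ 'm::finite) set"
  shows "vec.subspace P \<and> vec.dim P = 1 \<longleftrightarrow> (\<exists>v. v \<noteq> 0 \<and> P = vec.span {v})"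
proof
  assume P: "vec.subspace P \<and> vec.dim P = 1"
  obtain B where B: "B \<subseteq> P" "vec.independent B" "P \<subseteq> vec.span B" "card B = vec.dim P"
    using vec.basis_exists by blast
  then obtain v where v: "B = {v}" using P card_1_singletonE by metis
  then have "P = vec.span {v}" using B P by (metis vec.span_subspace)
  moreover have "v \<noteq> 0" using B(2) v by auto
  ultimately show "\<exists>v. v \<noteq> 0 \<and> P = vec.span {v}" by blast
next
  assume "\<exists>v. v \<noteq> 0 \<and> P = vec.span {v}"
  then show "vec.subspace P \<and> vec.dim P = 1" by auto
qed

lemma proj_points_eq:
  assumes "vec.subspace U"
  shows "proj_points U = {vec.span {v} |v. v \<noteq> 0 \<and> v \<in> U}"
proof -
  have 1: "vec.span {v} \<subseteq> U \<longleftrightarrow> v \<in> U" for v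
    using subspace_span_le[OF assms, of "{v}"] by simp
  have 2: "P \<in> proj_points U \<longleftrightarrow> (\<exists>v. v \<noteq> 0 \<and> P = vec.span {v}) \<and> P \<subseteq> U" for P
    unfolding proj_points_def dim_1_span[symmetric] by blast
  show ?thesis by (rule set_eqI) (use 1 in \<open>auto simp: 2\<close>)
qed

lemma span_mem_proj_points:
  assumes "v \<noteq> 0" "vec.subspace U"
  shows "vec.span {v} \<in> proj_points U \<longleftrightarrow> v \<in> U"
proof -
  have "vec.subspace (vec.span {v}) \<and> vec.dim (vec.span {v}) = 1" using assms dim_1_span by blast
  then show ?thesis unfolding proj_points_def using subspace_span_le[OF assms(2), of "{v}"] by simp
qed

lemma proj_points_inter: "proj_points U \<inter> proj_points W = proj_points (U \<inter> W)"
  by (auto simp: proj_points_def)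

lemma proj_points_subset:
  assumes "vec.subspace U" "vec.subspace W"
  shows "proj_points U \<subseteq> proj_points W \<longleftrightarrow> U \<subseteq> W"
proof
  assume sub: "proj_points U \<subseteq> proj_points W"
  show "U \<subseteq> W"
  proof
    fix v assume v: "v \<in> U"
    show "v \<in> W"
    proof (cases "v = 0")
      case False
      then show ?thesis using v sub assms span_mem_proj_points by blast
    qed (simp add: assms vec.subspace_0)
  qed
qed (auto simp: proj_points_def)

text \<open>The zero subspace has no points and the union is then empty, so the dimensions are
  compared through the span of the union.\<close>

lemma pdim_proj_points:
  assumes "vec.subspace U"
  shows "pdim (proj_points U) = int (vec.dim U) - 1"
proof -
  have 1: "\<Union>(proj_points U) \<subseteq> U" by (auto simp: proj_points_def)
  have "U \<subseteq> vec.span (\<Union>(proj_points U))"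
  proof
    fix v assume v: "v \<in> U"
    show "v \<in> vec.span (\<Union>(proj_points U))"
    proof (cases "v = 0")
      case False
      then have "vec.span {v} \<in> proj_points U" using v assms span_mem_proj_points by blast
      then show ?thesis using vec.span_base[of v "{v}"] by (meson UnionI singletonI vec.span_base)
    qed (simp add: vec.span_zero)
  qed
  then have "vec.dim U \<le> vec.dim (\<Union>(proj_points U))" by (rule vec.dim_mono)
  moreover have "vec.dim (\<Union>(proj_points U)) \<le> vec.dim U" using 1 by (rule vec.dim_subset)
  ultimately show ?thesis by (simp add: pdim_def)
qed

lemma span_polar_point:
  "v \<noteq> 0 \<Longrightarrow> vec.span {v} \<in> polar_points \<longleftrightarrow> hyp_form v = 0"
  using span_mem_proj_points[of v UNIV]
  by (auto simp: polar_points_def vec.span_singleton hyp_form_simps)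

lemma polar_points_eq: "polar_points = {vec.span {v} |v. sing v}"
proof -
  have P: "\<exists>v. v \<noteq> 0 \<and> P = vec.span {v}" if "P \<in> polar_points" for P :: "('a ^ ('b + 'b)) set"
    using that dim_1_span[of P] by (simp add: polar_points_def proj_points_def)
  show ?thesis
  proof (rule set_eqI, rule iffI)
    fix P :: "('a ^ ('b + 'b)) set" assume "P \<in> polar_points"
    moreover from P[OF this] obtain v where "v \<noteq> 0" "P = vec.span {v}" by auto
    ultimately show "P \<in> {vec.span {v} |v. sing v}" using span_polar_point by (auto simp: sing_def)
  next
    fix P :: "('a ^ ('b + 'b)) set" assume "P \<in> {vec.span {v} |v. sing v}"
    then show "P \<in> polar_points" using span_polar_point by (auto simp: sing_def)
  qed
qed

lemma span_sing: "sing v \<Longrightarrow> vec.span {v} \<in> polar_points"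
  by (auto simp: polar_points_eq)

lemma span_sing_eq_iff: "sing v \<Longrightarrow> sing w \<Longrightarrow> vec.span {v} = vec.span {w} \<longleftrightarrow> proportional v w"
  by (simp add: sing_def span_singleton_eq_iff)

lemma tot_sing_proj_points:
  assumes "vec.subspace U"
  shows "proj_points U \<subseteq> polar_points \<longleftrightarrow> tot_sing U"
proof -
  have "proj_points U \<subseteq> polar_points \<longleftrightarrow> (\<forall>v\<in>U. v \<noteq> 0 \<longrightarrow> vec.span {v} \<in> polar_points)"
    unfolding proj_points_eq[OF assms] by auto
  also have "\<dots> \<longleftrightarrow> (\<forall>v\<in>U. hyp_form v = 0)"
    using span_polar_point hyp_form_zero by metis
  finally show ?thesis using assms by (simp add: tot_sing_def)
qed

lemma singular_subspaces_eq: "singular_subspaces = {proj_points U |U. tot_sing U}"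
proof (rule set_eqI)
  fix X :: "('a ^ ('b + 'b)) set set"
  have "X \<in> singular_subspaces \<longleftrightarrow> (\<exists>U. vec.subspace U \<and> X = proj_points U \<and> proj_points U \<subseteq> polar_points)"
    unfolding singular_subspaces_def by auto
  also have "\<dots> \<longleftrightarrow> (\<exists>U. X = proj_points U \<and> tot_sing U)"
    using tot_sing_proj_points tot_sing_def by metis
  finally show "X \<in> singular_subspaces \<longleftrightarrow> X \<in> {proj_points U |U. tot_sing U}" by simp
qed

lemma polar_lines_eq: "polar_lines = {proj_points U |U. tot_sing U \<and> vec.dim U = 2}"
  unfolding polar_lines_def singular_subspaces_eq by (auto simp: pdim_proj_points tot_sing_def)

lemma dim_span_pair:
  fixes v w :: "'k::field ^ 'm::finite"
  assumes "v \<noteq> 0" "w \<noteq> 0" "\<not> proportional v w"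
  shows "vec.dim (vec.span {v, w}) = 2"
proof -
  have "v \<notin> vec.span {w}" using assms by (auto simp: vec.span_singleton proportional_def)
  then show ?thesis using assms by (simp add: vec.dim_insert)
qed

lemma dim_span_triple:
  fixes u v w :: "'k::field ^ 'm::finite"
  assumes "v \<noteq> 0" "w \<noteq> 0" "\<not> proportional v w" "\<forall>a b. u \<noteq> a *s v + b *s w"
  shows "vec.dim (vec.span {u, v, w}) = 3"
proof -
  have "u \<notin> vec.span {v, w}" using assms by (auto simp: mem_span_pair)
  then show ?thesis using dim_span_pair[OF assms(1-3)] by (simp add: vec.dim_insert[of u])
qed

lemma dim_2_eq_span:
  fixes v w :: "'k::field ^ 'm::finite"
  assumes "vec.subspace U" "vec.dim U = 2" "v \<in> U" "w \<in> U" "v \<noteq> 0" "w \<noteq> 0" "\<not> proportional v w"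
  shows "U = vec.span {v, w}"
  using vec.subspace_dim_equal[of "vec.span {v, w}" U] dim_span_pair[OF assms(5-7)] assms(1-4)
  by (simp add: subspace_span_le)

lemma tot_sing_span_pair:
  assumes "sing v" "sing w" "hyp_bil v w = 0"
  shows "tot_sing (vec.span {v, w})"
proof -
  have "hyp_form x = 0" if "x \<in> vec.span {v, w}" for x
    using that assms by (auto simp: mem_span_pair sing_def hyp_form_simps hyp_bil_simps)
  then show ?thesis by (simp add: tot_sing_def)
qed

lemma tot_sing_span_triple:
  assumes "sing u" "sing v" "sing w" "hyp_bil u v = 0" "hyp_bil u w = 0" "hyp_bil v w = 0"
  shows "tot_sing (vec.span {u, v, w})"
proof -
  have "u \<in> hyp_perp (vec.span {v, w})"
    using assms by (simp add: hyp_perp_span) (simp add: hyp_perp_def)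
  then have "tot_sing (vec.span (insert u (vec.span {v, w})))"
    using tot_sing_span_insert tot_sing_span_pair assms sing_def by blast
  moreover have "vec.span {u, v, w} \<subseteq> vec.span (insert u (vec.span {v, w}))"
    by (rule vec.span_mono) (use vec.span_superset in blast)
  ultimately show ?thesis by (auto simp: tot_sing_def)
qed

lemma collinear_pointsI: "L \<in> polar_lines \<Longrightarrow> P \<in> L \<Longrightarrow> Q \<in> L \<Longrightarrow> collinear_points P Q"
  by (auto simp: collinear_points_def)

text \<open>Collinearity of a point with itself also asks for a line through it;
  \<open>CARD('n) \<ge> 2\<close> supplies one inside a totally singular subspace of dimension
  \<open>n\<close>.\<close>

lemma collinear_points_span:
  fixes v w :: "'k::field ^ ('n::finite + 'n)"
  assumes n: "CARD('n) \<ge> 2" and v: "sing v" and w: "sing w"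
  shows "collinear_points (vec.span {v}) (vec.span {w}) \<longleftrightarrow> hyp_bil v w = 0"
proof
  assume "collinear_points (vec.span {v}) (vec.span {w})"
  then obtain U where U: "tot_sing U" "vec.span {v} \<in> proj_points U" "vec.span {w} \<in> proj_points U"
    unfolding collinear_points_def polar_lines_eq by blast
  then have "v \<in> U" "w \<in> U" using v w span_mem_proj_points by (auto simp: sing_def tot_sing_def)
  then show "hyp_bil v w = 0" using tot_sing_hyp_bil U by blast
next
  assume vw: "hyp_bil v w = 0"
  have "\<exists>U. tot_sing U \<and> vec.dim U = 2 \<and> v \<in> U \<and> w \<in> U"
  proof (cases "proportional v w")
    case False
    then show ?thesis
      using tot_sing_span_pair[OF v w vw] dim_span_pair[of v w] v w
      by (intro exI[of _ "vec.span {v, w}"]) (auto simp: sing_def vec.span_base)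
  next
    case True
    then obtain c where c: "w = c *s v" using proportional_sym proportional_def by metis
    obtain M where M: "tot_sing M" "vec.span {v} \<subseteq> M" "vec.dim M = CARD('n)"
      using tot_sing_extend[OF tot_sing_singleton] v sing_def by metis
    obtain x where x: "x \<in> M" "x \<notin> vec.span {v}"
      using vec.dim_subset[of M "vec.span {v}"] M(3) n v by (auto simp: sing_def split: if_splits)
    have x0: "x \<noteq> 0" using x vec.span_zero by metis
    have np: "\<not> proportional v x"
    proof
      assume "proportional v x"
      then obtain d where "x = d *s v" using proportional_sym proportional_def by metis
      then show False using x vec.span_scale[OF vec.span_base, of v "{v}"] by simp
    qed
    have vM: "v \<in> M" using M(2) vec.span_base by blast
    have "vec.span {v, x} \<subseteq> M" using vM x M(1) by (simp add: subspace_span_le tot_sing_def)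
    then have "tot_sing (vec.span {v, x})" using M(1) by (auto simp: tot_sing_def)
    moreover have "vec.dim (vec.span {v, x}) = 2" using dim_span_pair[OF _ x0 np] v sing_def by blast
    moreover have "v \<in> vec.span {v, x}" "w \<in> vec.span {v, x}"
      unfolding c by (simp_all add: vec.span_base vec.span_scale)
    ultimately show ?thesis by blast
  qed
  then obtain U where U: "tot_sing U" "vec.dim U = 2" "v \<in> U" "w \<in> U" by blast
  then have "vec.span {v} \<in> proj_points U" "vec.span {w} \<in> proj_points U"
    using span_mem_proj_points v w unfolding sing_def tot_sing_def by blast+
  then show "collinear_points (vec.span {v}) (vec.span {w})"
    using U unfolding collinear_points_def polar_lines_eq by blast
qed

lemma opposite_points_span:
  fixes v w :: "'k::field ^ ('n::finite + 'n)"
  assumes "CARD('n) \<ge> 2" "sing v" "sing w"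
  shows "opposite_points (vec.span {v}) (vec.span {w}) \<longleftrightarrow> hyp_bil v w \<noteq> 0"
  using collinear_points_span[OF assms] span_sing[OF assms(2)] span_sing[OF assms(3)]
  by (simp add: opposite_points_def)

section \<open>Collineations on representing vectors\<close>

text \<open>A vector chosen on the image point. No scalar is distinguished, so statements about
  \<open>rep\<close> concern proportionality, orthogonality and spans.\<close>

definition rep ::
    "(('k::field ^ ('n::finite + 'n)) set \<Rightarrow> ('k ^ ('n + 'n)) set) \<Rightarrow> 'k ^ ('n + 'n) \<Rightarrow> 'k ^ ('n + 'n)" where
  "rep \<theta> v = (SOME w. sing w \<and> \<theta> (vec.span {v}) = vec.span {w})"

lemma rep:
  assumes "collineation \<theta>" "sing v"
  shows "sing (rep \<theta> v)" and "\<theta> (vec.span {v}) = vec.span {rep \<theta> v}"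
proof -
  have "\<theta> (vec.span {v}) \<in> polar_points"
    using assms span_sing bij_betwE unfolding collineation_def by blast
  then have "\<exists>w. sing w \<and> \<theta> (vec.span {v}) = vec.span {w}" unfolding polar_points_eq by blast
  from someI_ex[OF this] show "sing (rep \<theta> v)" "\<theta> (vec.span {v}) = vec.span {rep \<theta> v}"
    unfolding rep_def by blast+
qed

lemma rep_proportional:
  assumes "collineation \<theta>" "sing v" "sing w"
  shows "proportional (rep \<theta> v) (rep \<theta> w) \<longleftrightarrow> proportional v w"
proof -
  have "inj_on \<theta> polar_points" using assms by (auto simp: collineation_def bij_betw_def)
  then have "\<theta> (vec.span {v}) = \<theta> (vec.span {w}) \<longleftrightarrow> vec.span {v} = vec.span {w}"
    by (rule inj_on_eq_iff[OF _ span_sing[OF assms(2)] span_sing[OF assms(3)]])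
  then show ?thesis
    unfolding rep(2)[OF assms(1,2)] rep(2)[OF assms(1,3)] span_sing_eq_iff[OF assms(2,3)]
      span_sing_eq_iff[OF rep(1)[OF assms(1,2)] rep(1)[OF assms(1,3)]] .
qed

text \<open>Collineations carry lines to lines in both directions and thereby preserve collinearity,
  which is orthogonality of representing vectors.\<close>

lemma rep_orth:
  fixes v w :: "'k::field ^ ('n::finite + 'n)"
  assumes n: "CARD('n) \<ge> 2" and col: "collineation \<theta>" and v: "sing v" and w: "sing w"
  shows "hyp_bil (rep \<theta> v) (rep \<theta> w) = 0 \<longleftrightarrow> hyp_bil v w = 0"
proof -
  have bij: "bij_betw \<theta> polar_points polar_points"
    and lines: "\<And>L. L \<subseteq> polar_points \<Longrightarrow> \<theta> ` L \<in> polar_lines \<longleftrightarrow> L \<in> polar_lines"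
    using col by (auto simp: collineation_def)
  have sub: "L \<subseteq> polar_points" if "L \<in> polar_lines" for L :: "('k ^ ('n + 'n)) set set"
    using that by (auto simp: polar_lines_def singular_subspaces_def)
  let ?P = "vec.span {v}" and ?Q = "vec.span {w}"
  have PQ: "?P \<in> polar_points" "?Q \<in> polar_points" using v w span_sing by auto
  have "collinear_points (\<theta> ?P) (\<theta> ?Q) \<longleftrightarrow> collinear_points ?P ?Q"
  proof
    assume "collinear_points ?P ?Q"
    then obtain L where L: "L \<in> polar_lines" "?P \<in> L" "?Q \<in> L"
      unfolding collinear_points_def by blast
    have "\<theta> ` L \<in> polar_lines" using lines[OF sub[OF L(1)]] L(1) by simp
    then show "collinear_points (\<theta> ?P) (\<theta> ?Q)"
      by (rule collinear_pointsI) (use L in simp_all)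
  next
    assume "collinear_points (\<theta> ?P) (\<theta> ?Q)"
    then obtain L where L: "L \<in> polar_lines" "\<theta> ?P \<in> L" "\<theta> ?Q \<in> L"
      unfolding collinear_points_def by blast
    \<comment> \<open>The image of this preimage is all of \<open>L\<close> by surjectivity; the
      equivalence in \<open>collineation\<close> then shows that it is a line.\<close>
    define L' where "L' = {P \<in> polar_points. \<theta> P \<in> L}"
    have "\<theta> ` L' = \<theta> ` polar_points \<inter> L" by (auto simp: L'_def)
    then have "\<theta> ` L' = L" using sub[OF L(1)] bij by (simp add: bij_betw_def Int_absorb1)
    moreover have "L' \<subseteq> polar_points" by (auto simp: L'_def)
    ultimately have "L' \<in> polar_lines" using lines[of L'] L(1) by simp
    moreover have PQL: "?P \<in> L'" "?Q \<in> L'" using L PQ by (simp_all add: L'_def)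
    ultimately show "collinear_points ?P ?Q" by (rule collinear_pointsI)
  qed
  then show ?thesis
    unfolding rep(2)[OF col v] rep(2)[OF col w] collinear_points_span[OF n v w]
      collinear_points_span[OF n rep(1)[OF col v] rep(1)[OF col w]] .
qed

lemma rep_mem_span:
  fixes v w :: "'k::field ^ ('n::finite + 'n)"
  assumes n: "CARD('n) \<ge> 2" and col: "collineation \<theta>" and v: "sing v" and w: "sing w"
    and vw: "hyp_bil v w = 0" and x: "sing x" "x \<in> vec.span {v, w}"
  shows "rep \<theta> x \<in> vec.span {rep \<theta> v, rep \<theta> w}"
proof (cases "proportional v w")
  case True
  then obtain c where c: "w = c *s v" using proportional_sym proportional_def by metis
  obtain a b where "x = a *s v + b *s w" using x mem_span_pair by blast
  then have "x = (a + b * c) *s v" by (simp add: c vec.scale_left_distrib vector_smult_assoc)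
  then have "proportional x v" using x proportionalI unfolding sing_def by blast
  then have "proportional (rep \<theta> x) (rep \<theta> v)" using rep_proportional col x v by blast
  then show ?thesis by (rule proportional_mem_span) simp
next
  case False
  have r: "sing (rep \<theta> v)" "sing (rep \<theta> w)" "sing (rep \<theta> x)" using rep col v w x by blast+
  let ?U = "vec.span {v, w}"
  have "tot_sing ?U" "vec.dim ?U = 2"
    using tot_sing_span_pair[OF v w vw] dim_span_pair[of v w] v w False by (auto simp: sing_def)
  then have "proj_points ?U \<in> polar_lines" "proj_points ?U \<subseteq> polar_points"
    unfolding polar_lines_eq using tot_sing_proj_points by auto
  then have "\<theta> ` proj_points ?U \<in> polar_lines" using col by (auto simp: collineation_def)
  then obtain W where W: "tot_sing W" "vec.dim W = 2" "\<theta> ` proj_points ?U = proj_points W"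
    unfolding polar_lines_eq by blast
  have mem: "rep \<theta> y \<in> W" if "sing y" "y \<in> ?U" for y
  proof -
    have "vec.span {y} \<in> proj_points ?U" using that by (auto simp: sing_def span_mem_proj_points)
    then have "vec.span {rep \<theta> y} \<in> proj_points W" using W(3) rep(2)[OF col that(1)] by blast
    then show ?thesis
      using W(1) rep(1)[OF col that(1)] span_mem_proj_points unfolding sing_def tot_sing_def by blast
  qed
  have "W = vec.span {rep \<theta> v, rep \<theta> w}"
    using W(1,2) mem[OF v] mem[OF w] r False rep_proportional[OF col v w]
    by (intro dim_2_eq_span) (auto simp: sing_def tot_sing_def vec.span_base)
  then show ?thesis using mem x by blast
qed

lemma collineation_the_inv:
  assumes "collineation \<theta>"
  shows "collineation (the_inv_into polar_points \<theta>)"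
proof -
  let ?i = "the_inv_into polar_points \<theta>"
  have bij: "bij_betw \<theta> polar_points polar_points" using assms by (simp add: collineation_def)
  have "\<theta> ` ?i ` L = L" if "L \<subseteq> polar_points" for L
    unfolding image_image using that f_the_inv_into_f_bij_betw[OF bij] by force
  moreover have "?i ` L \<subseteq> polar_points" if "L \<subseteq> polar_points" for L
    using that bij_betw_the_inv_into[OF bij] by (auto simp: bij_betw_def)
  ultimately have "?i ` L \<in> polar_lines \<longleftrightarrow> L \<in> polar_lines" if "L \<subseteq> polar_points" for L
    using assms that unfolding collineation_def by metis
  then show ?thesis using bij_betw_the_inv_into[OF bij] by (simp add: collineation_def)
qed

lemma rep_the_inv:
  assumes col: "collineation \<theta>" and v: "sing v"
  shows "proportional (rep (the_inv_into polar_points \<theta>) (rep \<theta> v)) v"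
    and "proportional (rep \<theta> (rep (the_inv_into polar_points \<theta>) v)) v"
proof -
  let ?i = "the_inv_into polar_points \<theta>"
  note col' = collineation_the_inv[OF col]
  have bij: "bij_betw \<theta> polar_points polar_points" using assms by (simp add: collineation_def)
  note r = rep[OF col v] and r' = rep[OF col' v]
  have "vec.span {rep ?i (rep \<theta> v)} = vec.span {v}"
    unfolding rep(2)[OF col' r(1), symmetric] r(2)[symmetric]
    by (rule the_inv_into_f_f[OF bij_betw_imp_inj_on[OF bij] span_sing[OF v]])
  then show "proportional (rep ?i (rep \<theta> v)) v"
    unfolding span_sing_eq_iff[OF rep(1)[OF col' r(1)] v] .
  have "vec.span {rep \<theta> (rep ?i v)} = vec.span {v}"
    unfolding rep(2)[OF col r'(1), symmetric] r'(2)[symmetric]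
    using f_the_inv_into_f_bij_betw[OF bij] span_sing[OF v] by blast
  then show "proportional (rep \<theta> (rep ?i v)) v"
    unfolding span_sing_eq_iff[OF rep(1)[OF col r'(1)] v] .
qed

text \<open>The point \<open>x\<close> lies on a line joining \<open>u\<close> to a point
  \<open>z\<close> of the span of \<open>v\<close> and \<open>w\<close>, so the statement for two
  vectors applies twice.\<close>

lemma rep_mem_span_triple:
  fixes u v w :: "'k::field ^ ('n::finite + 'n)"
  assumes n: "CARD('n) \<ge> 2" and col: "collineation \<theta>" and s: "sing u" "sing v" "sing w"
    and orth: "hyp_bil u v = 0" "hyp_bil u w = 0" "hyp_bil v w = 0"
    and x: "sing x" "x \<in> vec.span {u, v, w}"
  shows "rep \<theta> x \<in> vec.span {rep \<theta> u, rep \<theta> v, rep \<theta> w}"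
proof -
  let ?S = "{rep \<theta> u, rep \<theta> v, rep \<theta> w}"
  obtain k where k: "x - k *s u \<in> vec.span {v, w}"
    using x vec.span_breakdown_eq by blast
  define z where "z = x - k *s u"
  obtain a b where ab: "z = a *s v + b *s w" using k z_def mem_span_pair by blast
  have xz: "x = k *s u + 1 *s z" by (simp add: z_def)
  have sub: "vec.span {rep \<theta> v, rep \<theta> w} \<subseteq> vec.span ?S" by (rule vec.span_mono) auto
  show ?thesis
  proof (cases "z = 0")
    case True
    then have "proportional x u"
      using xz x(1) proportionalI[of x k u] by (simp add: sing_def)
    then have "proportional (rep \<theta> x) (rep \<theta> u)" using rep_proportional col x s by blast
    then show ?thesis by (rule proportional_mem_span) simp
  next
    case False
    then have sz: "sing z" using s orth by (simp add: sing_def ab hyp_form_simps hyp_bil_simps)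
    have "rep \<theta> z \<in> vec.span {rep \<theta> v, rep \<theta> w}"
      using rep_mem_span[OF n col s(2,3) orth(3) sz] k z_def by blast
    then have "rep \<theta> z \<in> vec.span ?S" using sub by blast
    moreover have "rep \<theta> u \<in> vec.span ?S" by (simp add: vec.span_base)
    ultimately have "vec.span {rep \<theta> u, rep \<theta> z} \<subseteq> vec.span ?S" by (simp add: subspace_span_le)
    moreover have "hyp_bil u z = 0" using orth by (simp add: ab hyp_bil_simps)
    moreover have "x \<in> vec.span {u, z}" using xz mem_span_pair by blast
    ultimately show ?thesis using rep_mem_span[OF n col s(1) sz _ x(1)] by blast
  qed
qed

lemma span_cong_proportional:
  assumes "\<And>i. i \<in> I \<Longrightarrow> proportional (f i) (h i)"
  shows "vec.span (f ` I) \<subseteq> vec.span (h ` I)"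
proof -
  have "f i \<in> vec.span (h ` I)" if "i \<in> I" for i
    using proportional_mem_span[OF assms[OF that]] that by simp
  then show ?thesis by (intro vec.span_minimal) auto
qed

text \<open>Collineations are defined by lines alone. One inclusion follows from
  \<open>rep_mem_span_triple\<close>, the other from the same statement for the inverse
  collineation.\<close>

lemma image_plane:
  fixes u v w :: "'k::field ^ ('n::finite + 'n)"
  assumes n: "CARD('n) \<ge> 2" and col: "collineation \<theta>" and s: "sing u" "sing v" "sing w"
    and orth: "hyp_bil u v = 0" "hyp_bil u w = 0" "hyp_bil v w = 0"
  shows "\<theta> ` proj_points (vec.span {u, v, w}) = proj_points (vec.span {rep \<theta> u, rep \<theta> v, rep \<theta> w})"
    (is "\<theta> ` proj_points ?U = proj_points ?W")
proof (intro equalityI subsetI)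
  have ts: "tot_sing ?U" using tot_sing_span_triple s orth by blast
  have r: "sing (rep \<theta> u)" "sing (rep \<theta> v)" "sing (rep \<theta> w)" using rep col s by blast+
  have r_orth: "hyp_bil (rep \<theta> u) (rep \<theta> v) = 0" "hyp_bil (rep \<theta> u) (rep \<theta> w) = 0"
    "hyp_bil (rep \<theta> v) (rep \<theta> w) = 0"
    using rep_orth[OF n col] s orth by blast+
  {
    fix Q assume "Q \<in> \<theta> ` proj_points ?U"
    then obtain x where x: "x \<noteq> 0" "x \<in> ?U" "Q = \<theta> (vec.span {x})"
      by (auto simp: proj_points_eq[OF vec.subspace_span])
    then have sx: "sing x" using ts by (auto simp: sing_def tot_sing_def)
    have "rep \<theta> x \<in> ?W" using rep_mem_span_triple[OF n col s orth sx x(2)] .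
    then show "Q \<in> proj_points ?W"
      using rep[OF col sx] x(3) by (auto simp: sing_def span_mem_proj_points)
  next
    fix Q assume "Q \<in> proj_points ?W"
    then obtain y where y: "y \<noteq> 0" "y \<in> ?W" "Q = vec.span {y}"
      by (auto simp: proj_points_eq[OF vec.subspace_span])
    have sy: "sing y"
      using y tot_sing_span_triple[OF r r_orth] by (auto simp: sing_def tot_sing_def)
    let ?i = "the_inv_into polar_points \<theta>"
    note col' = collineation_the_inv[OF col]
    define x where "x = rep ?i y"
    have "x \<in> vec.span {rep ?i (rep \<theta> u), rep ?i (rep \<theta> v), rep ?i (rep \<theta> w)}"
      unfolding x_def using rep_mem_span_triple[OF n col' r r_orth sy y(2)] .
    also have "\<dots> = vec.span ((\<lambda>z. rep ?i (rep \<theta> z)) ` {u, v, w})" by simp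
    also have "\<dots> \<subseteq> vec.span ((\<lambda>z. z) ` {u, v, w})"
      using rep_the_inv(1)[OF col] s by (intro span_cong_proportional) auto
    finally have "x \<in> ?U" by simp
    moreover have sx: "sing x" unfolding x_def using rep col' sy by blast
    ultimately have "vec.span {x} \<in> proj_points ?U" by (auto simp: sing_def span_mem_proj_points)
    moreover have "\<theta> (vec.span {x}) = Q"
      unfolding rep(2)[OF col sx] y(3) span_sing_eq_iff[OF rep(1)[OF col sx] sy]
      unfolding x_def by (rule rep_the_inv(2)[OF col sy])
    ultimately show "Q \<in> \<theta> ` proj_points ?U" by (metis imageI)
  }
qed

text \<open>Since the image is a singular subspace of the same dimension, the only clause of
  opposition that can fail is the one on points; it yields a point of the subspace opposite no point
  of the image.\<close>

lemma not_opposite_span: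
  fixes S :: "('k::field ^ ('n::finite + 'n)) set"
  assumes n: "CARD('n) \<ge> 2" and diag: "opposition_diagram_Dn11 \<theta>" and col: "collineation \<theta>"
    and U: "tot_sing (vec.span S)" "vec.dim (vec.span S) \<ge> 2"
    and W: "\<theta> ` proj_points (vec.span S) = proj_points W" "tot_sing W" "vec.dim W = vec.dim (vec.span S)"
    and sing: "\<And>y. y \<in> S \<Longrightarrow> sing y"
  shows "\<exists>x\<in>vec.span S. x \<noteq> 0 \<and> (\<forall>y\<in>S. hyp_bil x (rep \<theta> y) = 0)"
proof -
  let ?X = "proj_points (vec.span S)"
  have X: "?X \<in> singular_subspaces" "\<theta> ` ?X \<in> singular_subspaces"
    using U W unfolding singular_subspaces_eq by blast+
  have pd: "pdim ?X = pdim (\<theta> ` ?X)" "pdim ?X > 0"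
    using U W by (simp_all add: pdim_proj_points tot_sing_def)
  then have "\<not> opposite_subspaces ?X (\<theta> ` ?X)"
    using diag X by (auto simp: opposition_diagram_Dn11_def)
  then obtain P where P: "P \<in> ?X" "\<forall>Q\<in>\<theta> ` ?X. \<not> opposite_points P Q"
    using X pd unfolding opposite_subspaces_def by blast
  then obtain x where x: "x \<noteq> 0" "x \<in> vec.span S" "P = vec.span {x}"
    by (auto simp: proj_points_eq[OF vec.subspace_span])
  have sx: "sing x" using x U by (auto simp: sing_def tot_sing_def)
  have "hyp_bil x (rep \<theta> y) = 0" if y: "y \<in> S" for y
  proof -
    have "vec.span {y} \<in> ?X" using y sing[OF y] by (auto simp: sing_def span_mem_proj_points vec.span_base)
    then have "\<not> opposite_points P (\<theta> (vec.span {y}))" using P by blast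
    then show ?thesis
      using opposite_points_span[OF n sx rep(1)[OF col sing[OF y]]] x(3) rep(2)[OF col sing[OF y]] by simp
  qed
  then show ?thesis using x by blast
qed

lemma opposition_map_rep:
  fixes \<theta> :: "('k::field ^ ('n::finite + 'n)) set \<Rightarrow> ('k ^ ('n + 'n)) set"
  assumes n: "CARD('n) \<ge> 3" and col: "collineation \<theta>" and diag: "opposition_diagram_Dn11 \<theta>"
  shows "opposition_map (rep \<theta>)"
proof
  have n2: "CARD('n) \<ge> 2" using n by simp
  show "CARD('n) \<ge> 3" by (rule n)
  show "sing (rep \<theta> v)" if "sing v" for v using rep col that by blast
  show "hyp_bil (rep \<theta> v) (rep \<theta> w) = 0 \<longleftrightarrow> hyp_bil v w = 0" if "sing v" "sing w" for v w
    using rep_orth[OF n2 col that] .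
  show "proportional v w" if "sing v" "sing w" "proportional (rep \<theta> v) (rep \<theta> w)" for v w
    using rep_proportional col that by blast
  show "proportional (rep \<theta> (c *s v)) (rep \<theta> v)" if "sing v" "c \<noteq> 0" for v c
    using rep_proportional[OF col sing_scale] that proportional_scale by blast
  show "\<exists>c d. rep \<theta> (v + w) = c *s rep \<theta> v + d *s rep \<theta> w"
    if vw: "sing v" "sing w" "hyp_bil v w = 0" "v + w \<noteq> 0" for v w
  proof -
    have "sing (v + w)" using vw by (simp add: sing_def hyp_form_simps)
    moreover have "v + w \<in> vec.span {v, w}" by (simp add: vec.span_add vec.span_base)
    ultimately show ?thesis using rep_mem_span[OF n2 col vw(1-3)] mem_span_pair by blast
  qed
  show "\<exists>a b. (a \<noteq> 0 \<or> b \<noteq> 0) \<and> (\<forall>x\<in>{v, w}. hyp_bil (a *s v + b *s w) (rep \<theta> x) = 0)"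
    if vw: "sing v" "sing w" "hyp_bil v w = 0" "\<not> proportional v w" for v w
  proof -
    have ts: "tot_sing (vec.span {v, w})" using tot_sing_span_pair vw by blast
    have dim: "vec.dim (vec.span {v, w}) = 2" using dim_span_pair vw by (auto simp: sing_def)
    have "proj_points (vec.span {v, w}) \<in> polar_lines" using ts dim unfolding polar_lines_eq by blast
    then have "\<theta> ` proj_points (vec.span {v, w}) \<in> polar_lines"
      using col tot_sing_proj_points[OF vec.subspace_span] ts unfolding collineation_def by blast
    then obtain W where W: "tot_sing W" "vec.dim W = 2" "\<theta> ` proj_points (vec.span {v, w}) = proj_points W"
      unfolding polar_lines_eq by blast
    obtain x where x: "x \<in> vec.span {v, w}" "x \<noteq> 0" "\<forall>y\<in>{v, w}. hyp_bil x (rep \<theta> y) = 0"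
      using not_opposite_span[OF n2 diag col ts _ W(3,1)] W(2) dim vw by auto
    then obtain a b where "x = a *s v + b *s w" using mem_span_pair by blast
    then show ?thesis using x by (intro exI[of _ a] exI[of _ b]) auto
  qed
  show "\<exists>a b c. (a \<noteq> 0 \<or> b \<noteq> 0 \<or> c \<noteq> 0) \<and>
        (\<forall>x\<in>{u, v, w}. hyp_bil (a *s u + b *s v + c *s w) (rep \<theta> x) = 0)"
    if s: "sing u" "sing v" "sing w" and orth: "hyp_bil u v = 0" "hyp_bil u w = 0" "hyp_bil v w = 0"
      and np: "\<not> proportional v w" and ni: "\<forall>a b. u \<noteq> a *s v + b *s w" for u v w
  proof -
    let ?i = "the_inv_into polar_points \<theta>"
    note col' = collineation_the_inv[OF col]
    have ts: "tot_sing (vec.span {u, v, w})" using tot_sing_span_triple s orth by blast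
    have dim: "vec.dim (vec.span {u, v, w}) = 3"
      using dim_span_triple[OF _ _ np ni] s by (auto simp: sing_def)
    have r: "sing (rep \<theta> u)" "sing (rep \<theta> v)" "sing (rep \<theta> w)" using rep col s by blast+
    have r_orth: "hyp_bil (rep \<theta> u) (rep \<theta> v) = 0" "hyp_bil (rep \<theta> u) (rep \<theta> w) = 0"
      "hyp_bil (rep \<theta> v) (rep \<theta> w) = 0"
      using rep_orth[OF n2 col] s orth by blast+
    have "\<not> proportional (rep \<theta> v) (rep \<theta> w)" using rep_proportional col s np by blast
    \<comment> \<open>Otherwise the inverse collineation would carry \<open>u\<close> back into the
      span of \<open>v\<close> and \<open>w\<close>.\<close>
    moreover have "rep \<theta> u \<notin> vec.span {rep \<theta> v, rep \<theta> w}"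
    proof
      assume "rep \<theta> u \<in> vec.span {rep \<theta> v, rep \<theta> w}"
      then have "rep ?i (rep \<theta> u) \<in> vec.span {rep ?i (rep \<theta> v), rep ?i (rep \<theta> w)}"
        using rep_mem_span[OF n2 col' r(2,3) r_orth(3) r(1)] by blast
      also have "\<dots> = vec.span ((\<lambda>z. rep ?i (rep \<theta> z)) ` {v, w})" by simp
      also have "\<dots> \<subseteq> vec.span ((\<lambda>z. z) ` {v, w})"
        using rep_the_inv(1)[OF col] s by (intro span_cong_proportional) auto
      finally have "rep ?i (rep \<theta> u) \<in> vec.span {v, w}" by simp
      moreover obtain c where "u = c *s rep ?i (rep \<theta> u)"
        using rep_the_inv(1)[OF col s(1)] proportional_sym proportional_def by metis
      ultimately have "u \<in> vec.span {v, w}" using vec.span_scale by metis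
      then show False using ni mem_span_pair by blast
    qed
    then have "\<forall>a b. rep \<theta> u \<noteq> a *s rep \<theta> v + b *s rep \<theta> w" using mem_span_pair by blast
    ultimately have dimr: "vec.dim (vec.span {rep \<theta> u, rep \<theta> v, rep \<theta> w}) = 3"
      using dim_span_triple r by (auto simp: sing_def)
    obtain x where x: "x \<in> vec.span {u, v, w}" "x \<noteq> 0" "\<forall>y\<in>{u, v, w}. hyp_bil x (rep \<theta> y) = 0"
      using not_opposite_span[OF n2 diag col ts _ image_plane[OF n2 col s orth]
          tot_sing_span_triple[OF r r_orth]] dim dimr s by auto
    obtain a where "x - a *s u \<in> vec.span {v, w}" using x(1) vec.span_breakdown_eq by blast
    then obtain b c where "x - a *s u = b *s v + c *s w" using mem_span_pair by blast
    then have "x = a *s u + b *s v + c *s w" by (simp add: algebra_simps)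
    then show ?thesis using x by (intro exI[of _ a] exI[of _ b] exI[of _ c]) auto
  qed
qed

lemma diagram_ex_opp:
  fixes \<theta> :: "('k::field ^ ('n::finite + 'n)) set \<Rightarrow> ('k ^ ('n + 'n)) set"
  assumes n: "CARD('n) \<ge> 2" and col: "collineation \<theta>" and diag: "opposition_diagram_Dn11 \<theta>"
  shows "\<exists>e. sing e \<and> hyp_bil e (rep \<theta> e) \<noteq> 0"
proof -
  obtain P where "P \<in> polar_points" "opposite_points P (\<theta> P)"
    using diag unfolding opposition_diagram_Dn11_def by blast
  then obtain e where e: "sing e" "opposite_points (vec.span {e}) (\<theta> (vec.span {e}))"
    unfolding polar_points_eq by blast
  then have "hyp_bil e (rep \<theta> e) \<noteq> 0"
    unfolding rep(2)[OF col e(1)] opposite_points_span[OF n e(1) rep(1)[OF col e(1)]] by simp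
  then show ?thesis using e by blast
qed

theorem collineation_reflection:
  fixes \<theta> :: "('k::field ^ ('n::finite + 'n)) set \<Rightarrow> ('k ^ ('n + 'n)) set"
  assumes n: "CARD('n) \<ge> 3" and col: "collineation \<theta>" and diag: "opposition_diagram_Dn11 \<theta>"
  obtains p where "hyp_form p \<noteq> 0"
    and "\<And>v. sing v \<Longrightarrow> \<theta> (vec.span {v}) = vec.span {hyp_reflection p v}"
proof -
  interpret opposition_map "rep \<theta>" by (rule opposition_map_rep[OF assms])
  obtain e where "opp e" using diagram_ex_opp[OF _ col diag] n by (auto simp: opp_def)
  then obtain p where p: "hyp_form p \<noteq> 0"
    "\<forall>v. sing v \<longrightarrow> proportional (rep \<theta> v) (hyp_reflection p v)"
    using ex_reflection by blast
  have "\<theta> (vec.span {v}) = vec.span {hyp_reflection p v}" if v: "sing v" for v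
  proof -
    have "sing (hyp_reflection p v)" using sing_reflection[OF p(1)] v by blast
    then show ?thesis
      unfolding rep(2)[OF col v] using span_sing_eq_iff[OF rep(1)[OF col v]] p(2) v by simp
  qed
  then show ?thesis using that p by blast
qed

section \<open>The fixed parabolic quadric\<close>

text \<open>The members of a full frame are singular, and only the zero vector is orthogonal to all
  of them.\<close>

lemma ex_sing_not_perp:
  fixes p :: "'k::field ^ ('n::finite + 'n)"
  assumes "p \<noteq> 0"
  shows "\<exists>e. sing e \<and> hyp_bil e p \<noteq> 0"
proof -
  obtain M :: "('k ^ ('n + 'n)) set" where M: "tot_sing M" "vec.dim M = CARD('n)"
    using ex_tot_sing_max by blast
  obtain c :: "int \<Rightarrow> 'k ^ ('n + 'n)" where c: "hyp_frame CARD('n) c"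
    using tot_sing_frame[OF M(1)] M(2) by auto
  have "\<exists>i\<in>frame_index CARD('n). hyp_bil p (c (- i)) \<noteq> 0"
  proof (rule ccontr)
    assume "\<not> ?thesis"
    then have "p = 0" by (subst hyp_frame_expand[OF c]) simp
    then show False using assms by simp
  qed
  then obtain i where i: "- i \<in> frame_index CARD('n)" "hyp_bil p (c (- i)) \<noteq> 0"
    using uminus_frame_index by blast
  then have "hyp_form (c (- i)) = 0" using c by (auto simp: hyp_frame_def)
  moreover have "c (- i) \<noteq> 0" using i(2) by (auto simp: hyp_bil_simps)
  ultimately show ?thesis using i(2) by (auto simp: sing_def hyp_bil_commute[of p])
qed

text \<open>For a singular \<open>v\<close> not orthogonal to \<open>p\<close>, the difference of
  \<open>v\<close> and its mirror image is a nonzero multiple of \<open>p\<close>.\<close>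

lemma nonsingular_eq_add_sing:
  assumes p: "hyp_form p \<noteq> 0"
  shows "\<exists>e f. sing e \<and> sing f \<and> p = e + f"
proof -
  have "p \<noteq> 0" using p hyp_form_zero by auto
  then obtain v where v: "sing v" "hyp_bil v p \<noteq> 0" using ex_sing_not_perp by blast
  define k where "k = hyp_bil v p / hyp_form p"
  have k: "k \<noteq> 0" using v p by (simp add: k_def)
  have "hyp_reflection p v = v - k *s p" by (simp add: hyp_reflection_def k_def)
  then have "k *s p = v - hyp_reflection p v" by simp
  then have "(1 / k) *s (k *s p) = (1 / k) *s (v - hyp_reflection p v)" by simp
  then have "p = (1 / k) *s v + (- (1 / k)) *s hyp_reflection p v"
    using k by (simp add: vector_smult_assoc vec.scale_right_diff_distrib)
  moreover have "sing ((1 / k) *s v)" using v k by (intro sing_scale) auto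
  moreover have "sing ((- (1 / k)) *s hyp_reflection p v)"
    using v k sing_reflection[OF p, of v] by (intro sing_scale) auto
  ultimately show ?thesis by blast
qed

text \<open>Removing the pair \<open>e\<close>, \<open>(1 / t) *s f\<close> from a full frame that
  contains it leaves a frame of the perp of \<open>e\<close> and \<open>f\<close>.\<close>

lemma hyperbolic_pair_perp_frame:
  fixes e f :: "'k::field ^ ('n::finite + 'n)"
  assumes e: "sing e" and f: "sing f" and ef: "hyp_bil e f = t" "t \<noteq> 0"
  shows "\<exists>c. hyp_frame (CARD('n) - 1) c \<and>
    (\<forall>i\<in>frame_index (CARD('n) - 1). hyp_bil (c i) e = 0 \<and> hyp_bil (c i) f = 0) \<and>
    (\<forall>v. v = (hyp_bil v f / t) *s e + (hyp_bil v e / t) *s f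
      + (\<Sum>i\<in>frame_index (CARD('n) - 1). hyp_bil v (c (- i)) *s c i))"
proof -
  let ?m = "CARD('n) - 1"
  have "\<exists>c. hyp_frame CARD('n) c \<and> c 1 = e \<and> c (-1) = (1 / t) *s f"
    by (rule hyperbolic_pair_frame)
      (use e f ef in \<open>auto simp: sing_def hyp_form_simps hyp_bil_simps\<close>)
  then obtain b where b: "hyp_frame CARD('n) b" "b 1 = e" "b (-1) = (1 / t) *s f" by blast
  \<comment> \<open>The removed pair occupies the indices 1 and -1, so the remaining ones move one
    step towards 0.\<close>
  define c where "c i = b (i + sgn i)" for i
  have n: "int CARD('n) = int ?m + 1" by (simp add: Suc_leI int_ops(6))
  have idx: "i + sgn i \<in> frame_index CARD('n)" if "i \<in> frame_index ?m" for i
    using that unfolding frame_index_def n by (auto simp: sgn_if split: if_splits)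
  have one: "1 \<in> frame_index CARD('n)" "-1 \<in> frame_index CARD('n)"
    unfolding frame_index_def n by auto
  have bb: "hyp_bil (b i) (b j) = (if i = - j then 1 else 0)"
    if "i \<in> frame_index CARD('n)" "j \<in> frame_index CARD('n)" for i j
    using b(1) that unfolding hyp_frame_def by blast
  have frame: "hyp_frame ?m c"
    unfolding hyp_frame_def
  proof (intro ballI conjI)
    fix i assume i: "i \<in> frame_index ?m"
    show "hyp_form (c i) = 0" using b(1) idx[OF i] unfolding hyp_frame_def c_def by blast
    fix j assume j: "j \<in> frame_index ?m"
    have "i + sgn i = - (j + sgn j) \<longleftrightarrow> i = - j"
      using i j by (auto simp: frame_index_def sgn_if split: if_splits)
    then show "hyp_bil (c i) (c j) = (if i = - j then 1 else 0)"
      using bb[OF idx[OF i] idx[OF j]] unfolding c_def by simp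
  qed
  have fb: "f = t *s b (-1)" using ef(2) by (simp add: b vector_smult_assoc)
  have perp: "hyp_bil (c i) e = 0 \<and> hyp_bil (c i) f = 0" if i: "i \<in> frame_index ?m" for i
  proof -
    have "i + sgn i \<noteq> 1" "i + sgn i \<noteq> -1"
      using i by (auto simp: frame_index_def sgn_if split: if_splits)
    then have "hyp_bil (c i) (b 1) = 0" "hyp_bil (c i) (b (-1)) = 0"
      using bb[OF idx[OF i] one(1)] bb[OF idx[OF i] one(2)] unfolding c_def by auto
    then show ?thesis unfolding fb hyp_bil_scale_right using b by simp
  qed
  have expand: "v = (hyp_bil v f / t) *s e + (hyp_bil v e / t) *s f
      + (\<Sum>i\<in>frame_index ?m. hyp_bil v (c (- i)) *s c i)" for v
  proof -
    define S where "S = (\<Sum>i\<in>frame_index ?m. hyp_bil v (c (- i)) *s c i)"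
    define z where "z = v - (hyp_bil v f / t) *s e - (hyp_bil v e / t) *s f - S"
    have S: "hyp_bil S e = 0" "hyp_bil S f = 0"
      using perp unfolding S_def hyp_bil_sum_left by (simp_all add: hyp_bil_simps)
    have self: "hyp_bil e e = 0" "hyp_bil f f = 0" "hyp_bil f e = t"
      using sing_hyp_bil_self e f ef by (auto simp: hyp_bil_commute)
    have ze: "hyp_bil z e = 0" "hyp_bil z f = 0"
      using ef by (simp_all add: z_def hyp_bil_simps S self)
    have zc: "hyp_bil z (c j) = 0" if j: "j \<in> frame_index ?m" for j
    proof -
      have "hyp_bil (v - S) (c j) = 0" unfolding S_def by (rule hyp_frame_project[OF frame j])
      then show ?thesis
        using perp[OF j] by (simp add: z_def hyp_bil_simps hyp_bil_commute[of _ "c j"])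
    qed
    have "hyp_bil z (b i) = 0" if i: "i \<in> frame_index CARD('n)" for i
    proof -
      consider "i = 1" | "i = -1" | j where "j \<in> frame_index ?m" "i = j + sgn j"
      proof -
        have "i \<noteq> 1 \<Longrightarrow> i \<noteq> -1 \<Longrightarrow> i - sgn i \<in> frame_index ?m \<and> i = (i - sgn i) + sgn (i - sgn i)"
          using i unfolding frame_index_def n by (auto simp: sgn_if split: if_splits)
        then show ?thesis using that by blast
      qed
      then show ?thesis
        by cases (use ze zc in \<open>auto simp: b hyp_bil_simps c_def\<close>)
    qed
    then have "z = 0"
      by (subst hyp_frame_expand[OF b(1)]) (simp add: uminus_frame_index)
    then show ?thesis by (simp add: z_def S_def algebra_simps)
  qed
  show ?thesis using frame perp expand by blast
qed

lemma hyp_frame_mono: "hyp_frame m c \<Longrightarrow> k \<le> m \<Longrightarrow> hyp_frame k c"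
  unfolding hyp_frame_def frame_index_def by auto

text \<open>Different pairs are orthogonal, so no mixed terms arise and each pair contributes one
  product.\<close>

lemma hyp_form_frame_sum:
  assumes "hyp_frame m c"
  shows "hyp_form (\<Sum>i\<in>frame_index m. y i *s c i) = (\<Sum>i=1..int m. y (- i) * y i)"
  using assms
proof (induction m)
  case 0
  then show ?case by (simp add: frame_index_def hyp_form_zero)
next
  case (Suc m)
  let ?S = "\<Sum>i\<in>frame_index m. y i *s c i" and ?k = "int (Suc m)"
  have fr: "frame_index (Suc m) = insert ?k (insert (- ?k) (frame_index m))"
    by (rule set_eqI) (auto simp: frame_index_Suc)
  have notin: "?k \<notin> frame_index m" "- ?k \<notin> frame_index m" "?k \<noteq> - ?k"
    by (auto simp: frame_index_def)
  have mem: "?k \<in> frame_index (Suc m)" "- ?k \<in> frame_index (Suc m)"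
    by (auto simp: frame_index_def)
  have bil: "hyp_bil (c i) (c j) = (if i = - j then 1 else 0)"
    if "i \<in> frame_index (Suc m)" "j \<in> frame_index (Suc m)" for i j
    using Suc.prems that unfolding hyp_frame_def by blast
  have Q: "hyp_form (c ?k) = 0" "hyp_form (c (- ?k)) = 0"
    using Suc.prems mem unfolding hyp_frame_def by blast+
  have "hyp_bil (c j) ?S = 0" if j: "j = ?k \<or> j = - ?k" for j
  proof -
    have "hyp_bil (c j) (c i) = 0" if i: "i \<in> frame_index m" for i
    proof -
      have "j \<noteq> - i" using i j by (auto simp: frame_index_def)
      then show ?thesis using bil[of j i] i j mem by (auto simp: fr)
    qed
    then show ?thesis unfolding hyp_bil_sum_right by (simp add: hyp_bil_simps)
  qed
  then have S: "hyp_bil (c ?k) ?S = 0" "hyp_bil (c (- ?k)) ?S = 0" by blast+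
  have kk: "hyp_bil (c ?k) (c (- ?k)) = 1" using bil[OF mem] by simp
  have "(\<Sum>i\<in>frame_index (Suc m). y i *s c i) = y ?k *s c ?k + (y (- ?k) *s c (- ?k) + ?S)"
    unfolding fr using notin by simp
  then have "hyp_form (\<Sum>i\<in>frame_index (Suc m). y i *s c i) = hyp_form ?S + y (- ?k) * y ?k"
    by (simp only: hyp_form_simps hyp_bil_simps Q S kk) (simp add: algebra_simps)
  moreover have "{1..?k} = insert ?k {1..int m}" by auto
  ultimately show ?case using Suc.IH hyp_frame_mono[OF Suc.prems, of m] by simp
qed

lemma polar_subspace_perp:
  fixes p :: "'k::field ^ ('n::finite + 'n)"
  shows "polar_subspace {vec.span {v} |v. sing v \<and> hyp_bil v p = 0}" (is "polar_subspace ?S")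
  unfolding polar_subspace_def
proof (intro conjI ballI impI)
  show "?S \<subseteq> polar_points" unfolding polar_points_eq by auto
  fix L :: "('k ^ ('n + 'n)) set set"
  assume "L \<in> polar_lines" and L: "\<exists>P\<in>L \<inter> ?S. \<exists>Q\<in>L \<inter> ?S. P \<noteq> Q"
  then obtain U where U: "tot_sing U" "vec.dim U = 2" "L = proj_points U"
    unfolding polar_lines_eq by auto
  have subU: "vec.subspace U" using U tot_sing_def by blast
  from L obtain v w where v: "sing v" "hyp_bil v p = 0" "vec.span {v} \<in> L"
    and w: "sing w" "hyp_bil w p = 0" "vec.span {w} \<in> L" and vw: "vec.span {v} \<noteq> vec.span {w}"
    by auto
  have "v \<in> U" "w \<in> U"
    using v w U span_mem_proj_points[OF _ subU] unfolding sing_def by auto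
  then have Uspan: "U = vec.span {v, w}"
    using dim_2_eq_span[OF subU U(2)] v w vw span_sing_eq_iff[OF v(1) w(1)] unfolding sing_def by auto
  show "L \<subseteq> ?S"
  proof
    fix P assume "P \<in> L"
    then obtain x where x: "x \<noteq> 0" "x \<in> U" "P = vec.span {x}"
      using U(3) proj_points_eq[OF subU] by auto
    have "sing x" using x U(1) by (auto simp: sing_def tot_sing_def)
    moreover obtain a b where "x = a *s v + b *s w" using x(2) mem_span_pair[of x v w] unfolding Uspan by auto
    then have "hyp_bil x p = 0" using v w by (simp add: hyp_bil_simps)
    ultimately show "P \<in> ?S" using x by auto
  qed
qed

text \<open>With \<open>p = e + f\<close> for singular \<open>e\<close> and \<open>f\<close>, the
  perp of \<open>p\<close> is spanned by \<open>e - f\<close> and a frame of the perp of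
  \<open>e\<close> and \<open>f\<close>. The vector \<open>e - f\<close> has form value
  \<open>- t\<close> and provides the square; the hyperbolic pairs provide the products.\<close>

lemma polar_subspace_B_perp:
  fixes p :: "'k::field ^ ('n::finite + 'n)"
  assumes p: "hyp_form p \<noteq> 0"
  shows "polar_subspace_B {vec.span {v} |v. sing v \<and> hyp_bil v p = 0}"
proof -
  obtain e f where e: "sing e" and f: "sing f" and pef: "p = e + f"
    using nonsingular_eq_add_sing[OF p] by blast
  define t where "t = hyp_bil e f"
  have t: "t \<noteq> 0" using p e f unfolding pef t_def by (simp add: hyp_form_simps sing_def)
  let ?m = "CARD('n) - 1"
  obtain c where c: "hyp_frame ?m c"
    and perp: "\<And>i. i \<in> frame_index ?m \<Longrightarrow> hyp_bil (c i) e = 0 \<and> hyp_bil (c i) f = 0"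
    and expand: "\<And>v. v = (hyp_bil v f / t) *s e + (hyp_bil v e / t) *s f
      + (\<Sum>i\<in>frame_index ?m. hyp_bil v (c (- i)) *s c i)"
    using hyperbolic_pair_perp_frame[OF e f t_def[symmetric] t] by blast
  \<comment> \<open>Scaling the vectors of negative index by \<open>t\<close> gives every product
    the factor \<open>t\<close>, so the form becomes \<open>t\<close> times the difference of the
    two sides of the standard equation.\<close>
  define s where "s i = (if i > 0 then 1 else t)" for i :: int
  define E where "E i = (if i = 0 then e - f else s i *s c i)" for i
  let ?I = "{- int ?m..int ?m}"
  have I: "?I = insert 0 (frame_index ?m)" by (auto simp: frame_index_def)
  have zero: "0 \<notin> frame_index ?m" by (simp add: frame_index_def)
  have s: "s i \<noteq> 0" for i using t by (simp add: s_def)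
  have self: "hyp_bil e e = 0" "hyp_bil f f = 0" "hyp_bil f e = t" "hyp_bil e f = t"
    "hyp_form e = 0" "hyp_form f = 0"
    using sing_hyp_bil_self e f by (auto simp: hyp_bil_commute t_def sing_def)
  \<comment> \<open>The dual partner of \<open>e - f\<close> is \<open>e\<close>, since
    \<open>e - f\<close> pairs with itself to \<open>- 2 * t\<close>, which vanishes in
    characteristic 2.\<close>
  define d where "d i = (if i = 0 then e else c (- i))" for i
  have perp': "hyp_bil e (c i) = 0" "hyp_bil f (c i) = 0" if "i \<in> frame_index ?m" for i
    using perp[OF that] by (simp_all add: hyp_bil_commute)
  have dual: "hyp_bil (d i) (E j) = (if i = j then (if i = 0 then - t else s i) else 0)"
    if i: "i \<in> ?I" and j: "j \<in> ?I" for i j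
  proof -
    have bil: "hyp_bil (c i) (c j) = (if i = - j then 1 else 0)"
      if "i \<in> frame_index ?m" "j \<in> frame_index ?m" for i j
      using c that unfolding hyp_frame_def by blast
    consider "i = 0" "j = 0" | "i = 0" "j \<in> frame_index ?m" | "- i \<in> frame_index ?m" "j = 0"
      | "- i \<in> frame_index ?m" "j \<in> frame_index ?m"
      using i j unfolding I using uminus_frame_index by blast
    then show ?thesis
    proof cases
      case 1
      then show ?thesis by (simp add: d_def E_def hyp_bil_simps self)
    next
      case 2
      then show ?thesis
        using zero perp'[of j] by (auto simp: d_def E_def hyp_bil_simps)
    next
      case 3
      then show ?thesis using zero perp[of "- i"] by (auto simp: d_def E_def hyp_bil_simps)
    next
      case 4
      then have "i \<noteq> 0" "j \<noteq> 0" using zero by auto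
      then show ?thesis using bil[OF 4] by (auto simp: d_def E_def hyp_bil_simps)
    qed
  qed
  have indep: "inj_on E ?I" "vec.independent (E ` ?I)"
    by (rule independent_dual_family[OF _ dual]; simp add: s t)+
  have sum: "(\<Sum>i\<in>?I. x i *s E i) = x 0 *s (e - f) + (\<Sum>i\<in>frame_index ?m. (x i * s i) *s c i)" for x
  proof -
    have "(\<Sum>i\<in>frame_index ?m. x i *s E i) = (\<Sum>i\<in>frame_index ?m. (x i * s i) *s c i)"
      using zero by (intro sum.cong) (auto simp: E_def vector_smult_assoc)
    then show ?thesis unfolding I using zero by (simp add: E_def)
  qed
  have form: "hyp_form (\<Sum>i\<in>?I. x i *s E i) = t * ((\<Sum>i=1..int ?m. x (- i) * x i) - (x 0)\<^sup>2)" for x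
  proof -
    let ?T = "\<Sum>i\<in>frame_index ?m. (x i * s i) *s c i"
    have "hyp_bil (e - f) ?T = 0"
      unfolding hyp_bil_sum_right using perp' by (intro sum.neutral) (auto simp: hyp_bil_simps)
    moreover have "hyp_form (e - f) = - t" by (simp add: hyp_form_simps self)
    moreover have "hyp_form ?T = (\<Sum>i=1..int ?m. (x (- i) * s (- i)) * (x i * s i))"
      by (rule hyp_form_frame_sum[OF c])
    moreover have "\<dots> = t * (\<Sum>i=1..int ?m. x (- i) * x i)"
      unfolding sum_distrib_left by (intro sum.cong) (auto simp: s_def)
    ultimately show ?thesis
      unfolding sum hyp_form_add hyp_form_scale hyp_bil_scale_left
      by (simp add: algebra_simps power2_eq_square)
  qed
  have perp_p: "hyp_bil (\<Sum>i\<in>?I. x i *s E i) p = 0" for x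
    unfolding sum pef hyp_bil_add_left hyp_bil_sum_left using perp
    by (simp add: hyp_bil_simps self)
  have nz: "(\<Sum>i\<in>?I. x i *s E i) \<noteq> 0" if x: "\<exists>i\<in>?I. x i \<noteq> 0" for x
  proof
    assume 0: "(\<Sum>i\<in>?I. x i *s E i) = 0"
    from x obtain i where i: "i \<in> ?I" "x i \<noteq> 0" by blast
    have "0 = hyp_bil (d i) (\<Sum>j\<in>?I. x j *s E j)" by (simp only: 0 hyp_bil_zero_right)
    also have "\<dots> = (\<Sum>j\<in>?I. if i = j then x j * (if i = 0 then - t else s i) else 0)"
      unfolding hyp_bil_sum_right hyp_bil_scale_right by (rule sum.cong[OF refl]) (use dual[OF i(1)] in simp)
    also have "\<dots> = x i * (if i = 0 then - t else s i)" using i(1) by simp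
    finally show False using i(2) s t by (auto split: if_splits)
  qed
  have coord: "\<exists>x. v = (\<Sum>i\<in>?I. x i *s E i)" if v: "hyp_bil v p = 0" for v
  proof -
    \<comment> \<open>Orthogonality to \<open>p\<close> makes the coefficients of \<open>e\<close>
      and \<open>f\<close> opposite, so these two terms combine to a multiple of
      \<open>e - f\<close>.\<close>
    have fe: "hyp_bil v e = - hyp_bil v f" using v unfolding pef by (simp add: hyp_bil_simps eq_neg_iff_add_eq_0)
    define x where "x i = (if i = 0 then hyp_bil v f / t else hyp_bil v (c (- i)) / s i)" for i
    have "(\<Sum>i\<in>frame_index ?m. (x i * s i) *s c i) = (\<Sum>i\<in>frame_index ?m. hyp_bil v (c (- i)) *s c i)"
      using zero s by (intro sum.cong) (auto simp: x_def)
    then have "(\<Sum>i\<in>?I. x i *s E i)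
        = (hyp_bil v f / t) *s (e - f) + (\<Sum>i\<in>frame_index ?m. hyp_bil v (c (- i)) *s c i)"
      unfolding sum by (simp add: x_def)
    also have "\<dots> = (hyp_bil v f / t) *s e + (hyp_bil v e / t) *s f
      + (\<Sum>i\<in>frame_index ?m. hyp_bil v (c (- i)) *s c i)"
      unfolding fe by (simp add: vec.scale_right_diff_distrib)
    also have "\<dots> = v" by (rule expand[symmetric])
    finally show ?thesis by metis
  qed
  have "{vec.span {v} |v. sing v \<and> hyp_bil v p = 0} =
    {vec.span {\<Sum>i\<in>?I. x i *s E i} |x.
      (\<exists>i\<in>?I. x i \<noteq> 0) \<and> (\<Sum>i=1..int ?m. x (- i) * x i) = (x 0)\<^sup>2}" (is "?S = ?T")
  proof (intro equalityI subsetI)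
    fix P assume "P \<in> ?S"
    then obtain v where v: "sing v" "hyp_bil v p = 0" "P = vec.span {v}" by auto
    obtain x where x: "v = (\<Sum>i\<in>?I. x i *s E i)" using coord[OF v(2)] by auto
    have "v \<noteq> 0" "hyp_form v = 0" using v(1) by (auto simp: sing_def)
    then have "(\<Sum>i=1..int ?m. x (- i) * x i) = (x 0)\<^sup>2" using form[of x] t x by simp
    moreover have "\<exists>i\<in>?I. x i \<noteq> 0"
    proof (rule ccontr)
      assume "\<not> ?thesis"
      then have "v = 0" unfolding x by (intro sum.neutral) simp
      then show False using \<open>v \<noteq> 0\<close> by simp
    qed
    ultimately show "P \<in> ?T" using v(3) x by auto
  next
    fix P assume "P \<in> ?T"
    then obtain x where x: "\<exists>i\<in>?I. x i \<noteq> 0" "(\<Sum>i=1..int ?m. x (- i) * x i) = (x 0)\<^sup>2"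
      "P = vec.span {\<Sum>i\<in>?I. x i *s E i}" by auto
    have "sing (\<Sum>i\<in>?I. x i *s E i)" using nz[OF x(1)] form[of x] x(2) by (simp add: sing_def)
    then show "P \<in> ?S" using perp_p x(3) by auto
  qed
  then show ?thesis
    unfolding polar_subspace_B_def Let_def by (intro conjI exI[of _ E] polar_subspace_perp indep)
qed

section \<open>The two families of maximal singular subspaces\<close>

definition max_sing :: "('k::field ^ ('n::finite + 'n)) set \<Rightarrow> bool" where
  "max_sing M \<longleftrightarrow> tot_sing M \<and> vec.dim M = CARD('n)"

lemma max_sing_subspace: "max_sing M \<Longrightarrow> vec.subspace M"
  by (simp add: max_sing_def tot_sing_def)

lemma max_sing_perp_subset: "max_sing M \<Longrightarrow> hyp_perp M \<subseteq> M"
  using tot_sing_perp_subset unfolding max_sing_def by blast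

text \<open>Every totally singular subspace extends to one of dimension \<open>n\<close>, the
  largest possible, so maximality under inclusion is maximality of the dimension.\<close>

lemma maximal_singular_eq:
  "maximal_singular = {proj_points M |M. max_sing (M :: ('k::field ^ ('n::finite + 'n)) set)}"
proof (intro equalityI subsetI)
  fix X :: "('k ^ ('n + 'n)) set set" assume X: "X \<in> maximal_singular"
  then obtain U where U: "tot_sing U" "X = proj_points U"
    unfolding maximal_singular_def singular_subspaces_eq by auto
  obtain M where M: "tot_sing M" "U \<subseteq> M" "vec.dim M = CARD('n)"
    using tot_sing_extend[OF U(1)] by blast
  have "proj_points M \<in> singular_subspaces" using M(1) unfolding singular_subspaces_eq by auto
  moreover have "X \<subseteq> proj_points M" using M(2) unfolding U(2) proj_points_def by auto
  ultimately have "X = proj_points M" using X unfolding maximal_singular_def by auto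
  then show "X \<in> {proj_points M |M. max_sing M}" using M by (auto simp: max_sing_def)
next
  fix X :: "('k ^ ('n + 'n)) set set" assume "X \<in> {proj_points M |M. max_sing M}"
  then obtain M where M: "max_sing M" "X = proj_points M" by auto
  note subM = max_sing_subspace[OF M(1)]
  have "X \<in> singular_subspaces" using M unfolding singular_subspaces_eq max_sing_def by auto
  moreover have "Y = X" if Y: "Y \<in> singular_subspaces" "X \<subseteq> Y" for Y
  proof -
    obtain U where U: "tot_sing U" "Y = proj_points U" using Y(1) unfolding singular_subspaces_eq by auto
    have subU: "vec.subspace U" using U by (simp add: tot_sing_def)
    have "M \<subseteq> U" using Y(2) unfolding M(2) U(2) proj_points_subset[OF subM subU] .
    moreover have "vec.dim U \<le> vec.dim M"
      using tot_sing_dim_le[OF U(1)] M(1) by (simp add: max_sing_def)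
    ultimately have "M = U" using vec.subspace_dim_equal[OF subM subU] by blast
    then show ?thesis using U M by simp
  qed
  ultimately show "X \<in> maximal_singular" unfolding maximal_singular_def by auto
qed

section \<open>Parity of the dimensions of intersections\<close>

lemma hyperplane_span_insert:
  fixes X Z :: "('k::field ^ 'm::finite) set"
  assumes "vec.subspace X" "vec.subspace Z" "Z \<subseteq> X" "vec.dim X = Suc (vec.dim Z)" "x \<in> X" "x \<notin> Z"
  shows "X = vec.span (insert x Z)"
proof -
  have "vec.dim (vec.span (insert x Z)) = Suc (vec.dim Z)"
    using assms(2,6) by (simp add: vec.dim_insert vec.span_eq_iff[THEN iffD2])
  moreover have "vec.span (insert x Z) \<subseteq> X"
    using assms by (simp add: subspace_span_le)
  ultimately show ?thesis
    using vec.subspace_dim_equal[of "vec.span (insert x Z)" X] assms by simp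
qed

text \<open>\<open>X\<close> is spanned by \<open>m\<close> and \<open>X \<inter> Y\<close>. A
  vector of \<open>M \<inter> Y\<close> is orthogonal to both, so it lies in \<open>X\<close>; thus
  \<open>M \<inter> Y\<close> is contained in \<open>M \<inter> X\<close>, and \<open>m\<close>
  alone is missing from it.\<close>

lemma adjacent_dim_Suc:
  fixes M X Y :: "('k::field ^ ('n::finite + 'n)) set"
  assumes M: "max_sing M" and X: "max_sing X" and Y: "max_sing Y"
    and adj: "Suc (vec.dim (X \<inter> Y)) = CARD('n)" and m: "m \<in> M" "m \<in> X" "m \<notin> Y"
  shows "vec.dim (M \<inter> X) = Suc (vec.dim (M \<inter> Y))"
proof -
  let ?Z = "X \<inter> Y"
  have sub: "vec.subspace M" "vec.subspace X" "vec.subspace Y" "vec.subspace ?Z"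
    using M X Y max_sing_subspace vec.subspace_inter by blast+
  have Xs: "X = vec.span (insert m ?Z)"
    using X adj m by (intro hyperplane_span_insert sub) (auto simp: max_sing_def)
  have "y \<in> X" if y: "y \<in> M" "y \<in> Y" for y
  proof -
    have "hyp_bil y x = 0" if "x \<in> insert m ?Z" for x
      using that y m M Y tot_sing_hyp_bil unfolding max_sing_def by blast
    then have "y \<in> hyp_perp (insert m ?Z)" by (simp add: hyp_perp_def)
    moreover have "hyp_perp X = hyp_perp (insert m ?Z)" by (subst Xs) (rule hyp_perp_span)
    ultimately have "y \<in> hyp_perp X" by simp
    then show ?thesis using max_sing_perp_subset[OF X] by blast
  qed
  then have MY: "M \<inter> Y = M \<inter> ?Z" by blast
  have "x \<in> vec.span (insert m (M \<inter> ?Z))" if x: "x \<in> M" "x \<in> X" for x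
  proof -
    obtain k where "x - k *s m \<in> vec.span ?Z"
      using x(2) vec.span_breakdown_eq[of x m ?Z] unfolding Xs[symmetric] by blast
    then have "x - k *s m \<in> ?Z" using sub(4) vec.span_eq_iff by metis
    moreover have "x - k *s m \<in> M" using x m sub by (intro vec.subspace_diff vec.subspace_scale)
    ultimately have "x - k *s m \<in> vec.span (M \<inter> ?Z)" by (simp add: vec.span_base)
    then show ?thesis using vec.span_breakdown_eq[of x m "M \<inter> ?Z"] by blast
  qed
  then have "M \<inter> X \<subseteq> vec.span (insert m (M \<inter> ?Z))" by blast
  moreover have "vec.span (insert m (M \<inter> ?Z)) \<subseteq> M \<inter> X"
    using m sub vec.subspace_inter[of M X] by (auto simp: subspace_span_le)
  ultimately have "M \<inter> X = vec.span (insert m (M \<inter> ?Z))" by blast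
  moreover have "vec.dim (vec.span (insert m (M \<inter> ?Z))) = Suc (vec.dim (M \<inter> ?Z))"
    using m sub vec.subspace_inter[of M ?Z]
    by (simp add: vec.dim_insert vec.span_eq_iff[THEN iffD2])
  ultimately show ?thesis using MY by simp
qed

text \<open>The plane \<open>(X \<inter> Y)\<^sup>\<bottom> / (X \<inter> Y)\<close> is hyperbolic, so \<open>X\<close> and \<open>Y\<close> are the only
  maximal singular subspaces through \<open>X \<inter> Y\<close>.\<close>

lemma perp_adjacent_inter:
  fixes X Y :: "('k::field ^ ('n::finite + 'n)) set"
  assumes X: "max_sing X" and Y: "max_sing Y" and adj: "Suc (vec.dim (X \<inter> Y)) = CARD('n)"
    and m: "hyp_form m = 0" "m \<in> hyp_perp (X \<inter> Y)"
  shows "m \<in> X \<or> m \<in> Y"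
proof -
  let ?Z = "X \<inter> Y"
  have sub: "vec.subspace X" "vec.subspace Y" "vec.subspace ?Z"
    using X Y max_sing_subspace vec.subspace_inter by blast+
  have dim: "vec.dim X = Suc (vec.dim ?Z)" "vec.dim Y = Suc (vec.dim ?Z)"
    using X Y adj by (simp_all add: max_sing_def)
  have "\<not> X \<subseteq> ?Z" "\<not> Y \<subseteq> ?Z"
    using vec.dim_subset[of X ?Z] vec.dim_subset[of Y ?Z] dim by linarith+
  then obtain x y where x: "x \<in> X" "x \<notin> ?Z" and y: "y \<in> Y" "y \<notin> ?Z" by blast
  have Xs: "X = vec.span (insert x ?Z)"
    by (rule hyperplane_span_insert[OF sub(1,3) _ dim(1) x]) simp
  have Ys: "Y = vec.span (insert y ?Z)"
    by (rule hyperplane_span_insert[OF sub(2,3) _ dim(2) y]) simp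
  have tX: "hyp_bil u v = 0" if "u \<in> X" "v \<in> X" for u v
    using tot_sing_hyp_bil X that unfolding max_sing_def by blast
  have tY: "hyp_bil u v = 0" if "u \<in> Y" "v \<in> Y" for u v
    using tot_sing_hyp_bil Y that unfolding max_sing_def by blast
  have inX: "u \<in> X" if "\<forall>z\<in>insert x ?Z. hyp_bil u z = 0" for u
  proof -
    have "u \<in> hyp_perp (vec.span (insert x ?Z))" unfolding hyp_perp_span using that by (simp add: hyp_perp_def)
    then show ?thesis unfolding Xs[symmetric] using max_sing_perp_subset[OF X] by blast
  qed
  have inY: "u \<in> Y" if "\<forall>z\<in>insert y ?Z. hyp_bil u z = 0" for u
  proof -
    have "u \<in> hyp_perp (vec.span (insert y ?Z))" unfolding hyp_perp_span using that by (simp add: hyp_perp_def)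
    then show ?thesis unfolding Ys[symmetric] using max_sing_perp_subset[OF Y] by blast
  qed
  define t where "t = hyp_bil x y"
  have t: "t \<noteq> 0"
  proof
    assume "t = 0"
    then have "\<forall>z\<in>insert x ?Z. hyp_bil y z = 0" using tY y by (auto simp: t_def hyp_bil_commute)
    then show False using inX y by blast
  qed
  define a where "a = hyp_bil m y / t"
  define b where "b = hyp_bil m x / t"
  \<comment> \<open>Orthogonal to \<open>x\<close>, \<open>y\<close> and
    \<open>X \<inter> Y\<close>, this part of \<open>m\<close> lies in both \<open>X\<close> and
    \<open>Y\<close>. Hence \<open>hyp_form m = a * b * t\<close>, and \<open>a\<close> or
    \<open>b\<close> vanishes.\<close>
  define m' where "m' = m - a *s x - b *s y"
  have xy: "hyp_bil x x = 0" "hyp_bil y y = 0" "hyp_bil y x = t" "hyp_bil x y = t"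
    using tX tY x y by (auto simp: t_def hyp_bil_commute)
  have m'Z: "hyp_bil m' z = 0" if "z \<in> ?Z" for z
    using that m(2) tX[OF x(1)] tY[OF y(1)] by (simp add: m'_def hyp_bil_simps hyp_perp_def)
  have m'xy: "hyp_bil m' x = 0" "hyp_bil m' y = 0"
    using t by (simp_all add: m'_def hyp_bil_simps xy a_def b_def)
  have m': "m' \<in> X" "m' \<in> Y"
    using inX[of m'] inY[of m'] m'Z m'xy by auto
  have Q: "hyp_form m' = 0" "hyp_form x = 0" "hyp_form y = 0"
    using m' x y X Y by (auto simp: max_sing_def tot_sing_def)
  have mm: "m = m' + (a *s x + b *s y)" by (simp add: m'_def)
  have "hyp_form m = a * b * t"
    unfolding mm by (simp add: hyp_form_simps hyp_bil_simps Q xy m'xy)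
  then have "a = 0 \<or> b = 0" using m(1) t by auto
  then show ?thesis
  proof
    assume "a = 0"
    then have "m = m' + b *s y" using mm by simp
    then show ?thesis using m' y sub by (auto intro: vec.subspace_add vec.subspace_scale)
  next
    assume "b = 0"
    then have "m = m' + a *s x" using mm by simp
    then show ?thesis using m' x sub by (auto intro: vec.subspace_add vec.subspace_scale)
  qed
qed

text \<open>By the dimension count \<open>M\<close> contains a vector orthogonal to
  \<open>X \<inter> Y\<close> and outside it. Such a vector lies in exactly one of \<open>X\<close>
  and \<open>Y\<close>, and that one meets \<open>M\<close> in one dimension more.\<close>

lemma adjacent_parity:
  fixes M X Y :: "('k::field ^ ('n::finite + 'n)) set"
  assumes M: "max_sing M" and X: "max_sing X" and Y: "max_sing Y"
    and adj: "Suc (vec.dim (X \<inter> Y)) = CARD('n)"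
  shows "odd (vec.dim (M \<inter> X) + vec.dim (M \<inter> Y))"
proof -
  have sub: "vec.subspace (X \<inter> Y)" using X Y max_sing_subspace vec.subspace_inter by blast
  have "\<exists>m\<in>M. m \<in> hyp_perp (X \<inter> Y) \<and> m \<notin> X \<inter> Y"
    by (rule ex_perp_not_mem) (use M sub adj in \<open>auto simp: max_sing_def\<close>)
  then obtain m where m: "m \<in> M" "m \<in> hyp_perp (X \<inter> Y)" "m \<notin> X \<inter> Y" by blast
  have "hyp_form m = 0" using m M by (simp add: max_sing_def tot_sing_def)
  then consider "m \<in> X" "m \<notin> Y" | "m \<in> Y" "m \<notin> X"
    using perp_adjacent_inter[OF X Y adj] m by blast
  then show ?thesis
  proof cases
    case 1
    then show ?thesis using adjacent_dim_Suc[OF M X Y adj m(1)] by simp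
  next
    case 2
    then show ?thesis
      using adjacent_dim_Suc[OF M Y X _ m(1)] adj by (simp add: Int_commute)
  qed
qed

text \<open>For \<open>x\<close> in \<open>X\<close> outside \<open>Y\<close>, the subspace spanned
  by \<open>x\<close> and the part of \<open>Y\<close> orthogonal to \<open>x\<close> meets
  \<open>Y\<close> in a hyperplane and contains \<open>X \<inter> Y\<close> together with
  \<open>x\<close>.\<close>

lemma ex_adjacent_towards:
  fixes X Y :: "('k::field ^ ('n::finite + 'n)) set"
  assumes X: "max_sing X" and Y: "max_sing Y" and neq: "X \<noteq> Y"
  shows "\<exists>Y'. max_sing Y' \<and> Suc (vec.dim (Y \<inter> Y')) = CARD('n) \<and> vec.dim (X \<inter> Y) < vec.dim (X \<inter> Y')"
proof -
  have sub: "vec.subspace X" "vec.subspace Y" using X Y max_sing_subspace by blast+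
  have dimXY: "vec.dim X = CARD('n)" "vec.dim Y = CARD('n)" using X Y by (auto simp: max_sing_def)
  have "\<not> X \<subseteq> Y"
    using vec.subspace_dim_equal[OF sub] dimXY neq by auto
  then obtain x where x: "x \<in> X" "x \<notin> Y" by blast
  define Z where "Z = Y \<inter> hyp_perp {x}"
  define Y' where "Y' = vec.span (insert x Z)"
  have subZ: "vec.subspace Z" unfolding Z_def using sub subspace_hyp_perp vec.subspace_inter by blast
  have tsZ: "tot_sing Z" using Y subZ by (auto simp: Z_def max_sing_def tot_sing_def)
  have "hyp_form x = 0" using x X by (simp add: max_sing_def tot_sing_def)
  moreover have "x \<in> hyp_perp Z" by (auto simp: Z_def hyp_perp_def hyp_bil_commute)
  ultimately have tsY': "tot_sing Y'" unfolding Y'_def using tsZ by (intro tot_sing_span_insert)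
  have "vec.dim Y \<le> vec.dim Z + 1"
    using dim_le_inter_hyp_perp[of "{x}" Y] sub unfolding Z_def by simp
  moreover have dY': "vec.dim Y' = Suc (vec.dim Z)"
    using x subZ unfolding Y'_def
    by (simp add: vec.dim_insert vec.span_eq_iff[THEN iffD2]) (simp add: Z_def)
  moreover have "vec.dim Y' \<le> CARD('n)" using tot_sing_dim_le[OF tsY'] .
  ultimately have dim: "vec.dim Y' = CARD('n)" "Suc (vec.dim Z) = CARD('n)" using dimXY by linarith+
  have mY': "max_sing Y'" using tsY' dim by (simp add: max_sing_def)
  have subY': "vec.subspace Y'" by (simp add: Y'_def)
  have ZY': "Z \<subseteq> Y'" "x \<in> Y'" unfolding Y'_def using vec.span_superset by blast+
  then have "Z \<subseteq> Y \<inter> Y'" by (auto simp: Z_def)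
  then have "vec.dim Z \<le> vec.dim (Y \<inter> Y')" by (rule vec.dim_subset)
  moreover have "vec.dim (Y \<inter> Y') < vec.dim Y'"
  proof (rule ccontr)
    assume "\<not> ?thesis"
    then have "Y \<inter> Y' = Y'"
      using vec.subspace_dim_equal[of "Y \<inter> Y'" Y'] sub subY' vec.subspace_inter by auto
    then show False using ZY' x by blast
  qed
  ultimately have adj: "Suc (vec.dim (Y \<inter> Y')) = CARD('n)" using dim by linarith
  have "X \<inter> Y \<subseteq> Z"
    using x X tot_sing_hyp_bil unfolding Z_def hyp_perp_def max_sing_def by blast
  then have "insert x (X \<inter> Y) \<subseteq> X \<inter> Y'" using ZY' x by blast
  then have "vec.dim (insert x (X \<inter> Y)) \<le> vec.dim (X \<inter> Y')" by (rule vec.dim_subset)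
  moreover have "vec.dim (insert x (X \<inter> Y)) = Suc (vec.dim (X \<inter> Y))"
    using x vec.subspace_inter[OF sub] by (simp add: vec.dim_insert vec.span_eq_iff[THEN iffD2])
  ultimately show ?thesis using mY' adj by auto
qed

text \<open>A step from \<open>Y\<close> to an adjacent \<open>Y'\<close> closer to \<open>X\<close>
  flips the parities of the intersections with \<open>M\<close> and with \<open>X\<close>, so the
  sum keeps its parity. At \<open>Y = X\<close> every term occurs twice.\<close>

lemma parity_triangle:
  fixes M X Y :: "('k::field ^ ('n::finite + 'n)) set"
  assumes M: "max_sing M" and X: "max_sing X" and "max_sing Y"
  shows "even (vec.dim (M \<inter> X) + vec.dim (M \<inter> Y) + vec.dim (X \<inter> Y) + CARD('n))"
  using assms(3)
proof (induction "CARD('n) - vec.dim (X \<inter> Y)" arbitrary: Y rule: less_induct)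
  case less
  show ?case
  proof (cases "X = Y")
    case True
    then show ?thesis using X by (simp add: max_sing_def)
  next
    case False
    then obtain Y' where Y': "max_sing Y'" "Suc (vec.dim (Y \<inter> Y')) = CARD('n)"
      "vec.dim (X \<inter> Y) < vec.dim (X \<inter> Y')"
      using ex_adjacent_towards[OF X less(2)] by blast
    have "vec.dim (X \<inter> Y') \<le> vec.dim X" by (rule vec.dim_subset) simp
    then have "CARD('n) - vec.dim (X \<inter> Y') < CARD('n) - vec.dim (X \<inter> Y)"
      using Y'(3) X by (simp add: max_sing_def)
    then have "even (vec.dim (M \<inter> X) + vec.dim (M \<inter> Y') + vec.dim (X \<inter> Y') + CARD('n))"
      using less(1)[OF _ Y'(1)] by simp
    moreover have "odd (vec.dim (M \<inter> Y) + vec.dim (M \<inter> Y'))"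
      by (rule adjacent_parity[OF M less(2) Y'(1,2)])
    moreover have "odd (vec.dim (X \<inter> Y) + vec.dim (X \<inter> Y'))"
      by (rule adjacent_parity[OF X less(2) Y'(1,2)])
    ultimately show ?thesis by presburger
  qed
qed

lemma same_family_iff:
  fixes M N :: "('k::field ^ ('n::finite + 'n)) set"
  assumes M: "max_sing M" and N: "max_sing N"
  shows "(proj_points M, proj_points N) \<in> same_family \<longleftrightarrow> even (vec.dim (M \<inter> N) + CARD('n))"
proof -
  have mem: "proj_points M \<in> maximal_singular" "proj_points N \<in> maximal_singular"
    using M N unfolding maximal_singular_eq by auto
  have sub: "vec.subspace M" "vec.subspace N" using M N max_sing_subspace by blast+
  have pd: "pdim (proj_points M) - pdim (proj_points M \<inter> proj_points N) = int CARD('n) - int (vec.dim (M \<inter> N))"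
    "pdim (proj_points N) - pdim (proj_points M \<inter> proj_points N) = int CARD('n) - int (vec.dim (M \<inter> N))"
    unfolding proj_points_inter using M N sub vec.subspace_inter[OF sub]
    by (simp_all add: pdim_proj_points max_sing_def)
  have "(proj_points M, proj_points N) \<in> same_family \<longleftrightarrow> even (int CARD('n) - int (vec.dim (M \<inter> N)))"
    unfolding same_family_def mem_Collect_eq prod.case pd using mem by simp
  also have "\<dots> \<longleftrightarrow> even (vec.dim (M \<inter> N) + CARD('n))" by simp presburger
  finally show ?thesis .
qed

text \<open>By the parity rule for three maximal singular subspaces, belonging to a common family
  means equal parities of the intersections with \<open>M0\<close>; this leaves at most two
  classes.\<close>

lemma same_family_class:
  fixes M0 M :: "('k::field ^ ('n::finite + 'n)) set"
  assumes M0: "max_sing M0" and M: "max_sing M"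
  shows "same_family `` {proj_points M} = {proj_points W |W. max_sing W \<and>
    (even (vec.dim (M0 \<inter> W)) \<longleftrightarrow> even (vec.dim (M0 \<inter> M)))}"
proof -
  have iff: "(proj_points M, proj_points W) \<in> same_family \<longleftrightarrow>
      (even (vec.dim (M0 \<inter> W)) \<longleftrightarrow> even (vec.dim (M0 \<inter> M)))" if W: "max_sing W" for W
    unfolding same_family_iff[OF M W] using parity_triangle[OF M0 M W] by presburger
  show ?thesis
  proof (intro equalityI subsetI)
    fix X assume X: "X \<in> same_family `` {proj_points M}"
    then have "X \<in> maximal_singular" by (auto simp: same_family_def)
    then obtain W where W: "max_sing W" "X = proj_points W" unfolding maximal_singular_eq by auto
    then show "X \<in> {proj_points W |W. max_sing W \<and>
        (even (vec.dim (M0 \<inter> W)) \<longleftrightarrow> even (vec.dim (M0 \<inter> M)))}"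
      using X iff[OF W(1)] by auto
  qed (use iff in auto)
qed

lemma linear_hyp_reflection: "Vector_Spaces.linear (*s) (*s) (hyp_reflection p)"
  by (simp add: Vector_Spaces.linear_iff vec.vector_space_axioms hyp_reflection_add hyp_reflection_scale)

section \<open>Reflections and the two families\<close>

context
  fixes p :: "'k::field ^ ('n::finite + 'n)"
  assumes p: "hyp_form p \<noteq> 0"
begin

lemma max_sing_reflection:
  assumes M: "max_sing M"
  shows "max_sing (hyp_reflection p ` M)"
proof -
  have inj: "inj_on (hyp_reflection p) S" for S
    by (rule inj_on_inverseI) (rule hyp_reflection_reflection[OF p])
  have "vec.dim (hyp_reflection p ` M) = vec.dim M"
    by (rule vec.dim_image_eq[OF linear_hyp_reflection inj])
  moreover have "vec.subspace (hyp_reflection p ` M)"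
    using vec.linear_subspace_image[OF linear_hyp_reflection] max_sing_subspace[OF M] by blast
  ultimately show ?thesis
    using M hyp_form_reflection[OF p] by (auto simp: max_sing_def tot_sing_def)
qed

text \<open>The reflection fixes the vectors of \<open>M\<close> orthogonal to \<open>p\<close>,
  which span at least a hyperplane of \<open>M\<close>. If \<open>M\<close> were preserved, it would
  contain the differences \<open>u - R u\<close>, and with them the nonsingular vector
  \<open>p\<close>.\<close>

lemma reflection_adjacent:
  assumes M: "max_sing M"
  shows "Suc (vec.dim (M \<inter> hyp_reflection p ` M)) = CARD('n)"
proof -
  let ?R = "hyp_reflection p"
  have sub: "vec.subspace M" "vec.subspace (?R ` M)"
    using M max_sing_reflection max_sing_subspace by blast+
  have "M \<inter> hyp_perp {p} \<subseteq> M \<inter> ?R ` M"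
  proof
    fix x assume x: "x \<in> M \<inter> hyp_perp {p}"
    then have "?R x = x" by (simp add: hyp_perp_def hyp_reflection_perp)
    then show "x \<in> M \<inter> ?R ` M" using x by (metis IntE IntI imageI)
  qed
  then have "vec.dim (M \<inter> hyp_perp {p}) \<le> vec.dim (M \<inter> ?R ` M)" by (rule vec.dim_subset)
  moreover have "vec.dim M \<le> vec.dim (M \<inter> hyp_perp {p}) + 1"
    using dim_le_inter_hyp_perp[of "{p}" M] sub by simp
  moreover have "vec.dim (M \<inter> ?R ` M) < vec.dim M"
  proof (rule ccontr)
    assume "\<not> ?thesis"
    then have "M \<inter> ?R ` M = M"
      using vec.subspace_dim_equal[of "M \<inter> ?R ` M" M] sub vec.subspace_inter by auto
    moreover have "vec.dim (?R ` M) = vec.dim M"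
      using M max_sing_reflection[OF M] by (simp add: max_sing_def)
    ultimately have eq: "?R ` M = M"
      using vec.subspace_dim_equal[of M "?R ` M"] sub by auto
    have "p \<notin> M" using p M by (auto simp: max_sing_def tot_sing_def)
    then have "p \<notin> hyp_perp M" using max_sing_perp_subset[OF M] by blast
    then obtain u where u: "u \<in> M" "hyp_bil u p \<noteq> 0"
      by (auto simp: hyp_perp_def hyp_bil_commute)
    have "u - ?R u \<in> M" using u eq sub by (intro vec.subspace_diff) auto
    then have "(hyp_bil u p / hyp_form p) *s p \<in> M" by (simp add: hyp_reflection_def)
    then have "(hyp_form p / hyp_bil u p) *s ((hyp_bil u p / hyp_form p) *s p) \<in> M"
      using sub vec.subspace_scale by blast
    then show False using \<open>p \<notin> M\<close> u p by (simp add: vector_smult_assoc)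
  qed
  ultimately show ?thesis using M by (simp add: max_sing_def)
qed

text \<open>Families are labelled by the parity of the intersection with \<open>M0\<close>; a
  maximal singular subspace and its mirror image are adjacent and get different labels.\<close>

lemma type_rotating_reflection:
  assumes \<theta>: "\<And>v. sing v \<Longrightarrow> \<theta> (vec.span {v}) = vec.span {hyp_reflection p v}"
  shows "type_rotating \<theta>"
proof -
  let ?R = "hyp_reflection p"
  obtain M0 :: "('k ^ ('n + 'n)) set" where M0: "max_sing M0"
    using ex_tot_sing_max unfolding max_sing_def by blast
  define F where "F b = {proj_points W |W. max_sing W \<and>
    (even (vec.dim (M0 \<inter> W)) \<longleftrightarrow> b)}" for b
  have cls: "same_family `` {proj_points M} = F (even (vec.dim (M0 \<inter> M)))" if "max_sing M" for M
    unfolding F_def by (rule same_family_class[OF M0 that])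
  have flip: "even (vec.dim (M0 \<inter> ?R ` M)) \<longleftrightarrow> odd (vec.dim (M0 \<inter> M))" if M: "max_sing M" for M
    using adjacent_parity[OF M0 M max_sing_reflection[OF M] reflection_adjacent[OF M]] by auto
  have img: "\<theta> ` proj_points M = proj_points (?R ` M)" if M: "max_sing M" for M
  proof -
    note RM = max_sing_reflection[OF M]
    have "\<theta> ` proj_points M = (\<lambda>v. \<theta> (vec.span {v})) ` {v \<in> M. v \<noteq> 0}"
      unfolding proj_points_eq[OF max_sing_subspace[OF M]] by auto
    also have "\<dots> = (\<lambda>v. vec.span {?R v}) ` {v \<in> M. v \<noteq> 0}"
      using M \<theta> by (intro image_cong) (auto simp: sing_def max_sing_def tot_sing_def)
    also have "\<dots> = (\<lambda>v. vec.span {v}) ` (?R ` {v \<in> M. v \<noteq> 0})" by (simp add: image_image)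
    also have "?R ` {v \<in> M. v \<noteq> 0} = {v \<in> ?R ` M. v \<noteq> 0}"
    proof -
      have "?R v = 0 \<longleftrightarrow> v = 0" for v
        using hyp_reflection_reflection[OF p, of v] by (metis hyp_reflection_scale vector_smult_lzero)
      then show ?thesis by auto
    qed
    also have "(\<lambda>v. vec.span {v}) ` {v \<in> ?R ` M. v \<noteq> 0} = proj_points (?R ` M)"
      unfolding proj_points_eq[OF max_sing_subspace[OF RM]] by auto
    finally show ?thesis .
  qed
  have swap: "(`) \<theta> ` F b \<subseteq> F (\<not> b)" for b
  proof
    fix X assume "X \<in> (`) \<theta> ` F b"
    then obtain W where W: "max_sing W" "even (vec.dim (M0 \<inter> W)) \<longleftrightarrow> b" "X = \<theta> ` proj_points W"
      unfolding F_def by auto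
    then show "X \<in> F (\<not> b)"
      unfolding F_def img[OF W(1)] W(3) using max_sing_reflection[OF W(1)] flip[OF W(1)] by auto
  qed
  have RR: "\<theta> ` \<theta> ` X = X" if X: "X \<in> F b" for X b
  proof -
    obtain W where W: "max_sing W" "X = proj_points W" using X unfolding F_def by auto
    have "?R ` ?R ` W = W" by (simp add: image_image hyp_reflection_reflection[OF p])
    then show ?thesis using W img[OF W(1)] img[OF max_sing_reflection[OF W(1)]] by simp
  qed
  \<comment> \<open>The inclusions for both labels become equalities, since \<open>\<theta>\<close>
    applied twice restores each member.\<close>
  have swap_eq: "(`) \<theta> ` F b = F (\<not> b)" for b
  proof
    show "F (\<not> b) \<subseteq> (`) \<theta> ` F b"
    proof
      fix X assume X: "X \<in> F (\<not> b)"
      then have "\<theta> ` X \<in> F b" using swap[of "\<not> b"] by auto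
      then show "X \<in> (`) \<theta> ` F b" using RR[OF X] by (metis imageI)
    qed
  qed (rule swap)
  \<comment> \<open>The label of \<open>M0\<close> itself, that is, whether \<open>n\<close> is
    even.\<close>
  let ?b = "even (vec.dim (M0 \<inter> M0))"
  have mem: "proj_points M0 \<in> F ?b" using M0 unfolding F_def by auto
  have "F ?b \<noteq> F (\<not> ?b)"
  proof
    assume "F ?b = F (\<not> ?b)"
    then have "proj_points M0 \<in> F (\<not> ?b)" using mem by simp
    then obtain W where W: "max_sing W" "even (vec.dim (M0 \<inter> W)) \<longleftrightarrow> \<not> ?b"
      "proj_points M0 = proj_points W" unfolding F_def by auto
    then have "M0 = W"
      using proj_points_subset[of M0 W] proj_points_subset[of W M0] M0 max_sing_subspace by blast
    then show False using W by simp
  qed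
  moreover have "families = {F ?b, F (\<not> ?b)}"
  proof
    show "families \<subseteq> {F ?b, F (\<not> ?b)}"
    proof
      fix X :: "('k ^ ('n + 'n)) set set set" assume "X \<in> families"
      then obtain M where M: "max_sing M" "X = same_family `` {proj_points M}"
        unfolding families_def maximal_singular_eq by (auto elim!: quotientE)
      show "X \<in> {F ?b, F (\<not> ?b)}"
        unfolding M(2) cls[OF M(1)] by (cases "even (vec.dim (M0 \<inter> M)) = ?b") simp_all
    qed
    have "F ?b \<in> families" "F (\<not> ?b) \<in> families"
    proof -
      have "proj_points M0 \<in> maximal_singular" "proj_points (?R ` M0) \<in> maximal_singular"
        unfolding maximal_singular_eq using M0 max_sing_reflection by auto
      from this[THEN quotientI, of same_family]
      show "F ?b \<in> families" "F (\<not> ?b) \<in> families"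
        unfolding families_def cls[OF M0] cls[OF max_sing_reflection[OF M0]] flip[OF M0] by simp_all
    qed
    then show "{F ?b, F (\<not> ?b)} \<subseteq> families" by simp
  qed
  moreover have "(`) \<theta> ` F (\<not> ?b) = F ?b" using swap_eq[of "\<not> ?b"] by simp
  ultimately show ?thesis
    unfolding type_rotating_def using swap_eq[of ?b]
    by (intro exI[of _ "F ?b"] exI[of _ "F (\<not> ?b)"] conjI)
qed

end

text \<open>A reflection squares to the identity. It is not the identity on points, because a
  singular vector not orthogonal to \<open>p\<close> is not even collinear to its mirror
  image.\<close>

lemma involution_reflection:
  fixes \<theta> :: "('k::field ^ ('n::finite + 'n)) set \<Rightarrow> ('k ^ ('n + 'n)) set"
  assumes p: "hyp_form p \<noteq> 0"
    and \<theta>: "\<And>v. sing v \<Longrightarrow> \<theta> (vec.span {v}) = vec.span {hyp_reflection p v}"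
  shows "involution \<theta>"
  unfolding involution_def
proof
  show "\<forall>P\<in>polar_points. \<theta> (\<theta> P) = P"
  proof
    fix P :: "('k ^ ('n + 'n)) set" assume "P \<in> polar_points"
    then obtain v where v: "sing v" "P = vec.span {v}" unfolding polar_points_eq by auto
    have "sing (hyp_reflection p v)" using sing_reflection[OF p] v by simp
    then show "\<theta> (\<theta> P) = P" by (simp add: v \<theta> hyp_reflection_reflection[OF p])
  qed
  have "p \<noteq> 0" using p hyp_form_zero by auto
  then obtain e where e: "sing e" "hyp_bil e p \<noteq> 0" using ex_sing_not_perp by blast
  have Re: "sing (hyp_reflection p e)" using sing_reflection[OF p] e by simp
  have "\<not> proportional (hyp_reflection p e) e"
  proof
    assume "proportional (hyp_reflection p e) e"
    then have "hyp_bil (hyp_reflection p e) e = 0"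
      using proportional_hyp_bil sing_hyp_bil_self[OF e(1)] by blast
    moreover have "hyp_bil e (hyp_reflection p e) \<noteq> 0"
      using e p by (simp add: hyp_bil_reflection_self sing_def)
    ultimately show False by (simp add: hyp_bil_commute)
  qed
  then have "\<theta> (vec.span {e}) \<noteq> vec.span {e}"
    unfolding \<theta>[OF e(1)] span_sing_eq_iff[OF Re e(1)] .
  then show "\<exists>P\<in>polar_points. \<theta> P \<noteq> P" using span_sing[OF e(1)] by (rule bexI)
qed

theorem theorem2p6:
  fixes \<theta> :: "('k::field ^ ('n::finite + 'n)) set \<Rightarrow> ('k ^ ('n + 'n)) set"
  assumes "CARD('n) \<ge> 4"
    and "collineation \<theta>"
    and "opposition_diagram_Dn11 \<theta>"
  shows "involution \<theta> \<and>
         (\<exists>S. polar_subspace_B S \<and> (\<forall>P\<in>S. \<theta> P = P)) \<and>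
         type_rotating \<theta>"
proof -
  have "CARD('n) \<ge> 3" using assms(1) by simp
  from collineation_reflection[OF this assms(2,3)] obtain p where p: "hyp_form p \<noteq> 0"
    and \<theta>: "\<And>v. sing v \<Longrightarrow> \<theta> (vec.span {v}) = vec.span {hyp_reflection p v}"
    by blast
  let ?S = "{vec.span {v} |v. sing v \<and> hyp_bil v p = 0}"
  have "\<forall>P\<in>?S. \<theta> P = P" by (auto simp: \<theta> hyp_reflection_perp)
  moreover have "polar_subspace_B ?S" by (rule polar_subspace_B_perp[OF p])
  ultimately have "\<exists>S. polar_subspace_B S \<and> (\<forall>P\<in>S. \<theta> P = P)" by (intro exI[of _ ?S] conjI)
  then show ?thesis
    using involution_reflection[OF p \<theta>] type_rotating_reflection[OF p \<theta>] by simp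
qed

end
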